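(* Let $X$ be a compact Hausdorff space with a regular Borel probability measure $\mu$. Let $\alpha$ be a unital weak*-continuous isometric endomorphism of $L^\infty(X,\mu)$ and suppose that there is a representation $(\mathrm{id},\{S_i\}_{i=1}^n)$ of Stacey's crossed product $L^\infty(X,\mu)\times_\alpha^n\mathbb{N}$ on $L^2(X,\mu)$. Let $m$ be a positive integer. Then the following are equivalent: (1) $L^\infty(X,\mu)\times_\alpha^n\mathbb{N}\simeq L^\infty(X,\mu)\times_\alpha^m\mathbb{N}$ via a $*$-isomorphism that fixes $L^\infty(X,\mu)$ elementwise; (2) there is a representation $(\mathrm{id},\{Q_i\}_{i=1}^m)$ of $L^\infty(X,\mu)\times_\alpha^m\mathbb{N}$ acting on $L^2(X,\mu)$; (3) $n=m$; (4) $L^\infty(X,\mu)\times_\alpha\mathcal{T}_n^+\simeq L^\infty(X,\mu)\times_\alpha\mathcal{T}_m^+$ via a completely isometric isomorphism that fixes $L^\infty(X,\mu)$ elementwise.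
   Context: Here $n$ and $m$ are (finite) positive integers. For a $*$-endomorphism $\alpha\colon A\to A$ of a C*-algebra, Stacey's multiplicity $n$ crossed product $A\times_\alpha^n\mathbb{N}$ is the enveloping (universal) C*-algebra generated by $\pi(A)$ and a Toeplitz–Cuntz family $\{Q_i\}_{i=1}^n$ (isometries with pairwise orthogonal ranges), where $\pi$ is a non-degenerate representation of $A$ and $\pi(\alpha(a))=\sum_{i=1}^n Q_i\pi(a)Q_i^*$ for all $a\in A$. When $\alpha$ is unital, non-degeneracy of $\pi$ is redundant and $\{Q_i\}_{i=1}^n$ can be taken to be a Cuntz family, i.e. $Q_i^*Q_j=\delta_{ij}I$ and $\sum_{i=1}^n Q_iQ_i^*=I$. The semicrossed product $A\times_\alpha\mathcal{T}_n^+$ is the non-involutive closed subalgebra of $A\times_\alpha^n\mathbb{N}$ generated by $\pi(A)$ and $\{Q_i\}_{i=1}^n$. A representation $(\mathrm{id},\{S_i\}_{i=1}^n)$ of $L^\infty(X,\mu)\times_\alpha^n\mathbb{N}$ on $L^2(X,\mu)$ is one in which $L^\infty(X,\mu)$ acts by multiplication operators $M_f$ on $L^2(X,\mu)$, so that $\{S_i\}_{i=1}^n\subset\mathcal{B}(L^2(X,\mu))$ is a Cuntz family with $M_{\alpha(f)}=\sum_{i=1}^n S_iM_fS_i^*$ for all $f\in L^\infty(X,\mu)$. An isomorphism "fixes $L^\infty(X,\mu)$ elementwise" if it sends the canonical copy of each $f\in L^\infty(X,\mu)$ in one algebra to the canonical copy of $f$ in the other. *)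

theory Defs
  imports "HOL-Probability.Probability" "HOL-Algebra.Module"
begin

definition complex_ring :: "complex ring" where
  "complex_ring = \<lparr>carrier = UNIV, mult = (*), one = 1, zero = 0, add = (+)\<rparr>"

section \<open>Hilbert spaces and bounded operators\<close>

text \<open>Hilbert spaces are carrier-based, because the underlying set of \<open>L\<^sup>2(X,\<mu>)\<close> depends on the
  measure. As always for \<^const>\<open>smult\<close>-structures of HOL-Algebra, the multiplicative fields inherited
  from the \<open>ring\<close> record are meaningless here.\<close>

record 'h hilb = "(complex, 'h) module" +
  ip :: "'h \<Rightarrow> 'h \<Rightarrow> complex"

definition hnorm :: "'h hilb \<Rightarrow> 'h \<Rightarrow> real" where
  "hnorm H x = sqrt (Re (ip H x x))"

locale complex_hilbert_space = Module.module complex_ring H for H :: "'h hilb" (structure) +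
  assumes ip_add: "\<lbrakk>x \<in> carrier H; y \<in> carrier H; z \<in> carrier H\<rbrakk>
      \<Longrightarrow> ip H (x \<oplus>\<^bsub>H\<^esub> y) z = ip H x z + ip H y z"
    and ip_smult: "\<lbrakk>x \<in> carrier H; y \<in> carrier H\<rbrakk> \<Longrightarrow> ip H (c \<odot>\<^bsub>H\<^esub> x) y = c * ip H x y"
    and ip_cnj: "\<lbrakk>x \<in> carrier H; y \<in> carrier H\<rbrakk> \<Longrightarrow> ip H y x = cnj (ip H x y)"
    and ip_nonneg: "x \<in> carrier H \<Longrightarrow> 0 \<le> Re (ip H x x)"
    and ip_definite: "\<lbrakk>x \<in> carrier H; ip H x x = 0\<rbrakk> \<Longrightarrow> x = \<zero>\<^bsub>H\<^esub>"
    and hcomplete: "\<lbrakk>\<And>k. s k \<in> carrier H;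
        \<forall>e>0. \<exists>N. \<forall>i\<ge>N. \<forall>j\<ge>N. hnorm H (s i \<ominus>\<^bsub>H\<^esub> s j) < e\<rbrakk>
      \<Longrightarrow> \<exists>x\<in>carrier H. (\<lambda>k. hnorm H (s k \<ominus>\<^bsub>H\<^esub> x)) \<longlonglongrightarrow> 0"

definition closed_subspace :: "'h hilb \<Rightarrow> 'h set \<Rightarrow> bool" where
  "closed_subspace H V \<longleftrightarrow> submodule V complex_ring H \<and>
     (\<forall>x\<in>carrier H. (\<forall>e>0. \<exists>v\<in>V. hnorm H (x \<ominus>\<^bsub>H\<^esub> v) < e) \<longrightarrow> x \<in> V)"

record 'b cstar = "(complex, 'b) module" +
  adj :: "'b \<Rightarrow> 'b"
  nrm :: "'b \<Rightarrow> real"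

text \<open>Operators are extensional functions, so that equality in \<open>B(H)\<close> is equality of functions.\<close>

definition bounded_op_set :: "'h hilb \<Rightarrow> ('h \<Rightarrow> 'h) set" where
  "bounded_op_set H = {T \<in> carrier H \<rightarrow>\<^sub>E carrier H.
     (\<forall>x\<in>carrier H. \<forall>y\<in>carrier H. T (x \<oplus>\<^bsub>H\<^esub> y) = T x \<oplus>\<^bsub>H\<^esub> T y) \<and>
     (\<forall>c. \<forall>x\<in>carrier H. T (c \<odot>\<^bsub>H\<^esub> x) = c \<odot>\<^bsub>H\<^esub> T x) \<and>
     (\<exists>C. \<forall>x\<in>carrier H. hnorm H (T x) \<le> C * hnorm H x)}"

definition bounded_ops :: "'h hilb \<Rightarrow> ('h \<Rightarrow> 'h) cstar" where
  "bounded_ops H =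
    \<lparr>carrier = bounded_op_set H,
     mult = (\<lambda>S T. compose (carrier H) S T),
     one = (\<lambda>x\<in>carrier H. x),
     zero = (\<lambda>x\<in>carrier H. \<zero>\<^bsub>H\<^esub>),
     add = (\<lambda>S T. \<lambda>x\<in>carrier H. S x \<oplus>\<^bsub>H\<^esub> T x),
     smult = (\<lambda>c T. \<lambda>x\<in>carrier H. c \<odot>\<^bsub>H\<^esub> T x),
     adj = (\<lambda>T. THE S. S \<in> bounded_op_set H \<and>
        (\<forall>x\<in>carrier H. \<forall>y\<in>carrier H. ip H (T x) y = ip H x (S y))),
     nrm = (\<lambda>T. SUP x\<in>{x\<in>carrier H. hnorm H x \<le> 1}. hnorm H (T x))\<rparr>"

text \<open>The norm of the \<open>k \<times> k\<close> operator matrix \<open>T\<close> acting on the \<open>k\<close>-fold Hilbert sum of \<open>H\<close>.\<close>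

definition op_matrix_norm :: "'h hilb \<Rightarrow> nat \<Rightarrow> (nat \<Rightarrow> nat \<Rightarrow> 'h \<Rightarrow> 'h) \<Rightarrow> real" where
  "op_matrix_norm H k T =
     (SUP \<xi>\<in>{\<xi> \<in> {..<k} \<rightarrow>\<^sub>E carrier H. (\<Sum>j<k. (hnorm H (\<xi> j))\<^sup>2) \<le> 1}.
        sqrt (\<Sum>i<k. (hnorm H (finsum H (\<lambda>j. T i j (\<xi> j)) {..<k}))\<^sup>2))"

section \<open>Homomorphisms and generated subalgebras\<close>

definition alg_hom :: "'b cstar \<Rightarrow> 'd cstar \<Rightarrow> ('b \<Rightarrow> 'd) \<Rightarrow> bool" where
  "alg_hom A B \<phi> \<longleftrightarrow> \<phi> \<in> carrier A \<rightarrow> carrier B \<and>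
     (\<forall>x\<in>carrier A. \<forall>y\<in>carrier A. \<phi> (x \<oplus>\<^bsub>A\<^esub> y) = \<phi> x \<oplus>\<^bsub>B\<^esub> \<phi> y) \<and>
     (\<forall>x\<in>carrier A. \<forall>y\<in>carrier A. \<phi> (x \<otimes>\<^bsub>A\<^esub> y) = \<phi> x \<otimes>\<^bsub>B\<^esub> \<phi> y) \<and>
     (\<forall>c. \<forall>x\<in>carrier A. \<phi> (c \<odot>\<^bsub>A\<^esub> x) = c \<odot>\<^bsub>B\<^esub> \<phi> x)"

definition star_hom :: "'b cstar \<Rightarrow> 'd cstar \<Rightarrow> ('b \<Rightarrow> 'd) \<Rightarrow> bool" where
  "star_hom A B \<phi> \<longleftrightarrow> alg_hom A B \<phi> \<and> (\<forall>x\<in>carrier A. \<phi> (adj A x) = adj B (\<phi> x))"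

definition alg_iso :: "'b cstar \<Rightarrow> 'd cstar \<Rightarrow> ('b \<Rightarrow> 'd) \<Rightarrow> bool" where
  "alg_iso A B \<phi> \<longleftrightarrow> alg_hom A B \<phi> \<and> bij_betw \<phi> (carrier A) (carrier B)"

definition star_iso :: "'b cstar \<Rightarrow> 'd cstar \<Rightarrow> ('b \<Rightarrow> 'd) \<Rightarrow> bool" where
  "star_iso A B \<phi> \<longleftrightarrow> star_hom A B \<phi> \<and> bij_betw \<phi> (carrier A) (carrier B)"

definition closed_subalgebra :: "'b cstar \<Rightarrow> 'b set \<Rightarrow> bool" where
  "closed_subalgebra B V \<longleftrightarrow> submodule V complex_ring B \<and>
     (\<forall>x\<in>V. \<forall>y\<in>V. x \<otimes>\<^bsub>B\<^esub> y \<in> V) \<and>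
     (\<forall>x\<in>carrier B. (\<forall>e>0. \<exists>v\<in>V. nrm B (x \<ominus>\<^bsub>B\<^esub> v) < e) \<longrightarrow> x \<in> V)"

definition closed_star_subalgebra :: "'b cstar \<Rightarrow> 'b set \<Rightarrow> bool" where
  "closed_star_subalgebra B V \<longleftrightarrow> closed_subalgebra B V \<and> (\<forall>x\<in>V. adj B x \<in> V)"

text \<open>The C*-algebra of norm-bounded families \<open>(x\<^sub>r)\<^sub>r\<close> with \<open>x\<^sub>r \<in> B\<^sub>r\<close>, with the supremum norm.\<close>

definition cstar_prod :: "'r set \<Rightarrow> ('r \<Rightarrow> 'b cstar) \<Rightarrow> ('r \<Rightarrow> 'b) cstar" where
  "cstar_prod R B =
    \<lparr>carrier = {x \<in> (\<Pi>\<^sub>E r\<in>R. carrier (B r)). \<exists>C. \<forall>r\<in>R. nrm (B r) (x r) \<le> C},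
     mult = (\<lambda>x y. \<lambda>r\<in>R. x r \<otimes>\<^bsub>B r\<^esub> y r),
     one = (\<lambda>r\<in>R. \<one>\<^bsub>B r\<^esub>),
     zero = (\<lambda>r\<in>R. \<zero>\<^bsub>B r\<^esub>),
     add = (\<lambda>x y. \<lambda>r\<in>R. x r \<oplus>\<^bsub>B r\<^esub> y r),
     smult = (\<lambda>c x. \<lambda>r\<in>R. c \<odot>\<^bsub>B r\<^esub> x r),
     adj = (\<lambda>x. \<lambda>r\<in>R. adj (B r) (x r)),
     nrm = (\<lambda>x. SUP r\<in>R. nrm (B r) (x r))\<rparr>"

section \<open>Stacey's crossed product\<close>

text \<open>Isometries with pairwise orthogonal ranges, indexed by \<open>0, \<dots>, n - 1\<close>.\<close>

definition toeplitz_cuntz_family :: "'b cstar \<Rightarrow> nat \<Rightarrow> (nat \<Rightarrow> 'b) \<Rightarrow> bool" where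
  "toeplitz_cuntz_family B n Q \<longleftrightarrow> (\<forall>i<n. Q i \<in> carrier B) \<and>
     (\<forall>i<n. \<forall>j<n. adj B (Q i) \<otimes>\<^bsub>B\<^esub> Q j = (if i = j then \<one>\<^bsub>B\<^esub> else \<zero>\<^bsub>B\<^esub>))"

definition cuntz_family :: "'b cstar \<Rightarrow> nat \<Rightarrow> (nat \<Rightarrow> 'b) \<Rightarrow> bool" where
  "cuntz_family B n Q \<longleftrightarrow> toeplitz_cuntz_family B n Q \<and>
     finsum B (\<lambda>i. Q i \<otimes>\<^bsub>B\<^esub> adj B (Q i)) {..<n} = \<one>\<^bsub>B\<^esub>"

definition implements :: "'c cstar \<Rightarrow> ('c \<Rightarrow> 'c) \<Rightarrow> nat \<Rightarrow> 'b cstar \<Rightarrow> ('c \<Rightarrow> 'b) \<Rightarrow> (nat \<Rightarrow> 'b) \<Rightarrow> bool"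
  where "implements A \<alpha> n B \<pi> Q \<longleftrightarrow>
     (\<forall>a\<in>carrier A. \<pi> (\<alpha> a) = finsum B (\<lambda>i. Q i \<otimes>\<^bsub>B\<^esub> \<pi> a \<otimes>\<^bsub>B\<^esub> adj B (Q i)) {..<n})"

definition nondegenerate :: "'c cstar \<Rightarrow> 'h hilb \<Rightarrow> ('c \<Rightarrow> 'h \<Rightarrow> 'h) \<Rightarrow> bool" where
  "nondegenerate A H \<pi> \<longleftrightarrow>
     (closed_subspace H) hull {\<pi> a x |a x. a \<in> carrier A \<and> x \<in> carrier H} = carrier H"

type_synonym 'c rep = "'c hilb \<times> ('c \<Rightarrow> 'c \<Rightarrow> 'c) \<times> (nat \<Rightarrow> 'c \<Rightarrow> 'c)"

text \<open>All representations \<open>(\<pi>, {Q\<^sub>i})\<close> on Hilbert spaces \<open>H\<close> whose underlying set consists of elements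
  of the type in which \<open>A\<close> lives. This bound on the size of \<open>H\<close> loses nothing: every
  representation is a direct sum of cyclic ones, and a Hilbert space that is cyclic for \<open>\<pi>(A)\<close> and
  finitely many \<open>Q\<^sub>i\<close> has a dense subset of cardinality at most \<open>|A|\<close> and hence (if \<open>A \<noteq> 0\<close>) at most
  \<open>|A|\<^sup>\<omega> = |A|\<close> elements (a nonzero Banach space has as many elements as sequences of elements),
  so it can be transported into the type of \<open>A\<close>.\<close>

definition stacey_reps :: "'c cstar \<Rightarrow> ('c \<Rightarrow> 'c) \<Rightarrow> nat \<Rightarrow> 'c rep set" where
  "stacey_reps A \<alpha> n = {(H, \<pi>, Q).
     complex_hilbert_space H \<and> star_hom A (bounded_ops H) \<pi> \<and> nondegenerate A H \<pi> \<and>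
     toeplitz_cuntz_family (bounded_ops H) n Q \<and> implements A \<alpha> n (bounded_ops H) \<pi> Q}"

definition stacey_ambient :: "'c cstar \<Rightarrow> ('c \<Rightarrow> 'c) \<Rightarrow> nat \<Rightarrow> ('c rep \<Rightarrow> 'c \<Rightarrow> 'c) cstar" where
  "stacey_ambient A \<alpha> n = cstar_prod (stacey_reps A \<alpha> n) (\<lambda>r. bounded_ops (fst r))"

definition stacey_incl :: "'c cstar \<Rightarrow> ('c \<Rightarrow> 'c) \<Rightarrow> nat \<Rightarrow> 'c \<Rightarrow> 'c rep \<Rightarrow> 'c \<Rightarrow> 'c" where
  "stacey_incl A \<alpha> n a = (\<lambda>(H, \<pi>, Q)\<in>stacey_reps A \<alpha> n. \<pi> a)"

definition stacey_isom :: "'c cstar \<Rightarrow> ('c \<Rightarrow> 'c) \<Rightarrow> nat \<Rightarrow> nat \<Rightarrow> 'c rep \<Rightarrow> 'c \<Rightarrow> 'c" where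
  "stacey_isom A \<alpha> n i = (\<lambda>(H, \<pi>, Q)\<in>stacey_reps A \<alpha> n. Q i)"

definition stacey_gens :: "'c cstar \<Rightarrow> ('c \<Rightarrow> 'c) \<Rightarrow> nat \<Rightarrow> ('c rep \<Rightarrow> 'c \<Rightarrow> 'c) set" where
  "stacey_gens A \<alpha> n = stacey_incl A \<alpha> n ` carrier A \<union> stacey_isom A \<alpha> n ` {..<n}"

text \<open>\<open>A \<times>\<^sub>\<alpha>\<^sup>n \<nat>\<close> is the C*-algebra generated by the image of \<open>A\<close> and of the isometries under the
  universal representation (the direct sum of all representations); the semicrossed product
  \<open>A \<times>\<^sub>\<alpha> T\<^sub>n\<^sup>+\<close> is the closed non-involutive subalgebra generated by the same elements.\<close>

definition stacey_crossed_product ::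
    "'c cstar \<Rightarrow> ('c \<Rightarrow> 'c) \<Rightarrow> nat \<Rightarrow> ('c rep \<Rightarrow> 'c \<Rightarrow> 'c) cstar" where
  "stacey_crossed_product A \<alpha> n = (stacey_ambient A \<alpha> n)
     \<lparr>carrier := closed_star_subalgebra (stacey_ambient A \<alpha> n) hull stacey_gens A \<alpha> n\<rparr>"

definition semicrossed_product ::
    "'c cstar \<Rightarrow> ('c \<Rightarrow> 'c) \<Rightarrow> nat \<Rightarrow> ('c rep \<Rightarrow> 'c \<Rightarrow> 'c) cstar" where
  "semicrossed_product A \<alpha> n = (stacey_ambient A \<alpha> n)
     \<lparr>carrier := closed_subalgebra (stacey_ambient A \<alpha> n) hull stacey_gens A \<alpha> n\<rparr>"

text \<open>The C*-norm on \<open>M\<^sub>k(A \<times>\<^sub>\<alpha>\<^sup>n \<nat>)\<close>, computed in the universal representation.\<close>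

definition stacey_matrix_norm ::
    "'c cstar \<Rightarrow> ('c \<Rightarrow> 'c) \<Rightarrow> nat \<Rightarrow> nat \<Rightarrow> (nat \<Rightarrow> nat \<Rightarrow> 'c rep \<Rightarrow> 'c \<Rightarrow> 'c) \<Rightarrow> real" where
  "stacey_matrix_norm A \<alpha> n k x =
     (SUP r\<in>stacey_reps A \<alpha> n. op_matrix_norm (fst r) k (\<lambda>i j. x i j r))"

definition completely_isometric_on_semicrossed ::
    "'c cstar \<Rightarrow> ('c \<Rightarrow> 'c) \<Rightarrow> nat \<Rightarrow> nat \<Rightarrow> (('c rep \<Rightarrow> 'c \<Rightarrow> 'c) \<Rightarrow> ('c rep \<Rightarrow> 'c \<Rightarrow> 'c)) \<Rightarrow> bool" where
  "completely_isometric_on_semicrossed A \<alpha> n m \<Phi> \<longleftrightarrow>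
     (\<forall>k x. (\<forall>i<k. \<forall>j<k. x i j \<in> carrier (semicrossed_product A \<alpha> n)) \<longrightarrow>
        stacey_matrix_norm A \<alpha> m k (\<lambda>i j. \<Phi> (x i j)) = stacey_matrix_norm A \<alpha> n k x)"

section \<open>The spaces \<open>L\<^sup>2\<close> and \<open>L\<^sup>\<infinity>\<close>\<close>

definition regular_borel :: "'a::topological_space measure \<Rightarrow> bool" where
  "regular_borel M \<longleftrightarrow> sets M = sets borel \<and> (\<forall>B\<in>sets M.
     emeasure M B = (SUP K\<in>{K. compact K \<and> K \<subseteq> B}. emeasure M K) \<and>
     emeasure M B = (INF U\<in>{U. open U \<and> B \<subseteq> U}. emeasure M U))"

definition ae_class :: "'a measure \<Rightarrow> ('a \<Rightarrow> complex) \<Rightarrow> ('a \<Rightarrow> complex) set" where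
  "ae_class M f = {g \<in> borel_measurable M. AE x in M. g x = f x}"

definition ae_rep :: "('a \<Rightarrow> complex) set \<Rightarrow> 'a \<Rightarrow> complex" where
  "ae_rep F = (SOME f. f \<in> F)"

definition ae_map :: "'a measure \<Rightarrow> (complex \<Rightarrow> complex) \<Rightarrow>
    ('a \<Rightarrow> complex) set \<Rightarrow> ('a \<Rightarrow> complex) set" where
  "ae_map M g F = ae_class M (\<lambda>x. g (ae_rep F x))"

definition ae_map2 :: "'a measure \<Rightarrow> (complex \<Rightarrow> complex \<Rightarrow> complex) \<Rightarrow>
    ('a \<Rightarrow> complex) set \<Rightarrow> ('a \<Rightarrow> complex) set \<Rightarrow> ('a \<Rightarrow> complex) set" where
  "ae_map2 M g F G = ae_class M (\<lambda>x. g (ae_rep F x) (ae_rep G x))"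

definition L2 :: "'a measure \<Rightarrow> ('a \<Rightarrow> complex) set hilb" where
  "L2 M =
    \<lparr>carrier = ae_class M ` {f \<in> borel_measurable M. integrable M (\<lambda>x. (norm (f x))\<^sup>2)},
     mult = undefined, one = undefined,
     zero = ae_class M (\<lambda>_. 0),
     add = ae_map2 M (+),
     smult = (\<lambda>c. ae_map M ((*) c)),
     ip = (\<lambda>F G. \<integral>x. ae_rep F x * cnj (ae_rep G x) \<partial>M)\<rparr>"

definition Linf :: "'a measure \<Rightarrow> ('a \<Rightarrow> complex) set cstar" where
  "Linf M =
    \<lparr>carrier = ae_class M ` {f \<in> borel_measurable M. \<exists>C. AE x in M. norm (f x) \<le> C},
     mult = ae_map2 M (*),
     one = ae_class M (\<lambda>_. 1),
     zero = ae_class M (\<lambda>_. 0),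
     add = ae_map2 M (+),
     smult = (\<lambda>c. ae_map M ((*) c)),
     adj = ae_map M cnj,
     nrm = (\<lambda>F. real_of_ereal (esssup M (\<lambda>x. ereal (norm (ae_rep F x)))))\<rparr>"

definition weak_star_topology :: "'a measure \<Rightarrow> ('a \<Rightarrow> complex) set topology" where
  "weak_star_topology M = topology_generated_by
     {{F \<in> carrier (Linf M). (\<integral>x. ae_rep F x * g x \<partial>M) \<in> U} |g U. integrable M g \<and> open U}"

definition mult_op :: "'a measure \<Rightarrow> ('a \<Rightarrow> complex) set \<Rightarrow>
    ('a \<Rightarrow> complex) set \<Rightarrow> ('a \<Rightarrow> complex) set" where
  "mult_op M F = (\<lambda>G\<in>carrier (L2 M). ae_map2 M (*) F G)"

text \<open>A representation \<open>(id, {S\<^sub>i})\<close> of \<open>L\<^sup>\<infinity> \<times>\<^sub>\<alpha>\<^sup>n \<nat>\<close> on \<open>L\<^sup>2\<close>.\<close>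

definition L2_stacey_rep :: "'a measure \<Rightarrow> (('a \<Rightarrow> complex) set \<Rightarrow> ('a \<Rightarrow> complex) set) \<Rightarrow> nat \<Rightarrow>
    (nat \<Rightarrow> ('a \<Rightarrow> complex) set \<Rightarrow> ('a \<Rightarrow> complex) set) \<Rightarrow> bool" where
  "L2_stacey_rep M \<alpha> n S \<longleftrightarrow> cuntz_family (bounded_ops (L2 M)) n S \<and>
     implements (Linf M) \<alpha> n (bounded_ops (L2 M)) (mult_op M) S"

end

(*
  A *-isomorphism transports the isometries to a Cuntz family on L^2. If (S_i) and (Q_j) both implement alpha on
  L^2, then the operators S_i^* Q_j commute with all multiplication operators, so T 1 and T^* 1 have equal norms for
  each of them, and summing ||S_i^* Q_j 1||^2 over i and j in both orders gives n = m.

  For the semicrossed products no dilation theory is needed. The universal algebra carries a gauge action of the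
  unitary group of C^m, which makes the coefficients in A of the words of length one well defined and bounded by the
  norm. By the chain rule for these linear parts, applied to approximations of Phi and its inverse by noncommutative
  polynomials, the identity matrix of size m is within epsilon of a product of an m x n and an n x m matrix over
  L^infinity. Evaluation at a point gives m <= n, and the inverse of Phi gives n <= m.
*)

theory Submission
  imports Defs "HOL-Complex_Analysis.Cauchy_Integral_Formula"
begin

section \<open>Hilbert space geometry and the Riesz representation theorem\<close>

lemma complex_ring_simps [simp]:
  "carrier complex_ring = UNIV" "x \<oplus>\<^bsub>complex_ring\<^esub> y = x + y"
  "x \<otimes>\<^bsub>complex_ring\<^esub> y = x * y" "\<one>\<^bsub>complex_ring\<^esub> = 1" "\<zero>\<^bsub>complex_ring\<^esub> = 0"
  by (simp_all add: complex_ring_def)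

lemma cring_complex_ring: "cring complex_ring"
  by (rule cringI; (intro abelian_groupI comm_monoidI)?)
     (auto simp: algebra_simps intro!: exI[of _ "- x" for x])

context complex_hilbert_space
begin

lemma smult_cl [simp, intro]: "x \<in> carrier H \<Longrightarrow> c \<odot> x \<in> carrier H"
  by (rule smult_closed) auto

lemma smult_add_left: "x \<in> carrier H \<Longrightarrow> (a + b) \<odot> x = a \<odot> x \<oplus> b \<odot> x"
  using smult_l_distr[of a b x] by simp

lemma smult_add_right:
  "x \<in> carrier H \<Longrightarrow> y \<in> carrier H \<Longrightarrow> a \<odot> (x \<oplus> y) = a \<odot> x \<oplus> a \<odot> y"
  using smult_r_distr[of a x y] by simp

lemma smult_assoc: "x \<in> carrier H \<Longrightarrow> (a * b) \<odot> x = a \<odot> (b \<odot> x)"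
  using smult_assoc1[of a b x] by simp

lemma smult_1 [simp]: "x \<in> carrier H \<Longrightarrow> 1 \<odot> x = x"
  using smult_one[of x] by simp

lemma smult_0 [simp]: "x \<in> carrier H \<Longrightarrow> 0 \<odot> x = \<zero>"
  using smult_l_null[of x] by simp

lemma uminus_eq_smult: "x \<in> carrier H \<Longrightarrow> \<ominus> x = (-1) \<odot> x"
  by (rule M.minus_equality) (use smult_add_left[of x "-1" 1] in auto)

lemma minus_eq_smult: "x \<in> carrier H \<Longrightarrow> y \<in> carrier H \<Longrightarrow> x \<ominus> y = x \<oplus> (-1) \<odot> y"
  by (simp add: M.minus_eq uminus_eq_smult)

lemma ip_add_right:
  assumes "x \<in> carrier H" "y \<in> carrier H" "z \<in> carrier H"
  shows "ip H x (y \<oplus> z) = ip H x y + ip H x z"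
  using assms ip_cnj[of "y \<oplus> z" x] ip_cnj[of y x] ip_cnj[of z x] by (simp add: ip_add)

lemma ip_smult_right:
  assumes "x \<in> carrier H" "y \<in> carrier H"
  shows "ip H x (c \<odot> y) = cnj c * ip H x y"
  using assms ip_cnj[of "c \<odot> y" x] ip_cnj[of y x] by (simp add: ip_smult)

lemma ip_zero [simp]: "x \<in> carrier H \<Longrightarrow> ip H \<zero> x = 0" "x \<in> carrier H \<Longrightarrow> ip H x \<zero> = 0"
  using ip_smult[of x x 0] ip_smult_right[of x x 0] by simp_all

lemma ip_minus: "x \<in> carrier H \<Longrightarrow> y \<in> carrier H \<Longrightarrow> z \<in> carrier H \<Longrightarrow>
    ip H (x \<ominus> y) z = ip H x z - ip H y z"
  by (simp add: minus_eq_smult ip_add ip_smult)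

lemma ip_minus_right: "x \<in> carrier H \<Longrightarrow> y \<in> carrier H \<Longrightarrow> z \<in> carrier H \<Longrightarrow>
    ip H z (x \<ominus> y) = ip H z x - ip H z y"
  by (simp add: minus_eq_smult ip_add_right ip_smult_right)

lemma hnorm_nonneg [simp]: "x \<in> carrier H \<Longrightarrow> 0 \<le> hnorm H x"
  by (simp add: hnorm_def ip_nonneg)

lemma hnorm_sq: "x \<in> carrier H \<Longrightarrow> (hnorm H x)\<^sup>2 = Re (ip H x x)"
  by (simp add: hnorm_def ip_nonneg)

lemma ip_self: "x \<in> carrier H \<Longrightarrow> ip H x x = of_real ((hnorm H x)\<^sup>2)"
  using ip_cnj[of x x] by (simp add: hnorm_sq complex_eq_iff)

lemma hnorm_eq_0: "x \<in> carrier H \<Longrightarrow> hnorm H x = 0 \<longleftrightarrow> x = \<zero>"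
  using ip_definite[of x] ip_self[of x] by auto

lemma hnorm_zero [simp]: "hnorm H \<zero> = 0"
  by (simp add: hnorm_eq_0)

lemma hnorm_smult: 
  assumes "x \<in> carrier H" shows "hnorm H (c \<odot> x) = cmod c * hnorm H x"
proof -
  have "ip H (c \<odot> x) (c \<odot> x) = (c * cnj c) * ip H x x"
    using assms by (simp add: ip_smult ip_smult_right)
  also have "\<dots> = of_real ((cmod c * hnorm H x)\<^sup>2)"
    using assms by (simp add: ip_self complex_norm_square power_mult_distrib flip: of_real_power)
  finally have "(hnorm H (c \<odot> x))\<^sup>2 = (cmod c * hnorm H x)\<^sup>2"
    using assms by (simp add: hnorm_sq)
  thus ?thesis using assms by (simp add: power2_eq_iff_nonneg)
qed

lemma hnorm_add_sq:
  assumes "x \<in> carrier H" "y \<in> carrier H"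
  shows "(hnorm H (x \<oplus> y))\<^sup>2 = (hnorm H x)\<^sup>2 + (hnorm H y)\<^sup>2 + 2 * Re (ip H x y)"
  using assms ip_cnj[of x y] by (simp add: hnorm_sq ip_add ip_add_right)

lemma hnorm_minus_sq:
  assumes "x \<in> carrier H" "y \<in> carrier H"
  shows "(hnorm H (x \<ominus> y))\<^sup>2 = (hnorm H x)\<^sup>2 + (hnorm H y)\<^sup>2 - 2 * Re (ip H x y)"
  using assms by (simp add: minus_eq_smult hnorm_add_sq hnorm_smult ip_smult_right)

lemma Cauchy_Schwarz:
  assumes x: "x \<in> carrier H" and y: "y \<in> carrier H"
  shows "cmod (ip H x y) \<le> hnorm H x * hnorm H y"
proof (cases "hnorm H y = 0")
  case True
  thus ?thesis using assms by (simp add: hnorm_eq_0)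
next
  case False
  hence pos: "(hnorm H y)\<^sup>2 > 0" by simp
  define c where "c = ip H x y / of_real ((hnorm H y)\<^sup>2)"
  have "0 \<le> Re (ip H (x \<ominus> c \<odot> y) (x \<ominus> c \<odot> y))"
    using assms by (intro ip_nonneg) auto
  also have "ip H (x \<ominus> c \<odot> y) (x \<ominus> c \<odot> y)
     = ip H x x - cnj c * ip H x y - c * cnj (ip H x y) + c * cnj c * ip H y y"
    using assms ip_cnj[of x y] by (simp add: ip_minus ip_minus_right ip_smult ip_smult_right algebra_simps)
  also have "\<dots> = of_real ((hnorm H x)\<^sup>2 - (cmod (ip H x y))\<^sup>2 / (hnorm H y)\<^sup>2)"
    using pos False assms
    by (simp add: c_def ip_self complex_norm_square[symmetric] field_simps)
  finally have "0 \<le> (hnorm H x)\<^sup>2 - (cmod (ip H x y))\<^sup>2 / (hnorm H y)\<^sup>2"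
    by (simp only: Re_complex_of_real)
  hence "(cmod (ip H x y))\<^sup>2 \<le> (hnorm H x)\<^sup>2 * (hnorm H y)\<^sup>2"
    unfolding pos_divide_le_eq[OF pos, symmetric] by linarith
  hence "(cmod (ip H x y))\<^sup>2 \<le> (hnorm H x * hnorm H y)\<^sup>2"
    by (simp only: power_mult_distrib)
  thus ?thesis by (rule power2_le_imp_le) (use assms in auto)
qed

lemma hnorm_triangle:
  assumes "x \<in> carrier H" "y \<in> carrier H"
  shows "hnorm H (x \<oplus> y) \<le> hnorm H x + hnorm H y"
proof (rule power2_le_imp_le)
  have "Re (ip H x y) \<le> hnorm H x * hnorm H y"
    using Cauchy_Schwarz[OF assms] complex_Re_le_cmod order_trans by blast
  thus "(hnorm H (x \<oplus> y))\<^sup>2 \<le> (hnorm H x + hnorm H y)\<^sup>2"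
    using assms by (simp add: hnorm_add_sq power2_sum)
qed (use assms in auto)

lemma hnorm_triangle_minus:
  assumes "x \<in> carrier H" "y \<in> carrier H"
  shows "hnorm H (x \<ominus> y) \<le> hnorm H x + hnorm H y"
  using hnorm_triangle[of x "(-1) \<odot> y"] assms by (simp add: minus_eq_smult hnorm_smult)

lemma hnorm_le_by_ip:
  assumes "x \<in> carrier H" "0 \<le> C" "\<And>y. y \<in> carrier H \<Longrightarrow> cmod (ip H x y) \<le> C * hnorm H y"
  shows "hnorm H x \<le> C"
proof (cases "hnorm H x = 0")
  case False
  have "(hnorm H x)\<^sup>2 \<le> C * hnorm H x"
    using assms(3)[of x] assms(1) by (simp add: ip_self norm_power)
  thus ?thesis using False assms(1) by (simp add: power2_eq_square order.strict_iff_order)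
qed (use assms in auto)

lemma eq_by_ip:
  assumes "x \<in> carrier H" "y \<in> carrier H" "\<And>z. z \<in> carrier H \<Longrightarrow> ip H x z = ip H y z"
  shows "x = y"
proof -
  have "ip H (x \<ominus> y) (x \<ominus> y) = 0"
    using assms(1,2) assms(3)[of "x \<ominus> y"] by (simp add: ip_minus)
  hence "x \<ominus> y = \<zero>" using assms by (intro ip_definite) auto
  thus ?thesis using assms(1,2) by (metis M.minus_eq M.add.inv_solve_right' M.l_zero M.zero_closed)
qed

lemma eq_by_ip_right:
  assumes "x \<in> carrier H" "y \<in> carrier H" "\<And>z. z \<in> carrier H \<Longrightarrow> ip H z x = ip H z y"
  shows "x = y"
proof (rule eq_by_ip[OF assms(1,2)])
  fix z assume "z \<in> carrier H"
  thus "ip H x z = ip H y z"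
    using assms(3)[of z] ip_cnj[of z x] ip_cnj[of z y] assms(1,2) by simp
qed

text \<open>The representing vector minimises \<open>\<parallel>x\<parallel>\<^sup>2 - 2 Re \<phi> x\<close>.\<close>

lemma Riesz_representation:
  assumes add: "\<And>x y. x \<in> carrier H \<Longrightarrow> y \<in> carrier H \<Longrightarrow> \<phi> (x \<oplus> y) = \<phi> x + \<phi> y"
    and sm: "\<And>c x. x \<in> carrier H \<Longrightarrow> \<phi> (c \<odot> x) = c * \<phi> x"
    and bd: "\<And>x. x \<in> carrier H \<Longrightarrow> cmod (\<phi> x) \<le> C * hnorm H x"
  shows "\<exists>y\<in>carrier H. \<forall>x\<in>carrier H. \<phi> x = ip H x y"
proof -
  define J where "J x = (hnorm H x)\<^sup>2 - 2 * Re (\<phi> x)" for x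
  have J_ge: "J x \<ge> - (C\<^sup>2)" if "x \<in> carrier H" for x
  proof -
    have "Re (\<phi> x) \<le> C * hnorm H x" using bd[OF that] complex_Re_le_cmod order_trans by blast
    moreover have "0 \<le> (hnorm H x - C)\<^sup>2" by simp
    ultimately show ?thesis unfolding J_def power2_diff by (simp only: mult_ac)
  qed
  define d where "d = Inf (J ` carrier H)"
  have ne: "J ` carrier H \<noteq> {}" using M.zero_closed by blast
  have bb: "bdd_below (J ` carrier H)" using J_ge by (intro bdd_belowI[of _ "- (C\<^sup>2)"]) auto
  have d_le: "d \<le> J x" if "x \<in> carrier H" for x
    unfolding d_def using bb that by (intro cInf_lower) auto
  have "\<exists>x\<in>carrier H. J x < d + 1 / real (Suc k)" for k
    using cInf_lessD[OF ne, of "d + 1 / real (Suc k)"] unfolding d_def by auto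
  then obtain s where s: "\<And>k. s k \<in> carrier H" "\<And>k. J (s k) < d + 1 / real (Suc k)" by metis
  have dist: "(hnorm H (x \<ominus> y))\<^sup>2 \<le> 2 * (J x + J y - 2 * d)" if xy: "x \<in> carrier H" "y \<in> carrier H" for x y
  proof -
    let ?m = "(1/2) \<odot> (x \<oplus> y)"
    have "(hnorm H ?m)\<^sup>2 = ((hnorm H x)\<^sup>2 + (hnorm H y)\<^sup>2 + 2 * Re (ip H x y)) / 4"
      using xy by (simp add: hnorm_smult power_mult_distrib hnorm_add_sq power_divide)
    moreover have "Re (\<phi> ?m) = (Re (\<phi> x) + Re (\<phi> y)) / 2" using xy by (simp add: sm add)
    moreover have "d \<le> J ?m" using xy by (intro d_le) auto
    ultimately show ?thesis unfolding J_def hnorm_minus_sq[OF xy] by argo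
  qed
  have cauchy: "\<forall>e>0. \<exists>N. \<forall>i\<ge>N. \<forall>j\<ge>N. hnorm H (s i \<ominus> s j) < e"
  proof (intro allI impI)
    fix e :: real assume e: "e > 0"
    obtain N where N: "1 / real (Suc N) < e\<^sup>2 / 4"
      using e nat_approx_posE[of "e\<^sup>2/4"] by auto
    have "hnorm H (s i \<ominus> s j) < e" if "i \<ge> N" "j \<ge> N" for i j
    proof (rule power2_less_imp_less)
      have JN: "J (s l) < d + e\<^sup>2 / 4" if "l \<ge> N" for l
      proof -
        have "1 / real (Suc l) \<le> 1 / real (Suc N)" using that by (auto intro!: divide_left_mono)
        thus ?thesis using s(2)[of l] N by (meson add_le_cancel_left less_le_trans order_less_le_trans less_imp_le le_less_trans)
      qed
      thus "(hnorm H (s i \<ominus> s j))\<^sup>2 < e\<^sup>2"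
        using dist[OF s(1) s(1), of i j] JN[of i] JN[of j] that by argo
    qed (use e in auto)
    thus "\<exists>N. \<forall>i\<ge>N. \<forall>j\<ge>N. hnorm H (s i \<ominus> s j) < e" by blast
  qed
  obtain y where y: "y \<in> carrier H" and lim: "(\<lambda>k. hnorm H (s k \<ominus> y)) \<longlonglongrightarrow> 0"
    using hcomplete[OF s(1) cauchy] by blast
  have re: "Re (\<phi> h) = Re (ip H h y)" if h: "h \<in> carrier H" for h
  proof (rule ccontr)
    assume neq: "Re (\<phi> h) \<noteq> Re (ip H h y)"
    define b where "b = Re (ip H h y) - Re (\<phi> h)"
    have b: "b \<noteq> 0" using neq by (simp add: b_def)
    define t where "t = - b / ((hnorm H h)\<^sup>2 + 1)"
    have key: "- (1 / real (Suc k)) \<le> 2 * t * (b + Re (ip H h (s k \<ominus> y))) + t\<^sup>2 * (hnorm H h)\<^sup>2" for k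
    proof -
      have "d \<le> J (s k \<oplus> of_real t \<odot> h)" using s(1) h by (intro d_le) auto
      also have "\<dots> = J (s k) + 2 * t * (Re (ip H h (s k)) - Re (\<phi> h)) + t\<^sup>2 * (hnorm H h)\<^sup>2"
        using s(1)[of k] h ip_cnj[of h "s k"]
        by (simp add: J_def hnorm_add_sq hnorm_smult add sm ip_smult_right power_mult_distrib algebra_simps)
      finally show ?thesis using s(2)[of k] s(1)[of k] h y by (simp add: ip_minus_right b_def)
    qed
    have l1: "(\<lambda>k. Re (ip H h (s k \<ominus> y))) \<longlonglongrightarrow> 0"
    proof (rule Lim_null_comparison[OF always_eventually])
      show "\<forall>k. norm (Re (ip H h (s k \<ominus> y))) \<le> hnorm H h * hnorm H (s k \<ominus> y)"
      proof
        fix k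
        have "cmod (ip H h (s k \<ominus> y)) \<le> hnorm H h * hnorm H (s k \<ominus> y)"
          using Cauchy_Schwarz[OF h] s(1) y by auto
        thus "norm (Re (ip H h (s k \<ominus> y))) \<le> hnorm H h * hnorm H (s k \<ominus> y)"
          using abs_Re_le_cmod[of "ip H h (s k \<ominus> y)"] by simp
      qed
      show "(\<lambda>k. hnorm H h * hnorm H (s k \<ominus> y)) \<longlonglongrightarrow> 0"
        using tendsto_mult_right_zero[OF lim] by simp
    qed
    have l2: "(\<lambda>k. - (1 / real (Suc k))) \<longlonglongrightarrow> - 0"
      by (intro tendsto_minus) (rule lim_1_over_n[THEN LIMSEQ_Suc])
    have "(\<lambda>k. 2 * t * (b + Re (ip H h (s k \<ominus> y))) + t\<^sup>2 * (hnorm H h)\<^sup>2) \<longlonglongrightarrow> 2 * t * (b + 0) + t\<^sup>2 * (hnorm H h)\<^sup>2"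
      by (intro tendsto_intros l1)
    hence "- 0 \<le> 2 * t * (b + 0) + t\<^sup>2 * (hnorm H h)\<^sup>2"
      by (rule LIMSEQ_le[OF l2]) (use key in auto)
    moreover have "t\<^sup>2 * (hnorm H h)\<^sup>2 \<le> t\<^sup>2 * ((hnorm H h)\<^sup>2 + 1)"
      by (intro mult_left_mono) auto
    moreover have sp: "(hnorm H h)\<^sup>2 + 1 > 0" by (intro add_nonneg_pos) auto
    moreover have tb: "t * ((hnorm H h)\<^sup>2 + 1) = - b" using sp by (simp add: t_def)
    have "t\<^sup>2 * ((hnorm H h)\<^sup>2 + 1) = t * (t * ((hnorm H h)\<^sup>2 + 1))" by (simp add: power2_eq_square)
    hence e: "t\<^sup>2 * ((hnorm H h)\<^sup>2 + 1) = - (t * b)" by (simp only: tb mult_minus_right)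
    moreover have "t \<noteq> 0" using tb b by auto
    hence "t\<^sup>2 * ((hnorm H h)\<^sup>2 + 1) > 0" using sp by simp
    moreover have "2 * t * (b + 0) = 2 * (t * b)" by simp
    ultimately show False by linarith
  qed
  have "\<phi> x = ip H x y" if x: "x \<in> carrier H" for x
    using re[OF x] re[of "\<i> \<odot> x"] x y by (simp add: sm ip_smult complex_eq_iff)
  thus ?thesis using y by blast
qed

end

section \<open>Normed algebras\<close>

lemma (in abelian_monoid) finsum_lessThan_Suc:
  assumes "\<And>i. i < Suc k \<Longrightarrow> f i \<in> carrier G"
  shows "finsum G f {..<Suc k} = f k \<oplus> finsum G f {..<k}"
  unfolding lessThan_Suc using assms by (intro finsum_insert) auto

locale normed_algebra = ring B for B :: "'b cstar" (structure) +
  assumes smult_cl: "x \<in> carrier B \<Longrightarrow> c \<odot> x \<in> carrier B"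
    and smult_add_left: "x \<in> carrier B \<Longrightarrow> (c + d) \<odot> x = c \<odot> x \<oplus> d \<odot> x"
    and smult_add_right: "\<lbrakk>x \<in> carrier B; y \<in> carrier B\<rbrakk> \<Longrightarrow> c \<odot> (x \<oplus> y) = c \<odot> x \<oplus> c \<odot> y"
    and smult_assoc: "x \<in> carrier B \<Longrightarrow> (c * d) \<odot> x = c \<odot> (d \<odot> x)"
    and smult_1: "x \<in> carrier B \<Longrightarrow> 1 \<odot> x = x"
    and smult_mult_left: "\<lbrakk>x \<in> carrier B; y \<in> carrier B\<rbrakk> \<Longrightarrow> (c \<odot> x) \<otimes> y = c \<odot> (x \<otimes> y)"
    and smult_mult_right: "\<lbrakk>x \<in> carrier B; y \<in> carrier B\<rbrakk> \<Longrightarrow> x \<otimes> (c \<odot> y) = c \<odot> (x \<otimes> y)"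
    and nrm_nonneg: "x \<in> carrier B \<Longrightarrow> 0 \<le> nrm B x"
    and nrm_one: "nrm B \<one> \<le> 1"
    and nrm_zero: "nrm B \<zero> = 0"
    and nrm_triangle: "\<lbrakk>x \<in> carrier B; y \<in> carrier B\<rbrakk> \<Longrightarrow> nrm B (x \<oplus> y) \<le> nrm B x + nrm B y"
    and nrm_mult: "\<lbrakk>x \<in> carrier B; y \<in> carrier B\<rbrakk> \<Longrightarrow> nrm B (x \<otimes> y) \<le> nrm B x * nrm B y"
    and nrm_smult: "x \<in> carrier B \<Longrightarrow> nrm B (c \<odot> x) \<le> cmod c * nrm B x"
begin

lemma smult_0: assumes "x \<in> carrier B" shows "0 \<odot> x = \<zero>"
proof -
  have "0 \<odot> x \<oplus> 0 \<odot> x = 0 \<odot> x"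
    using smult_add_left[OF assms, of 0 0] by simp
  thus ?thesis using smult_cl[OF assms, of 0] by (metis add.l_cancel_one')
qed

lemma uminus_eq_smult: "x \<in> carrier B \<Longrightarrow> \<ominus> x = (-1) \<odot> x"
  by (rule minus_equality) (use smult_add_left[of x "-1" 1] smult_0[of x] smult_1[of x] smult_cl in auto)

lemma minus_eq_smult: "x \<in> carrier B \<Longrightarrow> y \<in> carrier B \<Longrightarrow> x \<ominus> y = x \<oplus> (-1) \<odot> y"
  by (simp add: minus_eq uminus_eq_smult)

lemma nrm_triangle_minus:
  "\<lbrakk>x \<in> carrier B; y \<in> carrier B\<rbrakk> \<Longrightarrow> nrm B (x \<ominus> y) \<le> nrm B x + nrm B y"
  using nrm_triangle[of x "(-1) \<odot> y"] nrm_smult[of y "-1"] smult_cl[of y "-1"]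
  by (simp add: minus_eq_smult)

lemma nrm_minus_trans:
  assumes "x \<in> carrier B" "y \<in> carrier B" "z \<in> carrier B"
  shows "nrm B (x \<ominus> z) \<le> nrm B (x \<ominus> y) + nrm B (y \<ominus> z)"
proof -
  have "x \<ominus> z = (x \<ominus> y) \<oplus> (y \<ominus> z)" using assms by algebra
  thus ?thesis using assms nrm_triangle[of "x \<ominus> y" "y \<ominus> z"] by simp
qed

lemma closed_subalgebraI:
  assumes "V \<subseteq> carrier B" "\<zero> \<in> V"
    and "\<And>x y. x \<in> V \<Longrightarrow> y \<in> V \<Longrightarrow> x \<oplus> y \<in> V"
    and sm: "\<And>c x. x \<in> V \<Longrightarrow> c \<odot> x \<in> V"
    and "\<And>x y. x \<in> V \<Longrightarrow> y \<in> V \<Longrightarrow> x \<otimes> y \<in> V"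
    and "\<And>x. x \<in> carrier B \<Longrightarrow> (\<And>e. e > 0 \<Longrightarrow> \<exists>v\<in>V. nrm B (x \<ominus> v) < e) \<Longrightarrow> x \<in> V"
  shows "closed_subalgebra B V"
  unfolding closed_subalgebra_def
proof (intro conjI ballI allI impI)
  show "submodule V complex_ring B"
  proof
    fix x assume "x \<in> V"
    hence "\<ominus> x \<in> V" using sm[of x "-1"] assms(1) by (auto simp: uminus_eq_smult)
    thus "inv\<^bsub>add_monoid B\<^esub> x \<in> V" by (simp add: a_inv_def)
  qed (use assms in auto)
qed (use assms in auto)

end

section \<open>The algebra of bounded operators\<close>

lemma carrier_bounded_ops [simp]: "carrier (bounded_ops H) = bounded_op_set H"
  by (simp add: bounded_ops_def)

lemma bounded_ops_simps:
  "S \<otimes>\<^bsub>bounded_ops H\<^esub> T = compose (carrier H) S T"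
  "\<one>\<^bsub>bounded_ops H\<^esub> = (\<lambda>x\<in>carrier H. x)"
  "\<zero>\<^bsub>bounded_ops H\<^esub> = (\<lambda>x\<in>carrier H. \<zero>\<^bsub>H\<^esub>)"
  "S \<oplus>\<^bsub>bounded_ops H\<^esub> T = (\<lambda>x\<in>carrier H. S x \<oplus>\<^bsub>H\<^esub> T x)"
  "c \<odot>\<^bsub>bounded_ops H\<^esub> T = (\<lambda>x\<in>carrier H. c \<odot>\<^bsub>H\<^esub> T x)"
  by (simp_all add: bounded_ops_def)

lemma nrm_bounded_ops: "nrm (bounded_ops H) T = (SUP x\<in>{x\<in>carrier H. hnorm H x \<le> 1}. hnorm H (T x))"
  by (simp add: bounded_ops_def)

context complex_hilbert_space
begin

abbreviation BH where "BH \<equiv> bounded_ops H"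

lemma op_cl [simp, intro]: "T \<in> bounded_op_set H \<Longrightarrow> x \<in> carrier H \<Longrightarrow> T x \<in> carrier H"
  by (auto simp: bounded_op_set_def)

lemma op_add: "T \<in> bounded_op_set H \<Longrightarrow> x \<in> carrier H \<Longrightarrow> y \<in> carrier H \<Longrightarrow> T (x \<oplus> y) = T x \<oplus> T y"
  by (auto simp: bounded_op_set_def)

lemma op_smult: "T \<in> bounded_op_set H \<Longrightarrow> x \<in> carrier H \<Longrightarrow> T (c \<odot> x) = c \<odot> T x"
  by (auto simp: bounded_op_set_def)

lemma op_zero: "T \<in> bounded_op_set H \<Longrightarrow> T \<zero> = \<zero>"
  using op_smult[of T "\<zero>" 0] by simp

lemma op_eqI:
  assumes "S \<in> bounded_op_set H" "T \<in> bounded_op_set H" "\<And>x. x \<in> carrier H \<Longrightarrow> S x = T x"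
  shows "S = T"
proof (rule PiE_ext)
  show "S \<in> carrier H \<rightarrow>\<^sub>E carrier H" "T \<in> carrier H \<rightarrow>\<^sub>E carrier H"
    using assms(1,2) by (auto simp: bounded_op_set_def)
qed (use assms(3) in auto)

lemma op_eqI_ip:
  assumes "S \<in> bounded_op_set H" "T \<in> bounded_op_set H"
    and "\<And>x y. x \<in> carrier H \<Longrightarrow> y \<in> carrier H \<Longrightarrow> ip H (S x) y = ip H (T x) y"
  shows "S = T"
  using assms by (intro op_eqI eq_by_ip) auto

lemma op_bound:
  assumes "T \<in> bounded_op_set H"
  obtains C where "C \<ge> 0" "\<And>x. x \<in> carrier H \<Longrightarrow> hnorm H (T x) \<le> C * hnorm H x"
proof -
  obtain C where C: "\<And>x. x \<in> carrier H \<Longrightarrow> hnorm H (T x) \<le> C * hnorm H x"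
    using assms unfolding bounded_op_set_def by blast
  have "hnorm H (T x) \<le> \<bar>C\<bar> * hnorm H x" if "x \<in> carrier H" for x
    using C[OF that] that by (elim order_trans) (auto intro!: mult_right_mono)
  thus ?thesis by (intro that[of "\<bar>C\<bar>"]) auto
qed

lemma opI:
  assumes "T \<in> carrier H \<rightarrow>\<^sub>E carrier H"
    and "\<And>x y. x \<in> carrier H \<Longrightarrow> y \<in> carrier H \<Longrightarrow> T (x \<oplus> y) = T x \<oplus> T y"
    and "\<And>c x. x \<in> carrier H \<Longrightarrow> T (c \<odot> x) = c \<odot> T x"
    and "\<And>x. x \<in> carrier H \<Longrightarrow> hnorm H (T x) \<le> C * hnorm H x"
  shows "T \<in> bounded_op_set H"
  unfolding bounded_op_set_def
  by (intro CollectI conjI exI[of _ C] ballI allI) (fact assms)+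

lemma nrm_op_bdd:
  assumes "T \<in> bounded_op_set H"
  shows "bdd_above ((\<lambda>x. hnorm H (T x)) ` {x\<in>carrier H. hnorm H x \<le> 1})"
proof -
  obtain C where C: "C \<ge> 0" "\<And>x. x \<in> carrier H \<Longrightarrow> hnorm H (T x) \<le> C * hnorm H x"
    using op_bound[OF assms] by blast
  show ?thesis
  proof (rule bdd_aboveI2)
    fix x assume "x \<in> {x\<in>carrier H. hnorm H x \<le> 1}"
    thus "hnorm H (T x) \<le> C" using C(2)[of x] mult_left_mono[of "hnorm H x" 1 C] C(1) by auto
  qed
qed

lemma nrm_op_nonneg: "T \<in> bounded_op_set H \<Longrightarrow> 0 \<le> nrm BH T"
  unfolding nrm_bounded_ops
  by (rule cSUP_upper2[OF nrm_op_bdd, of _ "\<zero>"]) auto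

lemma nrm_op: 
  assumes T: "T \<in> bounded_op_set H" and x: "x \<in> carrier H"
  shows "hnorm H (T x) \<le> nrm BH T * hnorm H x"
proof (cases "hnorm H x = 0")
  case True
  thus ?thesis using x op_zero[OF T] by (simp add: hnorm_eq_0)
next
  case False
  hence pos: "hnorm H x > 0" using x by (simp add: order.strict_iff_order)
  let ?u = "of_real (1 / hnorm H x) \<odot> x"
  have "hnorm H (T ?u) \<le> nrm BH T"
    unfolding nrm_bounded_ops
    by (rule cSUP_upper[OF _ nrm_op_bdd[OF T]]) (use pos x in \<open>auto simp: hnorm_smult norm_divide\<close>)
  thus ?thesis using pos x T by (simp add: op_smult hnorm_smult norm_divide field_simps)
qed

lemma nrm_op_le:
  assumes "0 \<le> C" "\<And>x. x \<in> carrier H \<Longrightarrow> hnorm H (T x) \<le> C * hnorm H x"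
  shows "nrm BH T \<le> C"
  unfolding nrm_bounded_ops
proof (rule cSUP_least)
  show "{x \<in> carrier H. hnorm H x \<le> 1} \<noteq> {}" using hnorm_zero by force
  fix x assume "x \<in> {x \<in> carrier H. hnorm H x \<le> 1}"
  thus "hnorm H (T x) \<le> C" using assms(2)[of x] mult_left_mono[of "hnorm H x" 1 C] assms(1) by auto
qed

lemma op_add_closed: 
  assumes "S \<in> bounded_op_set H" "T \<in> bounded_op_set H"
  shows "(\<lambda>x\<in>carrier H. S x \<oplus> T x) \<in> bounded_op_set H"
proof (rule opI)
  fix x assume "x \<in> carrier H"
  thus "hnorm H ((\<lambda>x\<in>carrier H. S x \<oplus> T x) x) \<le> (nrm BH S + nrm BH T) * hnorm H x"
    using hnorm_triangle[of "S x" "T x"] nrm_op[of S x] nrm_op[of T x] assms by (simp add: algebra_simps)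
qed (use assms in \<open>auto simp: op_add op_smult M.a_ac smult_add_right\<close>)

lemma op_smult_closed: 
  assumes "T \<in> bounded_op_set H"
  shows "(\<lambda>x\<in>carrier H. c \<odot> T x) \<in> bounded_op_set H"
proof (rule opI)
  fix x assume "x \<in> carrier H"
  thus "hnorm H ((\<lambda>x\<in>carrier H. c \<odot> T x) x) \<le> (cmod c * nrm BH T) * hnorm H x"
    using nrm_op[of T x] assms by (simp add: hnorm_smult mult_left_mono mult.assoc)
qed (use assms in \<open>auto simp: op_add op_smult smult_add_right mult.commute simp flip: smult_assoc\<close>)

lemma op_compose_closed: 
  assumes "S \<in> bounded_op_set H" "T \<in> bounded_op_set H"
  shows "compose (carrier H) S T \<in> bounded_op_set H"
proof (rule opI)
  fix x assume x: "x \<in> carrier H"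
  have "hnorm H (S (T x)) \<le> nrm BH S * hnorm H (T x)" using assms x by (intro nrm_op) auto
  also have "\<dots> \<le> nrm BH S * (nrm BH T * hnorm H x)"
    using assms x by (intro mult_left_mono nrm_op nrm_op_nonneg)
  finally show "hnorm H (compose (carrier H) S T x) \<le> (nrm BH S * nrm BH T) * hnorm H x"
    using x by (simp add: compose_eq mult.assoc)
qed (use assms in \<open>auto simp: compose_eq op_add op_smult intro!: PiE_I, auto simp: compose_def\<close>)

lemma op_zero_closed: "(\<lambda>x\<in>carrier H. \<zero>) \<in> bounded_op_set H"
  by (rule opI[where C = 0]) (auto simp: smult_add_right smult_r_null)

lemma op_one_closed: "(\<lambda>x\<in>carrier H. x) \<in> bounded_op_set H"
  by (rule opI[where C = 1]) auto

lemma BH_closed [simp, intro]: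
  "S \<in> bounded_op_set H \<Longrightarrow> T \<in> bounded_op_set H \<Longrightarrow> S \<oplus>\<^bsub>BH\<^esub> T \<in> bounded_op_set H"
  "S \<in> bounded_op_set H \<Longrightarrow> T \<in> bounded_op_set H \<Longrightarrow> S \<otimes>\<^bsub>BH\<^esub> T \<in> bounded_op_set H"
  "T \<in> bounded_op_set H \<Longrightarrow> c \<odot>\<^bsub>BH\<^esub> T \<in> bounded_op_set H"
  "\<zero>\<^bsub>BH\<^esub> \<in> bounded_op_set H" "\<one>\<^bsub>BH\<^esub> \<in> bounded_op_set H"
  unfolding bounded_ops_simps
  by (fact op_add_closed op_smult_closed op_compose_closed op_zero_closed op_one_closed)+

lemma BH_apply [simp]:
  assumes "x \<in> carrier H"
  shows "(S \<oplus>\<^bsub>BH\<^esub> T) x = S x \<oplus> T x" "(S \<otimes>\<^bsub>BH\<^esub> T) x = S (T x)"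
    "(c \<odot>\<^bsub>BH\<^esub> T) x = c \<odot> T x" "\<zero>\<^bsub>BH\<^esub> x = \<zero>" "\<one>\<^bsub>BH\<^esub> x = x"
  using assms by (simp_all add: bounded_ops_simps compose_eq)

lemma normed_algebra_BH: "normed_algebra BH"
proof -
  have ag: "abelian_group BH"
  proof (rule abelian_groupI)
    fix T assume "T \<in> carrier BH"
    hence "(-1) \<odot>\<^bsub>BH\<^esub> T \<in> carrier BH" "(-1) \<odot>\<^bsub>BH\<^esub> T \<oplus>\<^bsub>BH\<^esub> T = \<zero>\<^bsub>BH\<^esub>"
      by (auto simp: M.l_neg simp flip: uminus_eq_smult intro!: op_eqI)
    thus "\<exists>S\<in>carrier BH. S \<oplus>\<^bsub>BH\<^esub> T = \<zero>\<^bsub>BH\<^esub>" by blast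
  qed (auto simp: M.a_ac intro!: op_eqI)
  have mon: "monoid BH"
    by (rule monoidI) (auto intro!: op_eqI)
  have "ring BH"
    by (rule ringI[OF ag mon]) (auto simp: op_add intro!: op_eqI)
  then interpret ring BH .
  show ?thesis
  proof
    fix S T c assume S: "S \<in> carrier BH" and T: "T \<in> carrier BH"
    show "nrm BH (S \<oplus>\<^bsub>BH\<^esub> T) \<le> nrm BH S + nrm BH T"
    proof (rule nrm_op_le)
      fix x assume "x \<in> carrier H"
      thus "hnorm H ((S \<oplus>\<^bsub>BH\<^esub> T) x) \<le> (nrm BH S + nrm BH T) * hnorm H x"
        using hnorm_triangle[of "S x" "T x"] nrm_op[of S x] nrm_op[of T x] S T by (simp add: algebra_simps)
    qed (use S T in \<open>auto intro: nrm_op_nonneg add_nonneg_nonneg\<close>)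
    show "nrm BH (S \<otimes>\<^bsub>BH\<^esub> T) \<le> nrm BH S * nrm BH T"
    proof (rule nrm_op_le)
      fix x assume x: "x \<in> carrier H"
      have "hnorm H (S (T x)) \<le> nrm BH S * hnorm H (T x)" using S T x by (intro nrm_op) auto
      also have "\<dots> \<le> nrm BH S * (nrm BH T * hnorm H x)"
        using S T x by (intro mult_left_mono nrm_op nrm_op_nonneg) auto
      finally show "hnorm H ((S \<otimes>\<^bsub>BH\<^esub> T) x) \<le> (nrm BH S * nrm BH T) * hnorm H x"
        using x by (simp add: mult.assoc)
    qed (use S T in \<open>auto intro: nrm_op_nonneg mult_nonneg_nonneg\<close>)
    show "nrm BH (c \<odot>\<^bsub>BH\<^esub> S) \<le> cmod c * nrm BH S"
    proof (rule nrm_op_le)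
      fix x assume "x \<in> carrier H"
      thus "hnorm H ((c \<odot>\<^bsub>BH\<^esub> S) x) \<le> (cmod c * nrm BH S) * hnorm H x"
        using nrm_op[of S x] S by (simp add: hnorm_smult mult_left_mono mult.assoc)
    qed (use S in \<open>auto intro!: mult_nonneg_nonneg nrm_op_nonneg\<close>)
    show "0 \<le> nrm BH S" using S by (simp add: nrm_op_nonneg)
  next
    show "nrm BH \<zero>\<^bsub>BH\<^esub> = 0"
      by (intro antisym nrm_op_le nrm_op_nonneg) auto
    show "nrm BH \<one>\<^bsub>BH\<^esub> \<le> 1"
      by (intro nrm_op_le) auto
  qed (auto simp: smult_add_left smult_add_right smult_assoc op_smult intro!: op_eqI)
qed

lemma adj_ex1:
  assumes T: "T \<in> bounded_op_set H"
  shows "\<exists>!S. S \<in> bounded_op_set H \<and> (\<forall>x\<in>carrier H. \<forall>y\<in>carrier H. ip H (T x) y = ip H x (S y))"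
proof -
  have "\<exists>z\<in>carrier H. \<forall>x\<in>carrier H. ip H (T x) y = ip H x z" if y: "y \<in> carrier H" for y
  proof (rule Riesz_representation)
    fix x assume x: "x \<in> carrier H"
    have "cmod (ip H (T x) y) \<le> hnorm H (T x) * hnorm H y" using x y T by (intro Cauchy_Schwarz) auto
    also have "\<dots> \<le> (nrm BH T * hnorm H x) * hnorm H y"
      using x y T by (intro mult_right_mono nrm_op) auto
    finally show "cmod (ip H (T x) y) \<le> (nrm BH T * hnorm H y) * hnorm H x" by (simp add: mult_ac)
  qed (use y T in \<open>auto simp: op_add op_smult ip_add ip_smult\<close>)
  then obtain S0 where S0: "\<And>y. y \<in> carrier H \<Longrightarrow> S0 y \<in> carrier H"
    "\<And>x y. x \<in> carrier H \<Longrightarrow> y \<in> carrier H \<Longrightarrow> ip H (T x) y = ip H x (S0 y)" by metis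
  define S where "S = restrict S0 (carrier H)"
  have S: "\<And>y. y \<in> carrier H \<Longrightarrow> S y \<in> carrier H"
    "\<And>x y. x \<in> carrier H \<Longrightarrow> y \<in> carrier H \<Longrightarrow> ip H x (S y) = ip H (T x) y"
    using S0 by (auto simp: S_def)
  have "S \<in> bounded_op_set H"
  proof (rule opI)
    show "S \<in> carrier H \<rightarrow>\<^sub>E carrier H" using S0 by (auto simp: S_def)
    show "S (x \<oplus> y) = S x \<oplus> S y" if "x \<in> carrier H" "y \<in> carrier H" for x y
      using that by (intro eq_by_ip_right) (auto simp: S ip_add_right T)
    show "S (c \<odot> x) = c \<odot> S x" if "x \<in> carrier H" for c x
      using that by (intro eq_by_ip_right) (auto simp: S ip_smult_right T)
    show "hnorm H (S y) \<le> nrm BH T * hnorm H y" if y: "y \<in> carrier H" for y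
    proof (rule hnorm_le_by_ip)
      fix x assume x: "x \<in> carrier H"
      have "cmod (ip H (S y) x) = cmod (ip H (T x) y)"
        using ip_cnj[of x "S y"] S x y by simp
      also have "\<dots> \<le> hnorm H (T x) * hnorm H y" using x y T by (intro Cauchy_Schwarz) auto
      also have "\<dots> \<le> (nrm BH T * hnorm H x) * hnorm H y"
        using x y T by (intro mult_right_mono nrm_op) auto
      finally show "cmod (ip H (S y) x) \<le> (nrm BH T * hnorm H y) * hnorm H x" by (simp add: mult_ac)
    qed (use y S T in \<open>auto intro: nrm_op_nonneg mult_nonneg_nonneg\<close>)
  qed
  thus ?thesis
  proof (intro ex1I[of _ S])
    fix S' assume "S' \<in> bounded_op_set H \<and> (\<forall>x\<in>carrier H. \<forall>y\<in>carrier H. ip H (T x) y = ip H x (S' y))"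
    with \<open>S \<in> bounded_op_set H\<close> show "S' = S"
      by (intro op_eqI eq_by_ip_right) (auto simp: S)
  qed (use S in auto)
qed

lemma adj_BH: "adj BH T = (THE S. S \<in> bounded_op_set H \<and>
        (\<forall>x\<in>carrier H. \<forall>y\<in>carrier H. ip H (T x) y = ip H x (S y)))"
  by (simp add: bounded_ops_def)

lemma
  assumes "T \<in> bounded_op_set H"
  shows adj_cl [simp, intro]: "adj BH T \<in> bounded_op_set H"
    and adj_ip: "\<lbrakk>x \<in> carrier H; y \<in> carrier H\<rbrakk> \<Longrightarrow> ip H (T x) y = ip H x (adj BH T y)"
  using theI'[OF adj_ex1[OF assms]] by (auto simp: adj_BH)

lemma adj_eqI:
  assumes "T \<in> bounded_op_set H" "S \<in> bounded_op_set H"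
    and "\<And>x y. x \<in> carrier H \<Longrightarrow> y \<in> carrier H \<Longrightarrow> ip H (T x) y = ip H x (S y)"
  shows "adj BH T = S"
  unfolding adj_BH by (rule the1_equality[OF adj_ex1[OF assms(1)]]) (use assms in auto)

lemma adj_ip':
  assumes "T \<in> bounded_op_set H" "x \<in> carrier H" "y \<in> carrier H"
  shows "ip H (adj BH T x) y = ip H x (T y)"
  using adj_ip[OF assms(1,3,2)] ip_cnj[of "T y" x] ip_cnj[of y "adj BH T x"] assms by simp

lemma adj_adj: "T \<in> bounded_op_set H \<Longrightarrow> adj BH (adj BH T) = T"
  by (rule adj_eqI) (auto simp: adj_ip')

lemma adj_compose:
  assumes "S \<in> bounded_op_set H" "T \<in> bounded_op_set H"
  shows "adj BH (S \<otimes>\<^bsub>BH\<^esub> T) = adj BH T \<otimes>\<^bsub>BH\<^esub> adj BH S"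
  using assms by (intro adj_eqI) (auto simp: adj_ip)

lemma adj_smult:
  assumes "T \<in> bounded_op_set H"
  shows "adj BH (c \<odot>\<^bsub>BH\<^esub> T) = cnj c \<odot>\<^bsub>BH\<^esub> adj BH T"
  using assms by (intro adj_eqI) (auto simp: ip_smult ip_smult_right adj_ip)

lemma nrm_adj_le: 
  assumes T: "T \<in> bounded_op_set H"
  shows "nrm BH (adj BH T) \<le> nrm BH T"
proof (rule nrm_op_le)
  fix y assume y: "y \<in> carrier H"
  show "hnorm H (adj BH T y) \<le> nrm BH T * hnorm H y"
  proof (rule hnorm_le_by_ip)
    fix x assume x: "x \<in> carrier H"
    have "cmod (ip H (adj BH T y) x) = cmod (ip H y (T x))"
      using adj_ip' T x y by simp
    also have "\<dots> \<le> hnorm H y * hnorm H (T x)" using x y T by (intro Cauchy_Schwarz) auto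
    also have "\<dots> \<le> hnorm H y * (nrm BH T * hnorm H x)"
      using x y T by (intro mult_left_mono nrm_op) auto
    finally show "cmod (ip H (adj BH T y) x) \<le> (nrm BH T * hnorm H y) * hnorm H x" by (simp add: mult_ac)
  qed (use y T in \<open>auto intro: nrm_op_nonneg mult_nonneg_nonneg\<close>)
qed (use T in \<open>auto intro: nrm_op_nonneg\<close>)

lemma finsum_op_apply:
  assumes "\<And>i. i < (n::nat) \<Longrightarrow> F i \<in> bounded_op_set H" "x \<in> carrier H"
  shows "finsum BH F {..<n} \<in> bounded_op_set H \<and> finsum BH F {..<n} x = finsum H (\<lambda>i. F i x) {..<n}"
  using assms(1)
proof (induction n)
  interpret B: normed_algebra BH by (rule normed_algebra_BH)
  case 0
  show ?case using assms(2) by simp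
next
  interpret B: normed_algebra BH by (rule normed_algebra_BH)
  case (Suc n)
  have cl: "F \<in> {..<n} \<rightarrow> carrier BH" "F n \<in> carrier BH" using Suc.prems by auto
  have cl': "(\<lambda>i. F i x) \<in> {..<n} \<rightarrow> carrier H" "F n x \<in> carrier H"
    using Suc.prems assms(2) by (auto simp: less_Suc_eq)
  have "finsum BH F {..<Suc n} = F n \<oplus>\<^bsub>BH\<^esub> finsum BH F {..<n}"
    unfolding lessThan_Suc using cl by (intro B.finsum_insert) auto
  moreover have "finsum H (\<lambda>i. F i x) {..<Suc n} = F n x \<oplus> finsum H (\<lambda>i. F i x) {..<n}"
    unfolding lessThan_Suc using cl' by (intro M.finsum_insert) auto
  moreover have IH: "finsum BH F {..<n} \<in> bounded_op_set H" "finsum BH F {..<n} x = finsum H (\<lambda>i. F i x) {..<n}"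
    using Suc by auto
  moreover have "F n \<oplus>\<^bsub>BH\<^esub> finsum BH F {..<n} \<in> bounded_op_set H"
    using cl(2) IH(1) by simp
  moreover have "(F n \<oplus>\<^bsub>BH\<^esub> finsum BH F {..<n}) x = F n x \<oplus> finsum BH F {..<n} x"
    using assms(2) by simp
  ultimately show ?case by (simp only:)
qed

lemma ip_finsum:
  assumes "\<And>i. i < (n::nat) \<Longrightarrow> f i \<in> carrier H" "y \<in> carrier H"
  shows "ip H (finsum H f {..<n}) y = (\<Sum>i<n. ip H (f i) y)"
  using assms(1)
proof (induction n)
  case (Suc n)
  have cl: "f \<in> {..<n} \<rightarrow> carrier H" "f n \<in> carrier H" using Suc.prems by auto
  have "finsum H f {..<Suc n} = f n \<oplus> finsum H f {..<n}"
    unfolding lessThan_Suc using cl by (intro M.finsum_insert) auto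
  thus ?case using cl assms(2) Suc by (simp add: ip_add)
qed (use assms in simp)

end

section \<open>Products of normed algebras\<close>

lemma cstar_prod_simps [simp]:
  "x \<otimes>\<^bsub>cstar_prod R B\<^esub> y = (\<lambda>r\<in>R. x r \<otimes>\<^bsub>B r\<^esub> y r)"
  "\<one>\<^bsub>cstar_prod R B\<^esub> = (\<lambda>r\<in>R. \<one>\<^bsub>B r\<^esub>)"
  "\<zero>\<^bsub>cstar_prod R B\<^esub> = (\<lambda>r\<in>R. \<zero>\<^bsub>B r\<^esub>)"
  "x \<oplus>\<^bsub>cstar_prod R B\<^esub> y = (\<lambda>r\<in>R. x r \<oplus>\<^bsub>B r\<^esub> y r)"
  "c \<odot>\<^bsub>cstar_prod R B\<^esub> x = (\<lambda>r\<in>R. c \<odot>\<^bsub>B r\<^esub> x r)"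
  "adj (cstar_prod R B) x = (\<lambda>r\<in>R. adj (B r) (x r))"
  by (simp_all add: cstar_prod_def)

lemma carrier_cstar_prod:
  "carrier (cstar_prod R B) = {x \<in> (\<Pi>\<^sub>E r\<in>R. carrier (B r)). \<exists>C. \<forall>r\<in>R. nrm (B r) (x r) \<le> C}"
  and nrm_cstar_prod: "nrm (cstar_prod R B) x = (SUP r\<in>R. nrm (B r) (x r))"
  by (simp_all add: cstar_prod_def)

lemma cstar_prodI:
  assumes "\<And>r. r \<in> R \<Longrightarrow> x r \<in> carrier (B r)" "\<And>r. r \<in> R \<Longrightarrow> nrm (B r) (x r) \<le> C"
  shows "(\<lambda>r\<in>R. x r) \<in> carrier (cstar_prod R B)"
  unfolding carrier_cstar_prod using assms by auto

lemma cstar_prod_coord: "x \<in> carrier (cstar_prod R B) \<Longrightarrow> r \<in> R \<Longrightarrow> x r \<in> carrier (B r)"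
  by (auto simp: carrier_cstar_prod)

lemma cstar_prod_eqI:
  assumes "x \<in> carrier (cstar_prod R B)" "y \<in> carrier (cstar_prod R B)"
    and "\<And>r. r \<in> R \<Longrightarrow> x r = y r"
  shows "x = y"
  using assms unfolding carrier_cstar_prod by (auto intro: PiE_ext)

lemma nrm_coord_le:
  assumes "x \<in> carrier (cstar_prod R B)" "r \<in> R"
  shows "nrm (B r) (x r) \<le> nrm (cstar_prod R B) x"
  unfolding nrm_cstar_prod
  by (rule cSUP_upper) (use assms in \<open>auto simp: carrier_cstar_prod intro: bdd_aboveI2\<close>)

lemma nrm_cstar_prod_le:
  assumes "R \<noteq> {}" "\<And>r. r \<in> R \<Longrightarrow> nrm (B r) (x r) \<le> C"
  shows "nrm (cstar_prod R B) x \<le> C"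
  unfolding nrm_cstar_prod by (rule cSUP_least) (use assms in auto)

lemma (in normed_algebra) algebra_laws:
  assumes "x \<in> carrier B" "y \<in> carrier B" "z \<in> carrier B"
  shows "x \<otimes> y \<otimes> z = x \<otimes> (y \<otimes> z)" "\<one> \<otimes> x = x" "x \<otimes> \<one> = x"
    "x \<oplus> y \<oplus> z = x \<oplus> (y \<oplus> z)" "x \<oplus> y = y \<oplus> x" "\<zero> \<oplus> x = x" "(-1) \<odot> x \<oplus> x = \<zero>"
    "(x \<oplus> y) \<otimes> z = x \<otimes> z \<oplus> y \<otimes> z" "z \<otimes> (x \<oplus> y) = z \<otimes> x \<oplus> z \<otimes> y"
  using assms by (auto simp: m_assoc l_distr r_distr a_assoc l_neg intro: a_comm simp flip: uminus_eq_smult)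

lemma normed_algebra_cstar_prod:
  assumes ne: "R \<noteq> {}" and B: "\<And>r. r \<in> R \<Longrightarrow> normed_algebra (B r)"
  shows "normed_algebra (cstar_prod R B)"
proof -
  let ?C = "cstar_prod R B"
  note coord = cstar_prod_coord[of _ R B] and le = nrm_coord_le[of _ R B]
  have add_le: "nrm (B r) (x r \<oplus>\<^bsub>B r\<^esub> y r) \<le> nrm ?C x + nrm ?C y"
    if "x \<in> carrier ?C" "y \<in> carrier ?C" "r \<in> R" for x y r
    using normed_algebra.nrm_triangle[OF B coord coord, OF that(3,1,3,2,3)] le[OF that(1,3)] le[OF that(2,3)] by linarith
  have mult_le: "nrm (B r) (x r \<otimes>\<^bsub>B r\<^esub> y r) \<le> nrm ?C x * nrm ?C y"
    if "x \<in> carrier ?C" "y \<in> carrier ?C" "r \<in> R" for x y r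
  proof -
    have "nrm (B r) (x r \<otimes>\<^bsub>B r\<^esub> y r) \<le> nrm (B r) (x r) * nrm (B r) (y r)"
      using that by (intro normed_algebra.nrm_mult B coord)
    also have "\<dots> \<le> nrm ?C x * nrm ?C y"
      using that le[OF that(1,3)] normed_algebra.nrm_nonneg[OF B coord, OF that(3,1,3)] 
        normed_algebra.nrm_nonneg[OF B coord, OF that(3,2,3)]
      by (intro mult_mono le) auto
    finally show ?thesis .
  qed
  have smult_le: "nrm (B r) (c \<odot>\<^bsub>B r\<^esub> x r) \<le> cmod c * nrm ?C x"
    if "x \<in> carrier ?C" "r \<in> R" for x c r
    by (rule order_trans[OF normed_algebra.nrm_smult[OF B coord, OF that(2,1,2)] mult_left_mono[OF le[OF that]]]) simp
  have zero_cl: "\<zero>\<^bsub>?C\<^esub> \<in> carrier ?C"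
    unfolding cstar_prod_simps
  proof (rule cstar_prodI)
    fix r assume "r \<in> R"
    then interpret normed_algebra "B r" by (rule B)
    show "nrm (B r) \<zero>\<^bsub>B r\<^esub> \<le> 0" "\<zero>\<^bsub>B r\<^esub> \<in> carrier (B r)" by (auto simp: nrm_zero)
  qed
  have add_cl: "x \<oplus>\<^bsub>?C\<^esub> y \<in> carrier ?C" if x: "x \<in> carrier ?C" and y: "y \<in> carrier ?C" for x y c
    unfolding cstar_prod_simps
  proof (rule cstar_prodI)
    fix r assume r: "r \<in> R"
    then interpret normed_algebra "B r" by (rule B)
    show "x r \<oplus>\<^bsub>B r\<^esub> y r \<in> carrier (B r)" using coord[OF x r] coord[OF y r] smult_cl by simp
    show "nrm (B r) (x r \<oplus>\<^bsub>B r\<^esub> y r) \<le> nrm ?C x + nrm ?C y" using add_le x y r by blast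
  qed
  have mult_cl: "x \<otimes>\<^bsub>?C\<^esub> y \<in> carrier ?C" if x: "x \<in> carrier ?C" and y: "y \<in> carrier ?C" for x y c
    unfolding cstar_prod_simps
  proof (rule cstar_prodI)
    fix r assume r: "r \<in> R"
    then interpret normed_algebra "B r" by (rule B)
    show "x r \<otimes>\<^bsub>B r\<^esub> y r \<in> carrier (B r)" using coord[OF x r] coord[OF y r] smult_cl by simp
    show "nrm (B r) (x r \<otimes>\<^bsub>B r\<^esub> y r) \<le> nrm ?C x * nrm ?C y" using mult_le x y r by blast
  qed
  have smult_cl': "c \<odot>\<^bsub>?C\<^esub> x \<in> carrier ?C" if x: "x \<in> carrier ?C" and y: "y \<in> carrier ?C" for x y c
    unfolding cstar_prod_simps
  proof (rule cstar_prodI)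
    fix r assume r: "r \<in> R"
    then interpret normed_algebra "B r" by (rule B)
    show "c \<odot>\<^bsub>B r\<^esub> x r \<in> carrier (B r)" using coord[OF x r] coord[OF y r] smult_cl by simp
    show "nrm (B r) (c \<odot>\<^bsub>B r\<^esub> x r) \<le> cmod c * nrm ?C x" using smult_le x y r by blast
  qed
  note smult_cl = smult_cl'[OF _ zero_cl]
  have ring_laws: "ring (B r)" if "r \<in> R" for r using B[OF that] by (rule normed_algebra.axioms)
  note R = ring_laws[THEN ring.is_abelian_group] ring_laws[THEN ring.is_monoid]
  have one_cl: "\<one>\<^bsub>?C\<^esub> \<in> carrier ?C"
    unfolding cstar_prod_simps
    by (rule cstar_prodI) (use R B in \<open>auto intro: monoid.one_closed normed_algebra.nrm_one\<close>)
  note cl = add_cl mult_cl smult_cl zero_cl one_cl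
  note eqI = cstar_prod_eqI[of _ R B]
  have laws: "x \<otimes>\<^bsub>?C\<^esub> y \<otimes>\<^bsub>?C\<^esub> z = x \<otimes>\<^bsub>?C\<^esub> (y \<otimes>\<^bsub>?C\<^esub> z) \<and> \<one>\<^bsub>?C\<^esub> \<otimes>\<^bsub>?C\<^esub> x = x \<and> x \<otimes>\<^bsub>?C\<^esub> \<one>\<^bsub>?C\<^esub> = x \<and>
      (x \<oplus>\<^bsub>?C\<^esub> y) \<otimes>\<^bsub>?C\<^esub> z = x \<otimes>\<^bsub>?C\<^esub> z \<oplus>\<^bsub>?C\<^esub> y \<otimes>\<^bsub>?C\<^esub> z \<and> z \<otimes>\<^bsub>?C\<^esub> (x \<oplus>\<^bsub>?C\<^esub> y) = z \<otimes>\<^bsub>?C\<^esub> x \<oplus>\<^bsub>?C\<^esub> z \<otimes>\<^bsub>?C\<^esub> y \<and>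
      x \<oplus>\<^bsub>?C\<^esub> y \<oplus>\<^bsub>?C\<^esub> z = x \<oplus>\<^bsub>?C\<^esub> (y \<oplus>\<^bsub>?C\<^esub> z) \<and> x \<oplus>\<^bsub>?C\<^esub> y = y \<oplus>\<^bsub>?C\<^esub> x \<and> \<zero>\<^bsub>?C\<^esub> \<oplus>\<^bsub>?C\<^esub> x = x \<and> (-1) \<odot>\<^bsub>?C\<^esub> x \<oplus>\<^bsub>?C\<^esub> x = \<zero>\<^bsub>?C\<^esub> \<and>
      (c + d) \<odot>\<^bsub>?C\<^esub> x = c \<odot>\<^bsub>?C\<^esub> x \<oplus>\<^bsub>?C\<^esub> d \<odot>\<^bsub>?C\<^esub> x \<and> c \<odot>\<^bsub>?C\<^esub> (x \<oplus>\<^bsub>?C\<^esub> y) = c \<odot>\<^bsub>?C\<^esub> x \<oplus>\<^bsub>?C\<^esub> c \<odot>\<^bsub>?C\<^esub> y \<and>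
      (c * d) \<odot>\<^bsub>?C\<^esub> x = c \<odot>\<^bsub>?C\<^esub> (d \<odot>\<^bsub>?C\<^esub> x) \<and> 1 \<odot>\<^bsub>?C\<^esub> x = x \<and>
      (c \<odot>\<^bsub>?C\<^esub> x) \<otimes>\<^bsub>?C\<^esub> y = c \<odot>\<^bsub>?C\<^esub> (x \<otimes>\<^bsub>?C\<^esub> y) \<and> x \<otimes>\<^bsub>?C\<^esub> (c \<odot>\<^bsub>?C\<^esub> y) = c \<odot>\<^bsub>?C\<^esub> (x \<otimes>\<^bsub>?C\<^esub> y)"
    if x: "x \<in> carrier ?C" and y: "y \<in> carrier ?C" and z: "z \<in> carrier ?C" for x y z c d
  proof -
    have ext: "f = g" if "f \<in> carrier ?C" "g \<in> carrier ?C" "\<And>r. \<lbrakk>r \<in> R; normed_algebra (B r); x r \<in> carrier (B r);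
        y r \<in> carrier (B r); z r \<in> carrier (B r)\<rbrakk> \<Longrightarrow> f r = g r" for f g
      using that B x y z coord by (intro eqI) auto
    show ?thesis
      by (intro conjI; rule ext; (intro cl x y z)?)
         (simp_all add: normed_algebra.algebra_laws normed_algebra.smult_add_left normed_algebra.smult_add_right
           normed_algebra.smult_assoc normed_algebra.smult_1 normed_algebra.smult_mult_left normed_algebra.smult_mult_right)
  qed
  note L = laws[THEN conjunct1] laws[THEN conjunct2, THEN conjunct1] laws[THEN conjunct2, THEN conjunct2, THEN conjunct1] laws[THEN conjunct2, THEN conjunct2, THEN conjunct2, THEN conjunct1] laws[THEN conjunct2, THEN conjunct2, THEN conjunct2, THEN conjunct2, THEN conjunct1] laws[THEN conjunct2, THEN conjunct2, THEN conjunct2, THEN conjunct2, THEN conjunct2, THEN conjunct1] laws[THEN conjunct2, THEN conjunct2, THEN conjunct2, THEN conjunct2, THEN conjunct2, THEN conjunct2, THEN conjunct1] laws[THEN conjunct2, THEN conjunct2, THEN conjunct2, THEN conjunct2, THEN conjunct2, THEN conjunct2, THEN conjunct2, THEN conjunct1] laws[THEN conjunct2, THEN conjunct2, THEN conjunct2, THEN conjunct2, THEN conjunct2, THEN conjunct2, THEN conjunct2, THEN conjunct2, THEN conjunct1] laws[THEN conjunct2, THEN conjunct2, THEN conjunct2, THEN conjunct2, THEN conjunct2, THEN conjunct2, THEN conjunct2, THEN conjunct2, THEN conjunct2, THEN conjunct1] laws[THEN conjunct2, THEN conjunct2, THEN conjunct2, THEN conjunct2, THEN conjunct2, THEN conjunct2,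 THEN conjunct2, THEN conjunct2, THEN conjunct2, THEN conjunct2, THEN conjunct1] laws[THEN conjunct2, THEN conjunct2, THEN conjunct2, THEN conjunct2, THEN conjunct2, THEN conjunct2, THEN conjunct2, THEN conjunct2, THEN conjunct2, THEN conjunct2, THEN conjunct2, THEN conjunct1] laws[THEN conjunct2, THEN conjunct2, THEN conjunct2, THEN conjunct2, THEN conjunct2, THEN conjunct2, THEN conjunct2, THEN conjunct2, THEN conjunct2, THEN conjunct2, THEN conjunct2, THEN conjunct2, THEN conjunct1] laws[THEN conjunct2, THEN conjunct2, THEN conjunct2, THEN conjunct2, THEN conjunct2, THEN conjunct2, THEN conjunct2, THEN conjunct2, THEN conjunct2, THEN conjunct2, THEN conjunct2, THEN conjunct2, THEN conjunct2, THEN conjunct1] laws[THEN conjunct2, THEN conjunct2, THEN conjunct2, THEN conjunct2, THEN conjunct2, THEN conjunct2, THEN conjunct2, THEN conjunct2, THEN conjunct2, THEN conjunct2, THEN conjunct2, THEN conjunct2, THEN conjunct2, THEN conjunct2]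
  have ag: "abelian_group ?C"
  proof (rule abelian_groupI)
    fix x assume x: "x \<in> carrier ?C"
    show "\<exists>y\<in>carrier ?C. y \<oplus>\<^bsub>?C\<^esub> x = \<zero>\<^bsub>?C\<^esub>"
      by (rule bexI[of _ "(-1) \<odot>\<^bsub>?C\<^esub> x"], rule L(9)[OF x x x], rule smult_cl[OF x])
  qed (assumption | rule cl | rule L)+
  have mon: "monoid ?C" by (rule monoidI) (assumption | rule cl | rule L)+
  have "ring ?C" by (rule ringI[OF ag mon]) (assumption | rule cl | rule L)+
  then interpret ring ?C .
  have nn: "0 \<le> nrm ?C x" if "x \<in> carrier ?C" for x
  proof -
    obtain r where r: "r \<in> R" using ne by blast
    show ?thesis using normed_algebra.nrm_nonneg[OF B[OF r] coord[OF that r]] le[OF that r] by linarith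
  qed
  show ?thesis
  proof
    fix x y c assume x: "x \<in> carrier ?C" and y: "y \<in> carrier ?C"
    show "nrm ?C (x \<oplus>\<^bsub>?C\<^esub> y) \<le> nrm ?C x + nrm ?C y"
      by (rule nrm_cstar_prod_le[OF ne]) (use add_le[OF x y] in simp)
    show "nrm ?C (x \<otimes>\<^bsub>?C\<^esub> y) \<le> nrm ?C x * nrm ?C y"
      by (rule nrm_cstar_prod_le[OF ne]) (use mult_le[OF x y] in simp)
    show "nrm ?C (c \<odot>\<^bsub>?C\<^esub> x) \<le> cmod c * nrm ?C x"
      by (rule nrm_cstar_prod_le[OF ne]) (use smult_le[OF x] in simp)
  next
    have "nrm ?C \<zero>\<^bsub>?C\<^esub> \<le> 0"
      by (rule nrm_cstar_prod_le[OF ne]) (use B in \<open>simp add: normed_algebra.nrm_zero\<close>)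
    thus "nrm ?C \<zero>\<^bsub>?C\<^esub> = 0" using nn zero_cl by (intro antisym) auto
    show "nrm ?C \<one>\<^bsub>?C\<^esub> \<le> 1"
      by (rule nrm_cstar_prod_le[OF ne]) (use B in \<open>simp add: normed_algebra.nrm_one\<close>)
  qed (assumption | rule cl nn | rule L)+
qed

section \<open>Covariant representations and their universal product\<close>

locale stacey_system = cring A for A :: "'c cstar" (structure) +
  fixes \<alpha> :: "'c \<Rightarrow> 'c"
  assumes scalar_closed: "c \<odot> \<one> \<in> carrier A"
    and \<alpha>_closed: "a \<in> carrier A \<Longrightarrow> \<alpha> a \<in> carrier A"
    and \<alpha>_add: "\<lbrakk>a \<in> carrier A; b \<in> carrier A\<rbrakk> \<Longrightarrow> \<alpha> (a \<oplus> b) = \<alpha> a \<oplus> \<alpha> b"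
    and \<alpha>_one: "\<alpha> \<one> = \<one>"
    and bounded_element: "a \<in> carrier A \<Longrightarrow> \<exists>C b. b \<in> carrier A \<and> adj A a \<in> carrier A \<and> adj A b \<in> carrier A \<and>
          adj A a \<otimes> a \<oplus> adj A b \<otimes> b = complex_of_real C \<odot> \<one>"

locale stacey_rep = stacey_system A \<alpha> + Hil: complex_hilbert_space H
  for A (structure) and \<alpha> and H :: "'c hilb" +
  fixes \<pi> Q n
  assumes rep: "(H, \<pi>, Q) \<in> stacey_reps A \<alpha> n"
begin

lemma
  shows \<pi>_closed [simp, intro]: "a \<in> carrier A \<Longrightarrow> \<pi> a \<in> bounded_op_set H"
    and \<pi>_add: "\<lbrakk>a \<in> carrier A; b \<in> carrier A\<rbrakk> \<Longrightarrow> \<pi> (a \<oplus> b) = \<pi> a \<oplus>\<^bsub>Hil.BH\<^esub> \<pi> b"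
    and \<pi>_mult: "\<lbrakk>a \<in> carrier A; b \<in> carrier A\<rbrakk> \<Longrightarrow> \<pi> (a \<otimes> b) = \<pi> a \<otimes>\<^bsub>Hil.BH\<^esub> \<pi> b"
    and \<pi>_smult: "a \<in> carrier A \<Longrightarrow> \<pi> (c \<odot> a) = c \<odot>\<^bsub>Hil.BH\<^esub> \<pi> a"
    and \<pi>_adj: "a \<in> carrier A \<Longrightarrow> \<pi> (adj A a) = adj Hil.BH (\<pi> a)"
    and nondeg: "nondegenerate A H \<pi>"
    and Q_closed [simp, intro]: "i < n \<Longrightarrow> Q i \<in> bounded_op_set H"
    and Q_orth: "\<lbrakk>i < n; j < n\<rbrakk> \<Longrightarrow> adj Hil.BH (Q i) \<otimes>\<^bsub>Hil.BH\<^esub> Q j = (if i = j then \<one>\<^bsub>Hil.BH\<^esub> else \<zero>\<^bsub>Hil.BH\<^esub>)"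
    and \<pi>_\<alpha>: "a \<in> carrier A \<Longrightarrow>
      \<pi> (\<alpha> a) = finsum Hil.BH (\<lambda>i. Q i \<otimes>\<^bsub>Hil.BH\<^esub> \<pi> a \<otimes>\<^bsub>Hil.BH\<^esub> adj Hil.BH (Q i)) {..<n}"
  using rep by (auto simp: stacey_reps_def star_hom_def alg_hom_def toeplitz_cuntz_family_def implements_def)

lemma \<pi>_one: "\<pi> \<one> = \<one>\<^bsub>Hil.BH\<^esub>"
proof -
  let ?V = "{x \<in> carrier H. \<pi> \<one> x = x}"
  have "closed_subspace H ?V"
    unfolding closed_subspace_def
  proof (intro conjI ballI impI)
    show "submodule ?V complex_ring H"
    proof
      fix x assume "x \<in> ?V"
      thus "inv\<^bsub>add_monoid H\<^esub> x \<in> ?V"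
        by (simp add: Hil.uminus_eq_smult Hil.op_smult flip: a_inv_def)
    qed (auto simp: Hil.op_add Hil.op_smult Hil.op_zero)
  next
    fix x assume x: "x \<in> carrier H" and appr: "\<forall>e>0. \<exists>v\<in>?V. hnorm H (x \<ominus>\<^bsub>H\<^esub> v) < e"
    define K where "K = nrm Hil.BH (\<pi> \<one>) + 1"
    have K: "K > 0" using Hil.nrm_op_nonneg[of "\<pi> \<one>"] by (simp add: K_def)
    have "hnorm H (\<pi> \<one> x \<ominus>\<^bsub>H\<^esub> x) \<le> 0"
    proof (rule field_le_epsilon)
      fix e :: real assume "e > 0"
      with K appr obtain v where v: "v \<in> carrier H" "\<pi> \<one> v = v" and ve: "hnorm H (x \<ominus>\<^bsub>H\<^esub> v) < e / K"
        by (metis (mono_tags, lifting) divide_pos_pos mem_Collect_eq)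
      let ?d = "x \<ominus>\<^bsub>H\<^esub> v"
      have d: "?d \<in> carrier H" using x v by simp
      have "\<pi> \<one> ?d \<ominus>\<^bsub>H\<^esub> ?d = \<pi> \<one> x \<ominus>\<^bsub>H\<^esub> x"
        using x v by (intro Hil.eq_by_ip)
          (auto simp: Hil.ip_minus Hil.minus_eq_smult Hil.op_add Hil.op_smult Hil.ip_add Hil.ip_smult)
      hence "hnorm H (\<pi> \<one> x \<ominus>\<^bsub>H\<^esub> x) \<le> hnorm H (\<pi> \<one> ?d) + hnorm H ?d"
        using Hil.hnorm_triangle_minus[of "\<pi> \<one> ?d" ?d] d by simp
      also have "\<dots> \<le> K * hnorm H ?d"
        using Hil.nrm_op[OF _ d, of "\<pi> \<one>"] by (simp add: K_def algebra_simps)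
      also have "\<dots> \<le> K * (e / K)" using K ve by (intro mult_left_mono) auto
      finally show "hnorm H (\<pi> \<one> x \<ominus>\<^bsub>H\<^esub> x) \<le> 0 + e" using K by simp
    qed
    moreover have "0 \<le> hnorm H (\<pi> \<one> x \<ominus>\<^bsub>H\<^esub> x)" using x by simp
    ultimately have "hnorm H (\<pi> \<one> x \<ominus>\<^bsub>H\<^esub> x) = 0" by linarith
    hence "\<pi> \<one> x \<ominus>\<^bsub>H\<^esub> x = \<zero>\<^bsub>H\<^esub>" using x by (simp add: Hil.hnorm_eq_0)
    hence "\<pi> \<one> x = x" using x Hil.ip_minus[of "\<pi> \<one> x" x] by (intro Hil.eq_by_ip) auto
    thus "x \<in> ?V" using x by simp
  qed
  moreover have "{\<pi> a x |a x. a \<in> carrier A \<and> x \<in> carrier H} \<subseteq> ?V"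
  proof clarify
    fix a x assume a: "a \<in> carrier A" and x: "x \<in> carrier H"
    have "\<pi> \<one> (\<pi> a x) = (\<pi> (\<one> \<otimes> a)) x" using a x by (simp add: \<pi>_mult del: l_one)
    thus "\<pi> a x \<in> carrier H \<and> \<pi> \<one> (\<pi> a x) = \<pi> a x" using a x by simp
  qed
  ultimately have "carrier H \<subseteq> ?V"
    using nondeg hull_minimal[of _ ?V "closed_subspace H"] unfolding nondegenerate_def by auto
  thus ?thesis by (intro Hil.op_eqI) auto
qed

lemma adj_Q_Q: "\<lbrakk>i < n; j < n; x \<in> carrier H\<rbrakk> \<Longrightarrow> adj Hil.BH (Q i) (Q j x) = (if i = j then x else \<zero>\<^bsub>H\<^esub>)"
  using fun_cong[OF Q_orth, of i j x] by (auto split: if_splits)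

lemma ip_Q: "\<lbrakk>i < n; j < n; x \<in> carrier H; y \<in> carrier H\<rbrakk> \<Longrightarrow> ip H (Q i x) (Q j y) = (if i = j then ip H x y else 0)"
  by (simp add: Hil.adj_ip adj_Q_Q)

lemma hnorm_Q: "\<lbrakk>i < n; x \<in> carrier H\<rbrakk> \<Longrightarrow> hnorm H (Q i x) = hnorm H x"
  by (simp add: hnorm_def ip_Q)

lemma nrm_Q: "i < n \<Longrightarrow> nrm Hil.BH (Q i) \<le> 1"
  by (rule Hil.nrm_op_le) (auto simp: hnorm_Q)

lemma hnorm_adj_Q: "\<lbrakk>i < n; x \<in> carrier H\<rbrakk> \<Longrightarrow> hnorm H (adj Hil.BH (Q i) x) \<le> hnorm H x"
  using Hil.nrm_op[of "adj Hil.BH (Q i)" x] Hil.nrm_adj_le[of "Q i"] nrm_Q[of i]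
    mult_right_mono[of "nrm Hil.BH (adj Hil.BH (Q i))" 1 "hnorm H x"] by simp

lemma ip_\<pi>_\<alpha>:
  assumes "a \<in> carrier A" "x \<in> carrier H" "y \<in> carrier H"
  shows "ip H (\<pi> (\<alpha> a) x) y = (\<Sum>i<n. ip H (\<pi> a (adj Hil.BH (Q i) x)) (adj Hil.BH (Q i) y))"
proof -
  let ?F = "\<lambda>i. Q i \<otimes>\<^bsub>Hil.BH\<^esub> \<pi> a \<otimes>\<^bsub>Hil.BH\<^esub> adj Hil.BH (Q i)"
  have "finsum Hil.BH ?F {..<n} x = finsum H (\<lambda>i. ?F i x) {..<n}"
    using Hil.finsum_op_apply[of n ?F x] assms by auto
  thus ?thesis using assms by (simp add: \<pi>_\<alpha> Hil.ip_finsum Hil.adj_ip)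
qed

lemma sum_ip_adj_Q:
  assumes "x \<in> carrier H" "y \<in> carrier H"
  shows "(\<Sum>i<n. ip H (adj Hil.BH (Q i) x) (adj Hil.BH (Q i) y)) = ip H x y"
  using ip_\<pi>_\<alpha>[of \<one> x y] assms by (simp add: \<alpha>_one \<pi>_one)

lemma covariance:
  assumes "a \<in> carrier A" "i < n"
  shows "Q i \<otimes>\<^bsub>Hil.BH\<^esub> \<pi> a = \<pi> (\<alpha> a) \<otimes>\<^bsub>Hil.BH\<^esub> Q i"
proof (rule Hil.op_eqI_ip)
  fix x y assume xy: "x \<in> carrier H" "y \<in> carrier H"
  have "ip H (\<pi> (\<alpha> a) (Q i x)) y = (\<Sum>j<n. ip H (\<pi> a (adj Hil.BH (Q j) (Q i x))) (adj Hil.BH (Q j) y))"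
    using assms xy by (intro ip_\<pi>_\<alpha>) auto
  also have "\<dots> = (\<Sum>j<n. if j = i then ip H (\<pi> a x) (adj Hil.BH (Q i) y) else 0)"
    using assms xy by (intro sum.cong) (auto simp: adj_Q_Q Hil.op_zero)
  also have "\<dots> = ip H (Q i (\<pi> a x)) y" using assms xy by (simp add: Hil.adj_ip)
  finally show "ip H ((Q i \<otimes>\<^bsub>Hil.BH\<^esub> \<pi> a) x) y = ip H ((\<pi> (\<alpha> a) \<otimes>\<^bsub>Hil.BH\<^esub> Q i) x) y"
    using assms xy by simp
qed (use assms \<alpha>_closed in auto)

lemma adj_covariance:
  assumes "a \<in> carrier A" "i < n"
  shows "adj Hil.BH (Q i) \<otimes>\<^bsub>Hil.BH\<^esub> \<pi> (\<alpha> a) = \<pi> a \<otimes>\<^bsub>Hil.BH\<^esub> adj Hil.BH (Q i)"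
proof (rule Hil.op_eqI_ip)
  fix x y assume xy: "x \<in> carrier H" "y \<in> carrier H"
  have "ip H (\<pi> (\<alpha> a) x) (Q i y) = (\<Sum>j<n. ip H (\<pi> a (adj Hil.BH (Q j) x)) (adj Hil.BH (Q j) (Q i y)))"
    using assms xy by (intro ip_\<pi>_\<alpha>) auto
  also have "\<dots> = (\<Sum>j<n. if j = i then ip H (\<pi> a (adj Hil.BH (Q i) x)) y else 0)"
    using assms xy by (intro sum.cong) (auto simp: adj_Q_Q)
  also have "\<dots> = ip H (\<pi> a (adj Hil.BH (Q i) x)) y" using assms by simp
  finally show "ip H ((adj Hil.BH (Q i) \<otimes>\<^bsub>Hil.BH\<^esub> \<pi> (\<alpha> a)) x) y = ip H ((\<pi> a \<otimes>\<^bsub>Hil.BH\<^esub> adj Hil.BH (Q i)) x) y"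
    using assms xy \<alpha>_closed by (simp add: Hil.adj_ip')
qed (use assms \<alpha>_closed in auto)

lemma nrm_\<pi>:
  assumes a: "a \<in> carrier A" and b: "b \<in> carrier A" and adj: "adj A a \<in> carrier A" "adj A b \<in> carrier A"
    and eq: "adj A a \<otimes> a \<oplus> adj A b \<otimes> b = complex_of_real C \<odot> \<one>"
  shows "nrm Hil.BH (\<pi> a) \<le> sqrt \<bar>C\<bar>"
proof (rule Hil.nrm_op_le)
  fix x assume x: "x \<in> carrier H"
  have "ip H (\<pi> (adj A a \<otimes> a \<oplus> adj A b \<otimes> b) x) x = ip H (\<pi> a x) (\<pi> a x) + ip H (\<pi> b x) (\<pi> b x)"
    using a b adj x by (simp add: \<pi>_add \<pi>_mult \<pi>_adj Hil.ip_add Hil.adj_ip')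
  hence "(hnorm H (\<pi> a x))\<^sup>2 + (hnorm H (\<pi> b x))\<^sup>2 = C * (hnorm H x)\<^sup>2"
    using a b x unfolding eq
    by (simp add: \<pi>_smult \<pi>_one Hil.ip_smult Hil.ip_self flip: of_real_power of_real_mult of_real_add)
  hence "(hnorm H (\<pi> a x))\<^sup>2 \<le> C * (hnorm H x)\<^sup>2" using zero_le_power2[of "hnorm H (\<pi> b x)"] by linarith
  also have "\<dots> \<le> (sqrt \<bar>C\<bar> * hnorm H x)\<^sup>2" by (simp add: power_mult_distrib mult_right_mono)
  finally show "hnorm H (\<pi> a x) \<le> sqrt \<bar>C\<bar> * hnorm H x"
    by (rule power2_le_imp_le) (use x in auto)
qed auto

lemma gauge:
  assumes z: "\<And>i. i < n \<Longrightarrow> cmod (z i) = 1" and \<sigma>: "bij_betw \<sigma> {..<n} {..<n}"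
  shows "(H, \<pi>, \<lambda>i. z i \<odot>\<^bsub>Hil.BH\<^esub> Q (\<sigma> i)) \<in> stacey_reps A \<alpha> n"
proof -
  interpret B: normed_algebra Hil.BH by (rule Hil.normed_algebra_BH)
  let ?Q = "\<lambda>i. z i \<odot>\<^bsub>Hil.BH\<^esub> Q (\<sigma> i)"
  have \<sigma>n: "\<sigma> i < n" if "i < n" for i using \<sigma> that by (auto simp: bij_betw_def)
  have zz: "cnj (z i) * z i = 1" "z i * cnj (z i) = 1" if "i < n" for i
    using z[OF that] complex_norm_square[of "z i"] by (auto simp: mult.commute)
  have "toeplitz_cuntz_family Hil.BH n ?Q"
    unfolding toeplitz_cuntz_family_def
  proof (intro conjI allI impI)
    fix i j assume ij: "i < n" "j < n"
    have "(\<sigma> i = \<sigma> j) = (i = j)" using \<sigma> ij by (auto simp: bij_betw_def inj_on_def)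
    hence "adj Hil.BH (Q (\<sigma> i)) (Q (\<sigma> j) x) = (if i = j then x else \<zero>\<^bsub>H\<^esub>)" if "x \<in> carrier H" for x
      using ij \<sigma>n that by (simp add: adj_Q_Q)
    thus "adj Hil.BH (?Q i) \<otimes>\<^bsub>Hil.BH\<^esub> ?Q j = (if i = j then \<one>\<^bsub>Hil.BH\<^esub> else \<zero>\<^bsub>Hil.BH\<^esub>)"
      using ij \<sigma>n zz
      by (intro Hil.op_eqI) (auto simp: Hil.adj_smult Hil.op_smult Hil.smult_r_null simp flip: Hil.smult_assoc)
  qed (use \<sigma>n in auto)
  moreover have "implements A \<alpha> n Hil.BH \<pi> ?Q"
    unfolding implements_def
  proof
    fix a assume a: "a \<in> carrier A"
    let ?F = "\<lambda>i. Q i \<otimes>\<^bsub>Hil.BH\<^esub> \<pi> a \<otimes>\<^bsub>Hil.BH\<^esub> adj Hil.BH (Q i)"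
    have e: "?Q i \<otimes>\<^bsub>Hil.BH\<^esub> \<pi> a \<otimes>\<^bsub>Hil.BH\<^esub> adj Hil.BH (?Q i) = ?F (\<sigma> i)" if i: "i < n" for i
      using a i \<sigma>n[OF i] zz[OF i]
      by (intro Hil.op_eqI) (auto simp: Hil.adj_smult Hil.op_smult simp flip: Hil.smult_assoc)
    have "\<pi> (\<alpha> a) = finsum Hil.BH ?F (\<sigma> ` {..<n})" using a \<sigma> by (simp add: \<pi>_\<alpha> bij_betw_def)
    also have "\<dots> = finsum Hil.BH (\<lambda>i. ?F (\<sigma> i)) {..<n}"
      using a \<sigma> \<sigma>n by (intro B.finsum_reindex) (auto simp: bij_betw_def)
    also have "\<dots> = finsum Hil.BH (\<lambda>i. ?Q i \<otimes>\<^bsub>Hil.BH\<^esub> \<pi> a \<otimes>\<^bsub>Hil.BH\<^esub> adj Hil.BH (?Q i)) {..<n}"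
      using a \<sigma>n by (intro B.finsum_cong') (auto simp: e)
    finally show "\<pi> (\<alpha> a) = \<dots>" .
  qed
  ultimately show ?thesis using rep by (simp add: stacey_reps_def)
qed

end

context stacey_system
begin

lemma stacey_repI: "(H, \<pi>, Q) \<in> stacey_reps A \<alpha> n \<Longrightarrow> stacey_rep A \<alpha> H \<pi> Q n"
  by (intro stacey_rep.intro stacey_rep_axioms.intro stacey_system_axioms) (auto simp: stacey_reps_def)

end

locale stacey_universal = stacey_system A \<alpha> for A :: "'c cstar" (structure) and \<alpha> +
  fixes n :: nat
  assumes reps_nonempty: "stacey_reps A \<alpha> n \<noteq> {}"
begin

abbreviation "U \<equiv> stacey_ambient A \<alpha> n"
abbreviation "\<iota> \<equiv> stacey_incl A \<alpha> n"
abbreviation "t \<equiv> stacey_isom A \<alpha> n"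

lemma rep_cases:
  assumes "r \<in> stacey_reps A \<alpha> n"
  obtains H \<pi> Q where "r = (H, \<pi>, Q)" "stacey_rep A \<alpha> H \<pi> Q n"
  using assms by (cases r) (auto intro: stacey_repI)

sublocale U: normed_algebra U
  unfolding stacey_ambient_def
proof (rule normed_algebra_cstar_prod[OF reps_nonempty])
  fix r assume "r \<in> stacey_reps A \<alpha> n"
  then obtain H \<pi> Q where r: "r = (H, \<pi>, Q)" "stacey_rep A \<alpha> H \<pi> Q n" by (rule rep_cases)
  interpret stacey_rep A \<alpha> H \<pi> Q n by (rule r)
  show "normed_algebra (bounded_ops (fst r))" using Hil.normed_algebra_BH r by simp
qed

lemma U_eqI:
  assumes "x \<in> carrier U" "y \<in> carrier U"
    "\<And>H \<pi> Q. stacey_rep A \<alpha> H \<pi> Q n \<Longrightarrow> x (H, \<pi>, Q) = y (H, \<pi>, Q)"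
  shows "x = y"
  using assms(1,2) unfolding stacey_ambient_def
  by (rule cstar_prod_eqI) (use assms(3) rep_cases in metis)

lemma U_coord: "x \<in> carrier U \<Longrightarrow> (H, \<pi>, Q) \<in> stacey_reps A \<alpha> n \<Longrightarrow> x (H, \<pi>, Q) \<in> bounded_op_set H"
  unfolding stacey_ambient_def by (drule cstar_prod_coord) auto

lemma U_apply:
  assumes "(H, \<pi>, Q) \<in> stacey_reps A \<alpha> n"
  shows "(x \<otimes>\<^bsub>U\<^esub> y) (H, \<pi>, Q) = x (H, \<pi>, Q) \<otimes>\<^bsub>bounded_ops H\<^esub> y (H, \<pi>, Q)"
    "(x \<oplus>\<^bsub>U\<^esub> y) (H, \<pi>, Q) = x (H, \<pi>, Q) \<oplus>\<^bsub>bounded_ops H\<^esub> y (H, \<pi>, Q)"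
    "(c \<odot>\<^bsub>U\<^esub> x) (H, \<pi>, Q) = c \<odot>\<^bsub>bounded_ops H\<^esub> x (H, \<pi>, Q)"
    "\<one>\<^bsub>U\<^esub> (H, \<pi>, Q) = \<one>\<^bsub>bounded_ops H\<^esub>" "\<zero>\<^bsub>U\<^esub> (H, \<pi>, Q) = \<zero>\<^bsub>bounded_ops H\<^esub>"
    "adj U x (H, \<pi>, Q) = adj (bounded_ops H) (x (H, \<pi>, Q))"
    "\<iota> a (H, \<pi>, Q) = \<pi> a" "t i (H, \<pi>, Q) = Q i"
  using assms by (simp_all add: stacey_ambient_def stacey_incl_def stacey_isom_def)

lemma U_nrm_coord: "x \<in> carrier U \<Longrightarrow> (H, \<pi>, Q) \<in> stacey_reps A \<alpha> n \<Longrightarrow> nrm (bounded_ops H) (x (H, \<pi>, Q)) \<le> nrm U x"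
  unfolding stacey_ambient_def by (drule (1) nrm_coord_le) simp

lemma \<iota>_closed [simp, intro]: 
  assumes a: "a \<in> carrier A"
  shows "\<iota> a \<in> carrier U"
proof -
  obtain C b where b: "b \<in> carrier A" "adj A a \<in> carrier A" "adj A b \<in> carrier A"
    "adj A a \<otimes> a \<oplus> adj A b \<otimes> b = complex_of_real C \<odot> \<one>"
    using bounded_element[OF a] by blast
  have *: "(case r of (H, \<pi>, Q) \<Rightarrow> \<pi> a) \<in> carrier (bounded_ops (fst r)) \<and>
      nrm (bounded_ops (fst r)) (case r of (H, \<pi>, Q) \<Rightarrow> \<pi> a) \<le> sqrt \<bar>C\<bar>" if rR: "r \<in> stacey_reps A \<alpha> n" for r
  proof -
    obtain H \<pi> Q where r: "r = (H, \<pi>, Q)" "stacey_rep A \<alpha> H \<pi> Q n" using rR by (rule rep_cases)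
    interpret stacey_rep A \<alpha> H \<pi> Q n by (rule r)
    show ?thesis using a nrm_\<pi>[OF a b] by (simp add: r)
  qed
  show ?thesis unfolding stacey_ambient_def stacey_incl_def
    by (rule cstar_prodI) (use * in blast)+
qed

lemma t_closed [simp, intro]: 
  assumes i: "i < n"
  shows "t i \<in> carrier U"
proof -
  have *: "(case r of (H, \<pi>, Q) \<Rightarrow> Q i) \<in> carrier (bounded_ops (fst r)) \<and>
      nrm (bounded_ops (fst r)) (case r of (H, \<pi>, Q) \<Rightarrow> Q i) \<le> 1" if rR: "r \<in> stacey_reps A \<alpha> n" for r
  proof -
    obtain H \<pi> Q where r: "r = (H, \<pi>, Q)" "stacey_rep A \<alpha> H \<pi> Q n" using rR by (rule rep_cases)
    interpret stacey_rep A \<alpha> H \<pi> Q n by (rule r)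
    show ?thesis using i nrm_Q by (simp add: r)
  qed
  show ?thesis unfolding stacey_ambient_def stacey_isom_def
    by (rule cstar_prodI) (use * in blast)+
qed

lemma adj_U_closed:
  assumes x: "x \<in> carrier U"
  shows "adj U x \<in> carrier U"
proof -
  have *: "adj (bounded_ops (fst r)) (x r) \<in> carrier (bounded_ops (fst r)) \<and>
      nrm (bounded_ops (fst r)) (adj (bounded_ops (fst r)) (x r)) \<le> nrm U x" if rR: "r \<in> stacey_reps A \<alpha> n" for r
  proof -
    obtain H \<pi> Q where r: "r = (H, \<pi>, Q)" "stacey_rep A \<alpha> H \<pi> Q n" using rR by (rule rep_cases)
    interpret stacey_rep A \<alpha> H \<pi> Q n by (rule r)
    have "x r \<in> bounded_op_set H" "nrm (bounded_ops H) (x r) \<le> nrm U x"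
      using U_coord[OF x rep] U_nrm_coord[OF x rep] r by auto
    thus ?thesis using Hil.nrm_adj_le[of "x r"] by (simp add: r)
  qed
  show ?thesis unfolding stacey_ambient_def cstar_prod_simps 
    by (rule cstar_prodI) (use * stacey_ambient_def in blast)+
qed

lemma \<iota>_one: "\<iota> \<one> = \<one>\<^bsub>U\<^esub>"
  by (rule U_eqI) (auto simp: U_apply stacey_rep.rep stacey_rep.\<pi>_one)

lemma \<iota>_mult: "a \<in> carrier A \<Longrightarrow> b \<in> carrier A \<Longrightarrow> \<iota> (a \<otimes> b) = \<iota> a \<otimes>\<^bsub>U\<^esub> \<iota> b"
  by (rule U_eqI) (auto simp: U_apply stacey_rep.rep stacey_rep.\<pi>_mult)

lemma \<iota>_scalar: "\<iota> (c \<odot> \<one>) = c \<odot>\<^bsub>U\<^esub> \<one>\<^bsub>U\<^esub>"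
  by (rule U_eqI) (auto simp: U_apply stacey_rep.rep stacey_rep.\<pi>_smult stacey_rep.\<pi>_one scalar_closed U.smult_cl)

lemma t_\<iota>: "a \<in> carrier A \<Longrightarrow> i < n \<Longrightarrow> t i \<otimes>\<^bsub>U\<^esub> \<iota> a = \<iota> (\<alpha> a) \<otimes>\<^bsub>U\<^esub> t i"
  by (rule U_eqI) (auto simp: U_apply stacey_rep.rep stacey_rep.covariance \<alpha>_closed)

lemma closed_subalgebra_U: "closed_subalgebra U (carrier U)"
  by (rule U.closed_subalgebraI) (auto simp: U.smult_cl)

lemma closed_star_subalgebra_U: "closed_star_subalgebra U (carrier U)"
  using closed_subalgebra_U adj_U_closed by (auto simp: closed_star_subalgebra_def)

lemma gens_subset: "stacey_gens A \<alpha> n \<subseteq> carrier U"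
  by (auto simp: stacey_gens_def)

lemma carrier_crossed_product: "carrier (stacey_crossed_product A \<alpha> n) \<subseteq> carrier U"
  unfolding stacey_crossed_product_def
  using hull_minimal[OF gens_subset, of "closed_star_subalgebra U"] closed_star_subalgebra_U by simp

lemma carrier_semicrossed_product: "carrier (semicrossed_product A \<alpha> n) \<subseteq> carrier U"
  unfolding semicrossed_product_def
  using hull_minimal[OF gens_subset, of "closed_subalgebra U"] closed_subalgebra_U by simp

end

section \<open>The Hilbert space \<open>L\<^sup>2\<close> and the algebra \<open>L\<^sup>\<infinity>\<close>\<close>

lemma ae_class_cong: "AE x in M. f x = g x \<Longrightarrow> ae_class M f = ae_class M g"
  by (auto simp: ae_class_def)

lemma ae_class_self: "f \<in> borel_measurable M \<Longrightarrow> f \<in> ae_class M f"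
  by (auto simp: ae_class_def)

lemma
  assumes "f \<in> borel_measurable M"
  shows ae_rep_measurable: "ae_rep (ae_class M f) \<in> borel_measurable M"
    and ae_rep_AE: "AE x in M. ae_rep (ae_class M f) x = f x"
  using someI[of "\<lambda>g. g \<in> ae_class M f", OF ae_class_self[OF assms]]
  by (auto simp: ae_rep_def ae_class_def)

lemma ae_map_class: "f \<in> borel_measurable M \<Longrightarrow> ae_map M g (ae_class M f) = ae_class M (\<lambda>x. g (f x))"
  unfolding ae_map_def using ae_rep_AE[of f M] by (intro ae_class_cong) auto

lemma ae_map2_class:
  "f \<in> borel_measurable M \<Longrightarrow> h \<in> borel_measurable M \<Longrightarrow>
    ae_map2 M g (ae_class M f) (ae_class M h) = ae_class M (\<lambda>x. g (f x) (h x))"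
  unfolding ae_map2_def using ae_rep_AE[of f M] ae_rep_AE[of h M] by (intro ae_class_cong) auto

definition square_integrable :: "'a measure \<Rightarrow> ('a \<Rightarrow> complex) \<Rightarrow> bool" where
  "square_integrable M f \<longleftrightarrow> f \<in> borel_measurable M \<and> integrable M (\<lambda>x. (norm (f x))\<^sup>2)"

definition ess_bounded :: "'a measure \<Rightarrow> ('a \<Rightarrow> complex) \<Rightarrow> bool" where
  "ess_bounded M f \<longleftrightarrow> f \<in> borel_measurable M \<and> (\<exists>C. AE x in M. norm (f x) \<le> C)"

lemma carrier_L2: "carrier (L2 M) = ae_class M ` Collect (square_integrable M)"
  by (simp add: L2_def square_integrable_def[abs_def])

lemma carrier_Linf: "carrier (Linf M) = ae_class M ` Collect (ess_bounded M)"
  by (simp add: Linf_def ess_bounded_def[abs_def])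

lemma L2_closed [intro]: "square_integrable M f \<Longrightarrow> ae_class M f \<in> carrier (L2 M)"
  by (auto simp: carrier_L2)

lemma Linf_closed [intro]: "ess_bounded M f \<Longrightarrow> ae_class M f \<in> carrier (Linf M)"
  by (auto simp: carrier_Linf)

lemma L2_cases:
  assumes "F \<in> carrier (L2 M)"
  obtains f where "square_integrable M f" "F = ae_class M f"
  using assms by (auto simp: carrier_L2)

lemma Linf_cases:
  assumes "F \<in> carrier (Linf M)"
  obtains f where "ess_bounded M f" "F = ae_class M f"
  using assms by (auto simp: carrier_Linf)

lemma square_integrable_measurable [measurable_dest, dest]: "square_integrable M f \<Longrightarrow> f \<in> borel_measurable M"
  by (simp add: square_integrable_def)

lemma ess_bounded_measurable [measurable_dest, dest]: "ess_bounded M f \<Longrightarrow> f \<in> borel_measurable M"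
  by (simp add: ess_bounded_def)

lemma square_integrable_bound:
  assumes "f \<in> borel_measurable M" "integrable M g" "AE x in M. (norm (f x))\<^sup>2 \<le> g x"
  shows "square_integrable M f"
  unfolding square_integrable_def
proof
  show "integrable M (\<lambda>x. (norm (f x))\<^sup>2)"
    by (rule Bochner_Integration.integrable_bound[OF assms(2)]) (use assms in auto)
qed (fact assms)

lemma norm_add_sq_le: "(norm (a + b :: complex))\<^sup>2 \<le> 2 * (norm a)\<^sup>2 + 2 * (norm b)\<^sup>2"
proof -
  have "(norm (a + b))\<^sup>2 \<le> (norm a + norm b)\<^sup>2" by (intro power_mono norm_triangle_ineq) auto
  also have "\<dots> \<le> 2 * (norm a)\<^sup>2 + 2 * (norm b)\<^sup>2"
    using zero_le_power2[of "norm a - norm b"] by (simp add: power2_sum power2_diff)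
  finally show ?thesis .
qed

lemma square_integrable_add:
  assumes "square_integrable M f" "square_integrable M g"
  shows "square_integrable M (\<lambda>x. f x + g x)"
  by (rule square_integrable_bound[of _ _ "\<lambda>x. 2 * (norm (f x))\<^sup>2 + 2 * (norm (g x))\<^sup>2"])
     (use assms norm_add_sq_le in \<open>auto simp: square_integrable_def\<close>)

lemma square_integrable_mult:
  assumes f: "ess_bounded M f" and g: "square_integrable M g"
  shows "square_integrable M (\<lambda>x. f x * g x)"
proof -
  obtain C where C: "AE x in M. norm (f x) \<le> C" using f by (auto simp: ess_bounded_def)
  show ?thesis
  proof (rule square_integrable_bound[of _ _ "\<lambda>x. C\<^sup>2 * (norm (g x))\<^sup>2"])
    show "AE x in M. (norm (f x * g x))\<^sup>2 \<le> C\<^sup>2 * (norm (g x))\<^sup>2"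
      using C by eventually_elim (auto simp: norm_mult power_mult_distrib intro!: mult_right_mono power_mono)
  qed (use f g in \<open>auto simp: square_integrable_def ess_bounded_def\<close>)
qed

lemma ess_bounded_const [simp, intro]: "ess_bounded M (\<lambda>_. c)"
  by (auto simp: ess_bounded_def)

lemma ess_bounded_add:
  assumes "ess_bounded M f" "ess_bounded M g"
  shows "ess_bounded M (\<lambda>x. f x + g x)"
proof -
  obtain C D where C: "AE x in M. norm (f x) \<le> C" "AE x in M. norm (g x) \<le> D"
    using assms by (auto simp: ess_bounded_def)
  have "AE x in M. norm (f x + g x) \<le> C + D"
    using C by eventually_elim (meson add_mono norm_triangle_ineq order_trans)
  thus ?thesis using assms by (auto simp: ess_bounded_def)
qed

lemma ess_bounded_mult:
  assumes "ess_bounded M f" "ess_bounded M g"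
  shows "ess_bounded M (\<lambda>x. f x * g x)"
proof -
  obtain C D where C: "AE x in M. norm (f x) \<le> C" "AE x in M. norm (g x) \<le> D"
    using assms by (auto simp: ess_bounded_def)
  have "AE x in M. norm (f x * g x) \<le> C * D"
    using C by eventually_elim (auto simp: norm_mult intro!: mult_mono intro: order_trans[OF norm_ge_zero])
  thus ?thesis using assms by (auto simp: ess_bounded_def)
qed

lemma ess_bounded_cnj: "ess_bounded M f \<Longrightarrow> ess_bounded M (\<lambda>x. cnj (f x))"
  by (auto simp: ess_bounded_def intro!: borel_measurable_continuous_on[of cnj] continuous_intros)

lemma square_integrable_smult: "square_integrable M f \<Longrightarrow> square_integrable M (\<lambda>x. c * f x)"
  by (rule square_integrable_mult) auto

lemma integrable_ip:
  assumes f: "square_integrable M f" and g: "square_integrable M g"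
  shows "integrable M (\<lambda>x. f x * cnj (g x))"
proof (rule Bochner_Integration.integrable_bound)
  show "integrable M (\<lambda>x. (norm (f x))\<^sup>2 + (norm (g x))\<^sup>2)"
    using assms by (auto simp: square_integrable_def)
  show "(\<lambda>x. f x * cnj (g x)) \<in> borel_measurable M"
    using assms by (auto intro!: borel_measurable_times borel_measurable_continuous_on[of cnj] continuous_intros)
  have "a * b \<le> a\<^sup>2 + b\<^sup>2" for a b :: real
  proof -
    have "0 \<le> (a - b)\<^sup>2 + a\<^sup>2 + b\<^sup>2" by simp
    thus ?thesis by (simp add: power2_diff)
  qed
  thus "AE x in M. norm (f x * cnj (g x)) \<le> norm ((norm (f x))\<^sup>2 + (norm (g x))\<^sup>2)"
    by (simp add: norm_mult)
qed

lemma L2_simps: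
  "\<zero>\<^bsub>L2 M\<^esub> = ae_class M (\<lambda>_. 0)" "F \<oplus>\<^bsub>L2 M\<^esub> G = ae_map2 M (+) F G" "c \<odot>\<^bsub>L2 M\<^esub> F = ae_map M ((*) c) F"
  "ip (L2 M) F G = (\<integral>x. ae_rep F x * cnj (ae_rep G x) \<partial>M)"
  by (simp_all add: L2_def)

lemma Linf_simps:
  "\<one>\<^bsub>Linf M\<^esub> = ae_class M (\<lambda>_. 1)" "\<zero>\<^bsub>Linf M\<^esub> = ae_class M (\<lambda>_. 0)" "F \<oplus>\<^bsub>Linf M\<^esub> G = ae_map2 M (+) F G"
  "F \<otimes>\<^bsub>Linf M\<^esub> G = ae_map2 M (*) F G" "c \<odot>\<^bsub>Linf M\<^esub> F = ae_map M ((*) c) F" "adj (Linf M) F = ae_map M cnj F"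
  by (simp_all add: Linf_def)

lemma ip_class:
  assumes f: "square_integrable M f" and g: "square_integrable M g"
  shows "ip (L2 M) (ae_class M f) (ae_class M g) = (\<integral>x. f x * cnj (g x) \<partial>M)"
  unfolding L2_simps
proof (rule integral_cong_AE)
  have [measurable]: "f \<in> borel_measurable M" "g \<in> borel_measurable M" using assms by auto
  note [measurable] = ae_rep_measurable
  have [measurable]: "cnj \<in> borel_measurable borel" by (intro borel_measurable_continuous_onI continuous_intros)
  show "(\<lambda>x. ae_rep (ae_class M f) x * cnj (ae_rep (ae_class M g) x)) \<in> borel_measurable M"
    "(\<lambda>x. f x * cnj (g x)) \<in> borel_measurable M" by measurable
  show "AE x in M. ae_rep (ae_class M f) x * cnj (ae_rep (ae_class M g) x) = f x * cnj (g x)"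
    using ae_rep_AE[of f M] ae_rep_AE[of g M] by auto
qed

lemma hnorm_class:
  assumes f: "square_integrable M f"
  shows "hnorm (L2 M) (ae_class M f) = sqrt (\<integral>x. (norm (f x))\<^sup>2 \<partial>M)"
proof -
  have "ip (L2 M) (ae_class M f) (ae_class M f) = (\<integral>x. complex_of_real ((norm (f x))\<^sup>2) \<partial>M)"
    unfolding ip_class[OF f f] by (intro Bochner_Integration.integral_cong) (simp_all only: complex_norm_square)
  thus ?thesis by (simp only: hnorm_def integral_complex_of_real Re_complex_of_real)
qed

lemma L2_abelian_group: "abelian_group (L2 M)"
proof (rule abelian_groupI)
  fix F G K assume "F \<in> carrier (L2 M)" "G \<in> carrier (L2 M)" "K \<in> carrier (L2 M)"
  then obtain f g k where F: "square_integrable M f" "F = ae_class M f"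
    and G: "square_integrable M g" "G = ae_class M g" and K: "square_integrable M k" "K = ae_class M k"
    by (metis L2_cases)
  show "F \<oplus>\<^bsub>L2 M\<^esub> G \<oplus>\<^bsub>L2 M\<^esub> K = F \<oplus>\<^bsub>L2 M\<^esub> (G \<oplus>\<^bsub>L2 M\<^esub> K)"
    using F G K square_integrable_add[of M f g] square_integrable_add[of M g k]
    by (simp add: L2_simps ae_map2_class square_integrable_measurable add.assoc)
next
  fix F G assume "F \<in> carrier (L2 M)" "G \<in> carrier (L2 M)"
  then obtain f g where F: "square_integrable M f" "F = ae_class M f"
    and G: "square_integrable M g" "G = ae_class M g" by (metis L2_cases)
  show "F \<oplus>\<^bsub>L2 M\<^esub> G \<in> carrier (L2 M)" "F \<oplus>\<^bsub>L2 M\<^esub> G = G \<oplus>\<^bsub>L2 M\<^esub> F"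
    using F G square_integrable_add[of M f g]
    by (auto simp: L2_simps ae_map2_class square_integrable_measurable add.commute)
next
  fix F assume "F \<in> carrier (L2 M)"
  then obtain f where F: "square_integrable M f" "F = ae_class M f" by (metis L2_cases)
  show "\<zero>\<^bsub>L2 M\<^esub> \<oplus>\<^bsub>L2 M\<^esub> F = F"
    using F by (simp add: L2_simps ae_map2_class square_integrable_measurable)
  show "\<exists>G\<in>carrier (L2 M). G \<oplus>\<^bsub>L2 M\<^esub> F = \<zero>\<^bsub>L2 M\<^esub>"
    using F square_integrable_smult[of M f "-1"]
    by (intro bexI[of _ "ae_class M (\<lambda>x. -1 * f x)"])
       (auto simp: L2_simps ae_map2_class square_integrable_measurable)
qed (auto simp: L2_simps square_integrable_def)

lemma L2_minus_class:
  assumes f: "square_integrable M f" and g: "square_integrable M g"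
  shows "ae_class M f \<ominus>\<^bsub>L2 M\<^esub> ae_class M g = ae_class M (\<lambda>x. f x - g x)"
    and "square_integrable M (\<lambda>x. f x - g x)"
proof -
  interpret abelian_group "L2 M" by (rule L2_abelian_group)
  have g': "square_integrable M (\<lambda>x. -1 * g x)" using g by (rule square_integrable_smult)
  have "\<ominus>\<^bsub>L2 M\<^esub> ae_class M g = ae_class M (\<lambda>x. -1 * g x)"
    by (rule minus_equality) (use g g' in \<open>auto simp: L2_simps ae_map2_class square_integrable_measurable\<close>)
  thus "ae_class M f \<ominus>\<^bsub>L2 M\<^esub> ae_class M g = ae_class M (\<lambda>x. f x - g x)"
    using f g g' by (simp add: minus_eq L2_simps ae_map2_class square_integrable_measurable)
  show "square_integrable M (\<lambda>x. f x - g x)" using square_integrable_add[OF f g'] by simp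
qed

lemma Linf_cring: "cring (Linf M)"
proof (rule cringI)
  show "abelian_group (Linf M)"
  proof (rule abelian_groupI)
    fix F G K assume "F \<in> carrier (Linf M)" "G \<in> carrier (Linf M)" "K \<in> carrier (Linf M)"
    then obtain f g k where F: "ess_bounded M f" "F = ae_class M f"
      and G: "ess_bounded M g" "G = ae_class M g" and K: "ess_bounded M k" "K = ae_class M k"
      by (metis Linf_cases)
    show "F \<oplus>\<^bsub>Linf M\<^esub> G \<oplus>\<^bsub>Linf M\<^esub> K = F \<oplus>\<^bsub>Linf M\<^esub> (G \<oplus>\<^bsub>Linf M\<^esub> K)"
      using F G K ess_bounded_add[of M f g] ess_bounded_add[of M g k]
      by (simp add: Linf_simps ae_map2_class ess_bounded_measurable add.assoc)
  next
    fix F G assume "F \<in> carrier (Linf M)" "G \<in> carrier (Linf M)"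
    then obtain f g where F: "ess_bounded M f" "F = ae_class M f"
      and G: "ess_bounded M g" "G = ae_class M g" by (metis Linf_cases)
    show "F \<oplus>\<^bsub>Linf M\<^esub> G \<in> carrier (Linf M)" "F \<oplus>\<^bsub>Linf M\<^esub> G = G \<oplus>\<^bsub>Linf M\<^esub> F"
      using F G ess_bounded_add[of M f g]
      by (auto simp: Linf_simps ae_map2_class ess_bounded_measurable add.commute)
  next
    fix F assume "F \<in> carrier (Linf M)"
    then obtain f where F: "ess_bounded M f" "F = ae_class M f" by (metis Linf_cases)
    show "\<zero>\<^bsub>Linf M\<^esub> \<oplus>\<^bsub>Linf M\<^esub> F = F"
      using F by (simp add: Linf_simps ae_map2_class ess_bounded_measurable)
    show "\<exists>G\<in>carrier (Linf M). G \<oplus>\<^bsub>Linf M\<^esub> F = \<zero>\<^bsub>Linf M\<^esub>"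
      using F ess_bounded_mult[of M "\<lambda>_. -1" f]
      by (intro bexI[of _ "ae_class M (\<lambda>x. -1 * f x)"])
         (auto simp: Linf_simps ae_map2_class ess_bounded_measurable)
  qed (auto simp: Linf_simps)
next
  show "comm_monoid (Linf M)"
  proof (rule comm_monoidI)
    fix F G K assume "F \<in> carrier (Linf M)" "G \<in> carrier (Linf M)" "K \<in> carrier (Linf M)"
    then obtain f g k where F: "ess_bounded M f" "F = ae_class M f"
      and G: "ess_bounded M g" "G = ae_class M g" and K: "ess_bounded M k" "K = ae_class M k"
      by (metis Linf_cases)
    show "F \<otimes>\<^bsub>Linf M\<^esub> G \<otimes>\<^bsub>Linf M\<^esub> K = F \<otimes>\<^bsub>Linf M\<^esub> (G \<otimes>\<^bsub>Linf M\<^esub> K)"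
      using F G K ess_bounded_mult[of M f g] ess_bounded_mult[of M g k]
      by (simp add: Linf_simps ae_map2_class ess_bounded_measurable mult.assoc)
  next
    fix F G assume "F \<in> carrier (Linf M)" "G \<in> carrier (Linf M)"
    then obtain f g where F: "ess_bounded M f" "F = ae_class M f"
      and G: "ess_bounded M g" "G = ae_class M g" by (metis Linf_cases)
    show "F \<otimes>\<^bsub>Linf M\<^esub> G \<in> carrier (Linf M)" "F \<otimes>\<^bsub>Linf M\<^esub> G = G \<otimes>\<^bsub>Linf M\<^esub> F"
      using F G ess_bounded_mult[of M f g]
      by (auto simp: Linf_simps ae_map2_class ess_bounded_measurable mult.commute)
  next
    fix F assume "F \<in> carrier (Linf M)"
    then obtain f where F: "ess_bounded M f" "F = ae_class M f" by (metis Linf_cases)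
    show "\<one>\<^bsub>Linf M\<^esub> \<otimes>\<^bsub>Linf M\<^esub> F = F"
      using F by (simp add: Linf_simps ae_map2_class ess_bounded_measurable)
  qed (auto simp: Linf_simps)
next
  fix F G K assume "F \<in> carrier (Linf M)" "G \<in> carrier (Linf M)" "K \<in> carrier (Linf M)"
  then obtain f g k where F: "ess_bounded M f" "F = ae_class M f"
    and G: "ess_bounded M g" "G = ae_class M g" and K: "ess_bounded M k" "K = ae_class M k"
    by (metis Linf_cases)
  show "(F \<oplus>\<^bsub>Linf M\<^esub> G) \<otimes>\<^bsub>Linf M\<^esub> K = F \<otimes>\<^bsub>Linf M\<^esub> K \<oplus>\<^bsub>Linf M\<^esub> G \<otimes>\<^bsub>Linf M\<^esub> K"
    using F G K ess_bounded_add[of M f g] ess_bounded_mult[of M g k] ess_bounded_mult[of M f k]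
    by (simp add: Linf_simps ae_map2_class ess_bounded_measurable distrib_right)
qed

lemma Linf_system:
  assumes "star_hom (Linf M) (Linf M) \<alpha>" "\<alpha> \<one>\<^bsub>Linf M\<^esub> = \<one>\<^bsub>Linf M\<^esub>"
  shows "stacey_system (Linf M) \<alpha>"
proof -
  interpret cring "Linf M" by (rule Linf_cring)
  show ?thesis
  proof
    fix c show "c \<odot>\<^bsub>Linf M\<^esub> \<one>\<^bsub>Linf M\<^esub> \<in> carrier (Linf M)"
      by (auto simp: Linf_simps ae_map_class)
  next
    fix F assume "F \<in> carrier (Linf M)"
    then obtain f where f: "ess_bounded M f" "F = ae_class M f" by (metis Linf_cases)
    obtain C where C: "AE x in M. norm (f x) \<le> C" using f by (auto simp: ess_bounded_def)
    define g where "g x = complex_of_real (sqrt (C\<^sup>2 - (norm (f x))\<^sup>2))" for x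
    have [measurable]: "f \<in> borel_measurable M" using f by auto
    have sq: "AE x in M. (norm (f x))\<^sup>2 \<le> C\<^sup>2"
      using C by eventually_elim (auto intro: power_mono)
    have "AE x in M. norm (g x) \<le> \<bar>C\<bar>"
      using sq by eventually_elim (auto simp: g_def intro!: real_le_lsqrt)
    moreover have "g \<in> borel_measurable M" unfolding g_def by measurable
    ultimately have g: "ess_bounded M g" by (auto simp: ess_bounded_def)
    have ae: "AE x in M. cnj (f x) * f x + cnj (g x) * g x = complex_of_real (C\<^sup>2) * 1"
      using sq
    proof eventually_elim
      case (elim x)
      have "cnj (f x) * f x = complex_of_real ((norm (f x))\<^sup>2)" by (simp only: complex_norm_square mult.commute)
      moreover have "cnj (g x) * g x = complex_of_real (C\<^sup>2 - (norm (f x))\<^sup>2)"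
        using elim by (simp add: g_def flip: of_real_mult)
      ultimately show ?case by simp
    qed
    have "adj (Linf M) F \<otimes>\<^bsub>Linf M\<^esub> F \<oplus>\<^bsub>Linf M\<^esub> adj (Linf M) (ae_class M g) \<otimes>\<^bsub>Linf M\<^esub> ae_class M g
        = complex_of_real (C\<^sup>2) \<odot>\<^bsub>Linf M\<^esub> \<one>\<^bsub>Linf M\<^esub>"
      using f g ess_bounded_cnj[OF f(1)] ess_bounded_cnj[OF g] ess_bounded_mult[OF ess_bounded_cnj[OF f(1)] f(1)]
        ess_bounded_mult[OF ess_bounded_cnj[OF g] g] ae_class_cong[OF ae]
      by (simp add: Linf_simps ae_map2_class ae_map_class ess_bounded_measurable)
    thus "\<exists>C b. b \<in> carrier (Linf M) \<and> adj (Linf M) F \<in> carrier (Linf M) \<and> adj (Linf M) b \<in> carrier (Linf M) \<and>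
        adj (Linf M) F \<otimes>\<^bsub>Linf M\<^esub> F \<oplus>\<^bsub>Linf M\<^esub> adj (Linf M) b \<otimes>\<^bsub>Linf M\<^esub> b = complex_of_real C \<odot>\<^bsub>Linf M\<^esub> \<one>\<^bsub>Linf M\<^esub>"
      using f g ess_bounded_cnj[OF f(1)] ess_bounded_cnj[OF g]
      by (intro exI[of _ "C\<^sup>2"] exI[of _ "ae_class M g"]) (auto simp: Linf_simps ae_map_class ess_bounded_measurable)
  qed (use assms in \<open>auto simp: star_hom_def alg_hom_def\<close>)
qed

context prob_space
begin

lemma L2_complete:
  assumes s: "\<And>k. square_integrable M (f k)"
    and cauchy: "\<And>e. e > 0 \<Longrightarrow> \<exists>N. \<forall>i\<ge>N. \<forall>j\<ge>N. (\<integral>x. (norm (f i x - f j x))\<^sup>2 \<partial>M) < e"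
  shows "\<exists>g. square_integrable M g \<and> (\<lambda>k. \<integral>x. (norm (f k x - g x))\<^sup>2 \<partial>M) \<longlonglongrightarrow> 0"
proof -
  have [measurable]: "f k \<in> borel_measurable M" for k using s by auto
  have sd: "square_integrable M (\<lambda>x. f i x - f j x)" for i j using L2_minus_class(2)[OF s s] .
  have int: "integrable M (\<lambda>x. (norm (f i x - f j x))\<^sup>2)" for i j using sd by (simp add: square_integrable_def)
  have "\<exists>r. \<forall>k. (\<forall>i\<ge>r k. \<forall>j\<ge>r k. (\<integral>x. (norm (f i x - f j x))\<^sup>2 \<partial>M) < (1/4)^k) \<and> r k < r (Suc k)"
  proof (rule dependent_nat_choice)
    show "\<exists>x. \<forall>i\<ge>x. \<forall>j\<ge>x. (\<integral>x. (norm (f i x - f j x))\<^sup>2 \<partial>M) < (1/4)^0" by (rule cauchy) simp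
    fix x n
    obtain N where N: "\<forall>i\<ge>N. \<forall>j\<ge>N. (\<integral>x. (norm (f i x - f j x))\<^sup>2 \<partial>M) < (1/4)^Suc n"
      using cauchy[of "(1/4)^Suc n"] by auto
    show "\<exists>y. (\<forall>i\<ge>y. \<forall>j\<ge>y. (\<integral>x. (norm (f i x - f j x))\<^sup>2 \<partial>M) < (1/4)^Suc n) \<and> x < y"
      using N by (intro exI[of _ "max N (Suc x)"]) auto
  qed
  then obtain r where r: "\<And>k i j. i \<ge> r k \<Longrightarrow> j \<ge> r k \<Longrightarrow> (\<integral>x. (norm (f i x - f j x))\<^sup>2 \<partial>M) < (1/4)^k"
    and rS: "\<And>k. r k < r (Suc k)" by blast
  have rmono: "strict_mono r" using rS by (rule strict_monoI_Suc)
  define d where "d k x = norm (f (r (Suc k)) x - f (r k) x)" for k x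
  have [measurable]: "d k \<in> borel_measurable M" for k unfolding d_def by measurable
  have d_le: "d k x \<le> ((1/2)^k + (d k x)\<^sup>2 * 2^k) / 2" for k x
  proof -
    have "0 \<le> ((1/2)^k - d k x)\<^sup>2 * 2^k" by simp
    also have "\<dots> = (1/2)^k - 2 * d k x + (d k x)\<^sup>2 * 2^k"
      by (simp add: power2_eq_square field_simps flip: power_mult_distrib)
    finally show ?thesis by simp
  qed
  have dsq: "integrable M (\<lambda>x. (d k x)\<^sup>2)" for k unfolding d_def by (rule int)
  have dint: "integrable M (d k)" for k
    by (rule Bochner_Integration.integrable_bound[of _ "\<lambda>x. ((1/2)^k + (d k x)\<^sup>2 * 2^k) / 2"])
       (use dsq d_le in \<open>auto simp: d_def intro!: order_trans[OF d_le[unfolded d_def]]\<close>)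
  have dI: "(\<integral>x. d k x \<partial>M) \<le> (1/2)^k" for k
  proof -
    have "(\<integral>x. d k x \<partial>M) \<le> (\<integral>x. ((1/2)^k + (d k x)\<^sup>2 * 2^k) / 2 \<partial>M)"
      by (rule integral_mono) (use dint dsq d_le in auto)
    also have "\<dots> = ((1/2)^k + (\<integral>x. (d k x)\<^sup>2 \<partial>M) * 2^k) / 2"
      using dsq by (simp add: prob_space)
    also have "\<dots> \<le> ((1/2)^k + (1/4)^k * 2^k) / 2"
      using r[of k "r (Suc k)" "r k"] rS[of k] unfolding d_def
      by (intro divide_right_mono add_left_mono mult_right_mono) (auto intro: less_imp_le)
    also have "\<dots> = (1/2)^k" by (simp flip: power_mult_distrib)
    finally show ?thesis .
  qed
  have d0: "0 \<le> d k x" for k x by (simp add: d_def)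
  have nn: "(\<integral>\<^sup>+x. (\<Sum>k. ennreal (d k x)) \<partial>M) < \<infinity>"
  proof -
    have "(\<integral>\<^sup>+x. (\<Sum>k. ennreal (d k x)) \<partial>M) = (\<Sum>k. \<integral>\<^sup>+x. ennreal (d k x) \<partial>M)"
      by (rule nn_integral_suminf) measurable
    also have "\<dots> = (\<Sum>k. ennreal (\<integral>x. d k x \<partial>M))"
      by (intro suminf_cong nn_integral_eq_integral dint) (simp add: d0)
    also have "\<dots> \<le> (\<Sum>k. ennreal ((1/2)^k))"
      by (intro suminf_le summableI ennreal_leI dI)
    also have "\<dots> = ennreal (\<Sum>k. (1/2)^k)"
      by (rule suminf_ennreal2) (auto intro: summable_geometric)
    finally show ?thesis by (rule le_less_trans) simp
  qed
  have "AE x in M. (\<Sum>k. ennreal (d k x)) \<noteq> \<infinity>"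
    by (rule nn_integral_PInf_AE) (use nn in auto)
  hence conv: "AE x in M. convergent (\<lambda>k. f (r k) x)"
  proof eventually_elim
    case (elim x)
    have "summable (\<lambda>k. d k x)"
      by (rule summable_suminf_not_top) (use elim d0 in auto)
    hence "summable (\<lambda>k. f (r (Suc k)) x - f (r k) x)"
      unfolding d_def by (rule summable_norm_cancel)
    hence "convergent (\<lambda>m. \<Sum>k<m. f (r (Suc k)) x - f (r k) x)" by (simp add: summable_iff_convergent)
    hence "convergent (\<lambda>m. (\<Sum>k<m. f (r (Suc k)) x - f (r k) x) + f (r 0) x)"
      by (intro convergent_add convergent_const)
    thus ?case by (simp add: sum_lessThan_telescope[of "\<lambda>k. f (r k) x"])
  qed
  define g where "g x = lim (\<lambda>k. f (r k) x)" for x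
  have [measurable]: "g \<in> borel_measurable M" unfolding g_def by measurable
  have lim: "AE x in M. (\<lambda>k. f (r k) x) \<longlonglongrightarrow> g x"
    using conv by eventually_elim (simp add: g_def convergent_LIMSEQ_iff)
  have fatou: "(\<integral>\<^sup>+x. ennreal ((norm (f i x - g x))\<^sup>2) \<partial>M) \<le> ennreal e"
    if N: "\<forall>i\<ge>N. \<forall>j\<ge>N. (\<integral>x. (norm (f i x - f j x))\<^sup>2 \<partial>M) < e" and i: "i \<ge> N" for i N e
  proof -
    let ?u = "\<lambda>k x. ennreal ((norm (f i x - f (r k) x))\<^sup>2)"
    have "AE x in M. ennreal ((norm (f i x - g x))\<^sup>2) = liminf (\<lambda>k. ?u k x)"
      using lim
    proof eventually_elim
      case (elim x)
      have "(\<lambda>k. ?u k x) \<longlonglongrightarrow> ennreal ((norm (f i x - g x))\<^sup>2)"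
        by (intro tendsto_intros elim)
      thus ?case by (intro lim_imp_Liminf[symmetric]) simp_all
    qed
    hence "(\<integral>\<^sup>+x. ennreal ((norm (f i x - g x))\<^sup>2) \<partial>M) = (\<integral>\<^sup>+x. liminf (\<lambda>k. ?u k x) \<partial>M)"
      by (rule nn_integral_cong_AE)
    also have "\<dots> \<le> liminf (\<lambda>k. \<integral>\<^sup>+x. ?u k x \<partial>M)" by (rule nn_integral_liminf) measurable
    also have "\<dots> \<le> limsup (\<lambda>k. \<integral>\<^sup>+x. ?u k x \<partial>M)" by (rule Liminf_le_Limsup) simp
    also have "\<dots> \<le> ennreal e"
    proof (rule Limsup_bounded, rule eventually_sequentiallyI[of N])
      fix k assume "k \<ge> N"
      hence "r k \<ge> N" using seq_suble[OF rmono, of k] by linarith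
      hence "(\<integral>x. (norm (f i x - f (r k) x))\<^sup>2 \<partial>M) \<le> e" using N i by (auto intro: less_imp_le)
      thus "(\<integral>\<^sup>+x. ?u k x \<partial>M) \<le> ennreal e"
        using int by (subst nn_integral_eq_integral) (auto intro: ennreal_leI)
    qed
    finally show ?thesis .
  qed
  have gi: "integrable M (\<lambda>x. (norm (f i x - g x))\<^sup>2) \<and> (\<integral>x. (norm (f i x - g x))\<^sup>2 \<partial>M) \<le> e"
    if N: "\<forall>i\<ge>N. \<forall>j\<ge>N. (\<integral>x. (norm (f i x - f j x))\<^sup>2 \<partial>M) < e" and i: "i \<ge> N" and e: "e > 0" for i N e
  proof
    show ii: "integrable M (\<lambda>x. (norm (f i x - g x))\<^sup>2)"
      by (rule integrableI_bounded)
         (use le_less_trans[OF fatou[OF N i] ennreal_less_top] in auto)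
    show "(\<integral>x. (norm (f i x - g x))\<^sup>2 \<partial>M) \<le> e"
      using fatou[OF N i] ii e by (subst (asm) nn_integral_eq_integral) auto
  qed
  obtain N where "\<forall>i\<ge>N. \<forall>j\<ge>N. (\<integral>x. (norm (f i x - f j x))\<^sup>2 \<partial>M) < 1" using cauchy[of 1] by auto
  from gi[OF this order.refl] have "square_integrable M (\<lambda>x. f N x - g x)" by (simp add: square_integrable_def)
  from L2_minus_class(2)[OF s[of N] this] have "square_integrable M g" by simp
  moreover have "(\<lambda>k. \<integral>x. (norm (f k x - g x))\<^sup>2 \<partial>M) \<longlonglongrightarrow> 0"
  proof (rule LIMSEQ_I)
    fix e :: real assume e: "e > 0"
    obtain N where N: "\<forall>i\<ge>N. \<forall>j\<ge>N. (\<integral>x. (norm (f i x - f j x))\<^sup>2 \<partial>M) < e / 2"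
      using cauchy[of "e / 2"] e by auto
    show "\<exists>N. \<forall>k\<ge>N. norm ((\<integral>x. (norm (f k x - g x))\<^sup>2 \<partial>M) - 0) < e"
    proof (intro exI allI impI)
      fix k assume "k \<ge> N"
      from gi[OF N this] e have "(\<integral>x. (norm (f k x - g x))\<^sup>2 \<partial>M) \<le> e / 2" by simp
      moreover have "0 \<le> (\<integral>x. (norm (f k x - g x))\<^sup>2 \<partial>M)" by simp
      ultimately show "norm ((\<integral>x. (norm (f k x - g x))\<^sup>2 \<partial>M) - 0) < e" using e by simp
    qed
  qed
  ultimately show ?thesis by blast
qed

lemma L2_hilbert: "complex_hilbert_space (L2 M)"
proof -
  interpret cring complex_ring by (rule cring_complex_ring)
  have mod: "Module.module complex_ring (L2 M)"
  proof (rule moduleI[OF cring_complex_ring L2_abelian_group])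
    fix a b F G assume "F \<in> carrier (L2 M)" "G \<in> carrier (L2 M)"
    then obtain f g where F: "square_integrable M f" "F = ae_class M f"
      and G: "square_integrable M g" "G = ae_class M g" by (metis L2_cases)
    show "a \<odot>\<^bsub>L2 M\<^esub> (F \<oplus>\<^bsub>L2 M\<^esub> G) = a \<odot>\<^bsub>L2 M\<^esub> F \<oplus>\<^bsub>L2 M\<^esub> a \<odot>\<^bsub>L2 M\<^esub> G"
      using F G square_integrable_add[of M f g] square_integrable_smult[of M f a] square_integrable_smult[of M g a]
      by (simp add: L2_simps ae_map2_class ae_map_class square_integrable_measurable distrib_left)
  next
    fix a b F assume "F \<in> carrier (L2 M)"
    then obtain f where F: "square_integrable M f" "F = ae_class M f" by (metis L2_cases)
    note sm = square_integrable_smult[OF F(1)]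
    show "a \<odot>\<^bsub>L2 M\<^esub> F \<in> carrier (L2 M)"
      "(a \<oplus>\<^bsub>complex_ring\<^esub> b) \<odot>\<^bsub>L2 M\<^esub> F = a \<odot>\<^bsub>L2 M\<^esub> F \<oplus>\<^bsub>L2 M\<^esub> b \<odot>\<^bsub>L2 M\<^esub> F"
      "(a \<otimes>\<^bsub>complex_ring\<^esub> b) \<odot>\<^bsub>L2 M\<^esub> F = a \<odot>\<^bsub>L2 M\<^esub> (b \<odot>\<^bsub>L2 M\<^esub> F)"
      "\<one>\<^bsub>complex_ring\<^esub> \<odot>\<^bsub>L2 M\<^esub> F = F"
      using F sm by (auto simp: L2_simps ae_map2_class ae_map_class square_integrable_measurable distrib_right mult.assoc)
  qed
  show ?thesis
  proof (intro complex_hilbert_space.intro mod complex_hilbert_space_axioms.intro)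
    fix F G K assume "F \<in> carrier (L2 M)" "G \<in> carrier (L2 M)" "K \<in> carrier (L2 M)"
    then obtain f g k where F: "square_integrable M f" "F = ae_class M f"
      and G: "square_integrable M g" "G = ae_class M g" and K: "square_integrable M k" "K = ae_class M k"
      by (metis L2_cases)
    have "(\<integral>x. (f x + g x) * cnj (k x) \<partial>M) = (\<integral>x. f x * cnj (k x) \<partial>M) + (\<integral>x. g x * cnj (k x) \<partial>M)"
      using integrable_ip[OF F(1) K(1)] integrable_ip[OF G(1) K(1)]
      by (simp add: distrib_right)
    thus "ip (L2 M) (F \<oplus>\<^bsub>L2 M\<^esub> G) K = ip (L2 M) F K + ip (L2 M) G K"
      using F G K square_integrable_add[OF F(1) G(1)]
      by (simp add: L2_simps(2) ae_map2_class square_integrable_measurable ip_class)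
  next
    fix c F G assume "F \<in> carrier (L2 M)" "G \<in> carrier (L2 M)"
    then obtain f g where F: "square_integrable M f" "F = ae_class M f"
      and G: "square_integrable M g" "G = ae_class M g" by (metis L2_cases)
    show "ip (L2 M) (c \<odot>\<^bsub>L2 M\<^esub> F) G = c * ip (L2 M) F G"
      using F G square_integrable_smult[OF F(1)]
      by (simp add: L2_simps(3) ae_map_class square_integrable_measurable ip_class mult.assoc)
    have "cnj (\<integral>x. f x * cnj (g x) \<partial>M) = (\<integral>x. cnj (f x * cnj (g x)) \<partial>M)"
      by (rule Bochner_Integration.integral_cnj[symmetric])
    thus "ip (L2 M) G F = cnj (ip (L2 M) F G)"
      using F G by (simp add: ip_class mult.commute)
  next
    fix F assume "F \<in> carrier (L2 M)"
    then obtain f where F: "square_integrable M f" "F = ae_class M f" by (metis L2_cases)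
    have ip: "ip (L2 M) F F = complex_of_real (\<integral>x. (norm (f x))\<^sup>2 \<partial>M)"
    proof -
      have "ip (L2 M) F F = (\<integral>x. complex_of_real ((norm (f x))\<^sup>2) \<partial>M)"
        unfolding F(2) ip_class[OF F(1) F(1)]
        by (intro Bochner_Integration.integral_cong) (simp_all only: complex_norm_square)
      thus ?thesis by (simp only: integral_complex_of_real)
    qed
    thus "0 \<le> Re (ip (L2 M) F F)" by simp
    assume "ip (L2 M) F F = 0"
    hence "(\<integral>x. (norm (f x))\<^sup>2 \<partial>M) = 0" using ip by simp
    moreover have "integrable M (\<lambda>x. (norm (f x))\<^sup>2)" using F by (simp add: square_integrable_def)
    ultimately have "AE x in M. (norm (f x))\<^sup>2 = 0"
      using integral_nonneg_eq_0_iff_AE[of M "\<lambda>x. (norm (f x))\<^sup>2"] by simp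
    hence "AE x in M. f x = 0" by simp
    thus "F = \<zero>\<^bsub>L2 M\<^esub>" unfolding F(2) L2_simps by (rule ae_class_cong)
  next
    fix s :: "nat \<Rightarrow> ('a \<Rightarrow> complex) set"
    assume s: "\<And>k. s k \<in> carrier (L2 M)"
      and c: "\<forall>e>0. \<exists>N. \<forall>i\<ge>N. \<forall>j\<ge>N. hnorm (L2 M) (s i \<ominus>\<^bsub>L2 M\<^esub> s j) < e"
    have "\<forall>k. \<exists>f. square_integrable M f \<and> s k = ae_class M f" using L2_cases[OF s] by blast
    then obtain f where f: "\<And>k. square_integrable M (f k)" "\<And>k. s k = ae_class M (f k)" by metis
    have "\<exists>g. square_integrable M g \<and> (\<lambda>k. \<integral>x. (norm (f k x - g x))\<^sup>2 \<partial>M) \<longlonglongrightarrow> 0"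
    proof (rule L2_complete[OF f(1)])
      fix e :: real assume e: "e > 0"
      hence "sqrt e > 0" by simp
      then obtain N where "\<forall>i\<ge>N. \<forall>j\<ge>N. hnorm (L2 M) (s i \<ominus>\<^bsub>L2 M\<^esub> s j) < sqrt e" using c by blast
      thus "\<exists>N. \<forall>i\<ge>N. \<forall>j\<ge>N. (\<integral>x. (norm (f i x - f j x))\<^sup>2 \<partial>M) < e"
        by (auto simp: f L2_minus_class hnorm_class)
    qed
    then obtain g where g: "square_integrable M g" "(\<lambda>k. \<integral>x. (norm (f k x - g x))\<^sup>2 \<partial>M) \<longlonglongrightarrow> 0" by blast
    have "(\<lambda>k. sqrt (\<integral>x. (norm (f k x - g x))\<^sup>2 \<partial>M)) \<longlonglongrightarrow> sqrt 0"
      by (intro tendsto_real_sqrt g)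
    hence "(\<lambda>k. hnorm (L2 M) (s k \<ominus>\<^bsub>L2 M\<^esub> ae_class M g)) \<longlonglongrightarrow> 0"
      using g(1) by (simp add: f L2_minus_class hnorm_class)
    thus "\<exists>F\<in>carrier (L2 M). (\<lambda>k. hnorm (L2 M) (s k \<ominus>\<^bsub>L2 M\<^esub> F)) \<longlonglongrightarrow> 0" using g(1) by blast
  qed
qed

end

section \<open>The representation by multiplication operators\<close>

context prob_space
begin

sublocale L2: complex_hilbert_space "L2 M" by (rule L2_hilbert)

lemma mult_op_class:
  "ess_bounded M f \<Longrightarrow> square_integrable M g \<Longrightarrow> mult_op M (ae_class M f) (ae_class M g) = ae_class M (\<lambda>x. f x * g x)"
  by (simp add: mult_op_def L2_closed ae_map2_class ess_bounded_measurable square_integrable_measurable)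

lemma mult_op_closed:
  assumes "F \<in> carrier (Linf M)"
  shows "mult_op M F \<in> bounded_op_set (L2 M)"
proof -
  obtain f where f: "ess_bounded M f" "F = ae_class M f" using assms by (rule Linf_cases)
  obtain C where C: "AE x in M. norm (f x) \<le> C" using f by (auto simp: ess_bounded_def)
  show ?thesis
  proof (rule L2.opI)
    show "mult_op M F \<in> carrier (L2 M) \<rightarrow>\<^sub>E carrier (L2 M)"
    proof
      fix G assume "G \<in> carrier (L2 M)"
      then obtain g where g: "square_integrable M g" "G = ae_class M g" by (rule L2_cases)
      show "mult_op M F G \<in> carrier (L2 M)" using f g by (auto simp: mult_op_class square_integrable_mult)
    qed (simp add: mult_op_def)
  next
    fix G K assume "G \<in> carrier (L2 M)" "K \<in> carrier (L2 M)"
    then obtain g k where G: "square_integrable M g" "G = ae_class M g"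
      and K: "square_integrable M k" "K = ae_class M k" by (metis L2_cases)
    show "mult_op M F (G \<oplus>\<^bsub>L2 M\<^esub> K) = mult_op M F G \<oplus>\<^bsub>L2 M\<^esub> mult_op M F K"
      using f G K square_integrable_add[OF G(1) K(1)] square_integrable_mult[OF f(1)]
      by (simp add: L2_simps ae_map2_class mult_op_class square_integrable_measurable distrib_left)
  next
    fix c G assume "G \<in> carrier (L2 M)"
    then obtain g where G: "square_integrable M g" "G = ae_class M g" by (rule L2_cases)
    show "mult_op M F (c \<odot>\<^bsub>L2 M\<^esub> G) = c \<odot>\<^bsub>L2 M\<^esub> mult_op M F G"
      using f G square_integrable_smult[OF G(1)] square_integrable_mult[OF f(1) G(1)]
      by (simp add: L2_simps ae_map_class mult_op_class square_integrable_measurable mult_ac)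
  next
    fix G assume "G \<in> carrier (L2 M)"
    then obtain g where G: "square_integrable M g" "G = ae_class M g" by (rule L2_cases)
    note fg = square_integrable_mult[OF f(1) G(1)]
    have "(\<integral>x. (norm (f x * g x))\<^sup>2 \<partial>M) \<le> (\<integral>x. \<bar>C\<bar>\<^sup>2 * (norm (g x))\<^sup>2 \<partial>M)"
    proof (rule integral_mono_AE)
      show "AE x in M. (norm (f x * g x))\<^sup>2 \<le> \<bar>C\<bar>\<^sup>2 * (norm (g x))\<^sup>2"
        using C by eventually_elim (auto simp: norm_mult power_mult_distrib simp del: power2_abs intro!: mult_right_mono power_mono)
    qed (use fg G in \<open>auto simp: square_integrable_def\<close>)
    hence "sqrt (\<integral>x. (norm (f x * g x))\<^sup>2 \<partial>M) \<le> sqrt (\<bar>C\<bar>\<^sup>2 * (\<integral>x. (norm (g x))\<^sup>2 \<partial>M))"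
      by simp
    thus "hnorm (L2 M) (mult_op M F G) \<le> \<bar>C\<bar> * hnorm (L2 M) G"
      using f G fg by (simp add: mult_op_class hnorm_class real_sqrt_mult)
  qed
qed

lemma mult_op_one: "mult_op M \<one>\<^bsub>Linf M\<^esub> = \<one>\<^bsub>L2.BH\<^esub>"
proof (rule L2.op_eqI)
  show "mult_op M \<one>\<^bsub>Linf M\<^esub> \<in> bounded_op_set (L2 M)" by (rule mult_op_closed) (auto simp: Linf_simps)
  fix G assume G: "G \<in> carrier (L2 M)"
  then obtain g where "square_integrable M g" "G = ae_class M g" by (rule L2_cases)
  thus "mult_op M \<one>\<^bsub>Linf M\<^esub> G = \<one>\<^bsub>L2.BH\<^esub> G" using G by (simp add: Linf_simps mult_op_class)
qed auto

lemma mult_op_star_hom: "star_hom (Linf M) L2.BH (mult_op M)"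
  unfolding star_hom_def alg_hom_def
proof (intro conjI ballI allI)
  interpret Linf: cring "Linf M" by (rule Linf_cring)
  show "mult_op M \<in> carrier (Linf M) \<rightarrow> carrier L2.BH" using mult_op_closed by auto
  fix F K assume FK: "F \<in> carrier (Linf M)" "K \<in> carrier (Linf M)"
  then obtain f k where F: "ess_bounded M f" "F = ae_class M f"
    and K: "ess_bounded M k" "K = ae_class M k" by (metis Linf_cases)
  note m = ess_bounded_measurable square_integrable_measurable
  show "mult_op M (F \<oplus>\<^bsub>Linf M\<^esub> K) = mult_op M F \<oplus>\<^bsub>L2.BH\<^esub> mult_op M K"
  proof (rule L2.op_eqI)
    fix G assume G: "G \<in> carrier (L2 M)"
    then obtain g where "square_integrable M g" "G = ae_class M g" by (rule L2_cases)
    thus "mult_op M (F \<oplus>\<^bsub>Linf M\<^esub> K) G = (mult_op M F \<oplus>\<^bsub>L2.BH\<^esub> mult_op M K) G"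
      using G F K ess_bounded_add[OF F(1) K(1)] square_integrable_mult[of M f g] square_integrable_mult[of M k g]
      by (simp add: mult_op_class Linf_simps(3) L2_simps(2) ae_map2_class m distrib_right)
  qed (use FK in \<open>auto intro!: mult_op_closed\<close>)
  show "mult_op M (F \<otimes>\<^bsub>Linf M\<^esub> K) = mult_op M F \<otimes>\<^bsub>L2.BH\<^esub> mult_op M K"
  proof (rule L2.op_eqI)
    fix G assume G: "G \<in> carrier (L2 M)"
    then obtain g where "square_integrable M g" "G = ae_class M g" by (rule L2_cases)
    thus "mult_op M (F \<otimes>\<^bsub>Linf M\<^esub> K) G = (mult_op M F \<otimes>\<^bsub>L2.BH\<^esub> mult_op M K) G"
      using G F K ess_bounded_mult[OF F(1) K(1)] square_integrable_mult[of M k g]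
      by (simp add: mult_op_class Linf_simps(4) ae_map2_class m mult.assoc)
  qed (use FK in \<open>auto intro!: mult_op_closed\<close>)
next
  fix c F assume FK: "F \<in> carrier (Linf M)"
  then obtain f where F: "ess_bounded M f" "F = ae_class M f" by (metis Linf_cases)
  note m = ess_bounded_measurable square_integrable_measurable
  have cF: "ess_bounded M (\<lambda>x. c * f x)" using F by (intro ess_bounded_mult) auto
  show "mult_op M (c \<odot>\<^bsub>Linf M\<^esub> F) = c \<odot>\<^bsub>L2.BH\<^esub> mult_op M F"
  proof (rule L2.op_eqI)
    fix G assume G: "G \<in> carrier (L2 M)"
    then obtain g where "square_integrable M g" "G = ae_class M g" by (rule L2_cases)
    thus "mult_op M (c \<odot>\<^bsub>Linf M\<^esub> F) G = (c \<odot>\<^bsub>L2.BH\<^esub> mult_op M F) G"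
      using G F cF square_integrable_mult[of M f g]
      by (simp add: mult_op_class Linf_simps(5) L2_simps(3) ae_map_class m mult.assoc)
  qed (use FK F cF in \<open>auto intro!: mult_op_closed simp: Linf_simps ae_map_class m\<close>)
  show "mult_op M (adj (Linf M) F) = adj L2.BH (mult_op M F)"
  proof (rule L2.adj_eqI[symmetric])
    fix G K assume G: "G \<in> carrier (L2 M)" and K: "K \<in> carrier (L2 M)"
    then obtain g k where "square_integrable M g" "G = ae_class M g" "square_integrable M k" "K = ae_class M k"
      by (metis L2_cases)
    thus "ip (L2 M) (mult_op M F G) K = ip (L2 M) G (mult_op M (adj (Linf M) F) K)"
      using F ess_bounded_cnj[OF F(1)] square_integrable_mult[of M f g] square_integrable_mult[OF ess_bounded_cnj[OF F(1)], of k]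
      by (simp add: mult_op_class Linf_simps(6) ae_map_class m ip_class mult_ac)
  qed (use FK F ess_bounded_cnj[OF F(1)] in \<open>auto intro!: mult_op_closed simp: Linf_simps ae_map_class m\<close>)
qed

lemma mult_op_nondegenerate: "nondegenerate (Linf M) (L2 M) (mult_op M)"
proof -
  interpret Linf: cring "Linf M" by (rule Linf_cring)
  let ?X = "{mult_op M F G |F G. F \<in> carrier (Linf M) \<and> G \<in> carrier (L2 M)}"
  have "closed_subspace (L2 M) (carrier (L2 M))"
    unfolding closed_subspace_def by (intro conjI ballI impI) (unfold_locales, auto simp: L2.uminus_eq_smult simp flip: a_inv_def)
  moreover have "?X \<subseteq> carrier (L2 M)" using mult_op_closed by blast
  ultimately have "closed_subspace (L2 M) hull ?X \<subseteq> carrier (L2 M)" by (intro hull_minimal)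
  moreover have "carrier (L2 M) \<subseteq> ?X"
  proof
    fix G assume G: "G \<in> carrier (L2 M)"
    hence "G = mult_op M \<one>\<^bsub>Linf M\<^esub> G" by (simp add: mult_op_one)
    thus "G \<in> ?X" using G Linf.one_closed by blast
  qed
  ultimately show ?thesis unfolding nondegenerate_def using hull_subset[of ?X "closed_subspace (L2 M)"] by blast
qed

lemma L2_rep_mem: "L2_stacey_rep M \<alpha> n S \<Longrightarrow> (L2 M, mult_op M, S) \<in> stacey_reps (Linf M) \<alpha> n"
  using L2_hilbert mult_op_star_hom mult_op_nondegenerate
  by (auto simp: L2_stacey_rep_def cuntz_family_def stacey_reps_def)

abbreviation "unit_vector \<equiv> ae_class M (\<lambda>_. 1)"

lemma unit_vector: "unit_vector \<in> carrier (L2 M)" "hnorm (L2 M) unit_vector = 1"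
  by (auto simp: square_integrable_def hnorm_class prob_space)

text \<open>For \<open>g = T 1\<close> and \<open>h = T\<^sup>* 1\<close>, commutation with all multiplication operators gives \<open>h = cnj g\<close>.\<close>

lemma hnorm_adj_unit_vector:
  assumes T: "T \<in> bounded_op_set (L2 M)"
    and comm: "\<And>F. F \<in> carrier (Linf M) \<Longrightarrow> T \<otimes>\<^bsub>L2.BH\<^esub> mult_op M F = mult_op M F \<otimes>\<^bsub>L2.BH\<^esub> T"
  shows "hnorm (L2 M) (adj L2.BH T unit_vector) = hnorm (L2 M) (T unit_vector)"
proof -
  obtain g where g: "square_integrable M g" "T unit_vector = ae_class M g"
    using L2_cases[of "T unit_vector" M] T unit_vector by blast
  obtain h where h: "square_integrable M h" "adj L2.BH T unit_vector = ae_class M h"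
    using L2_cases[of "adj L2.BH T unit_vector" M] T unit_vector by blast
  have one: "square_integrable M (\<lambda>_. 1)" by (simp add: square_integrable_def)
  define u where "u x = h x - cnj (g x)" for x
  define w where "w x = u x / of_real (norm (u x))" for x
  have [measurable]: "g \<in> borel_measurable M" "h \<in> borel_measurable M" using g h by auto
  have [measurable]: "cnj \<in> borel_measurable borel" by (intro borel_measurable_continuous_onI continuous_intros)
  have [measurable]: "u \<in> borel_measurable M" unfolding u_def by measurable
  have [measurable]: "w \<in> borel_measurable M" unfolding w_def by measurable
  have w1: "norm (w x) \<le> 1" for x by (simp add: w_def norm_divide)
  have w: "ess_bounded M w" unfolding ess_bounded_def using w1 by (auto intro!: exI[of _ 1])
  have ws: "square_integrable M w" using square_integrable_mult[OF w one] by simp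
  have uw: "u x * cnj (w x) = of_real (norm (u x))" for x
    by (simp add: w_def complex_norm_square[symmetric] power2_eq_square)
  let ?W = "ae_class M w"
  have W: "?W \<in> carrier (Linf M)" using w by blast
  have W1: "mult_op M ?W unit_vector = ?W" using w one by (simp add: mult_op_class)
  have "ip (L2 M) (adj L2.BH T unit_vector) ?W = ip (L2 M) unit_vector (T ?W)"
    using T unit_vector ws by (intro L2.adj_ip') auto
  also have "T ?W = mult_op M ?W (T unit_vector)"
    using fun_cong[OF comm[OF W], of unit_vector] unit_vector W1 by simp
  finally have "ip (L2 M) (ae_class M h) ?W = ip (L2 M) unit_vector (mult_op M ?W (ae_class M g))"
    by (simp only: g h)
  hence eq: "(\<integral>x. h x * cnj (w x) \<partial>M) = (\<integral>x. cnj (w x) * cnj (g x) \<partial>M)"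
    using w g(1) h(1) ws one square_integrable_mult[OF w g(1)] by (simp add: mult_op_class ip_class)
  have i1: "integrable M (\<lambda>x. h x * cnj (w x))" by (rule integrable_ip[OF h(1) ws])
  have i2: "integrable M (\<lambda>x. cnj (w x) * cnj (g x))"
    using integrable_ip[OF one square_integrable_mult[OF w g(1)]] by simp
  have huw: "h x * cnj (w x) - cnj (w x) * cnj (g x) = of_real (norm (u x))" for x
  proof -
    have "h x * cnj (w x) - cnj (w x) * cnj (g x) = u x * cnj (w x)" unfolding u_def by (simp add: algebra_simps)
    thus ?thesis by (simp only: uw)
  qed
  have "(\<integral>x. complex_of_real (norm (u x)) \<partial>M) = (\<integral>x. h x * cnj (w x) - cnj (w x) * cnj (g x) \<partial>M)"
    by (simp only: huw)
  also have "\<dots> = 0" using i1 i2 eq by simp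
  finally have z: "(\<integral>x. norm (u x) \<partial>M) = 0" by (simp only: integral_complex_of_real of_real_eq_0_iff)
  have "integrable M (\<lambda>x. norm (h x * cnj (w x) - cnj (w x) * cnj (g x)))"
    by (intro integrable_norm Bochner_Integration.integrable_diff i1 i2)
  hence "integrable M (\<lambda>x. norm (u x))" by (simp add: huw)
  hence "AE x in M. norm (u x) = 0" using z integral_nonneg_eq_0_iff_AE[of M "\<lambda>x. norm (u x)"] by simp
  hence "AE x in M. (norm (h x))\<^sup>2 = (norm (g x))\<^sup>2" by eventually_elim (simp add: u_def)
  hence "(\<integral>x. (norm (h x))\<^sup>2 \<partial>M) = (\<integral>x. (norm (g x))\<^sup>2 \<partial>M)" by (intro integral_cong_AE) auto
  thus ?thesis using g h by (simp add: hnorm_class)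
qed

lemma mult_op_le_imp_AE:
  assumes f: "ess_bounded M f" and e: "e \<ge> 0"
    and le: "\<And>G. G \<in> carrier (L2 M) \<Longrightarrow> hnorm (L2 M) (mult_op M (ae_class M f) G) \<le> e * hnorm (L2 M) G"
  shows "AE x in M. norm (f x) \<le> e"
proof -
  have [measurable]: "f \<in> borel_measurable M" using f by auto
  define g where "g x = (if norm (f x) > e then 1 else 0 :: complex)" for x
  have [measurable]: "g \<in> borel_measurable M" unfolding g_def by measurable
  have "ess_bounded M g" unfolding ess_bounded_def by (auto simp: g_def intro!: exI[of _ 1])
  from square_integrable_mult[OF this, of "\<lambda>_. 1"] have g: "square_integrable M g" 
    by (simp add: square_integrable_def)
  note fg = square_integrable_mult[OF f g]
  have "sqrt (\<integral>x. (norm (f x * g x))\<^sup>2 \<partial>M) \<le> e * sqrt (\<integral>x. (norm (g x))\<^sup>2 \<partial>M)"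
    using le[OF L2_closed[OF g]] f g fg by (simp add: mult_op_class hnorm_class)
  also have "\<dots> = sqrt (e\<^sup>2 * (\<integral>x. (norm (g x))\<^sup>2 \<partial>M))" using e by (simp add: real_sqrt_mult)
  finally have "(\<integral>x. (norm (f x * g x))\<^sup>2 \<partial>M) \<le> e\<^sup>2 * (\<integral>x. (norm (g x))\<^sup>2 \<partial>M)" by simp
  moreover have int: "integrable M (\<lambda>x. (norm (f x * g x))\<^sup>2)" "integrable M (\<lambda>x. (norm (g x))\<^sup>2)"
    using fg g by (auto simp: square_integrable_def)
  ultimately have le0: "(\<integral>x. (norm (f x * g x))\<^sup>2 - e\<^sup>2 * (norm (g x))\<^sup>2 \<partial>M) \<le> 0" by simp
  have ge: "0 \<le> (norm (f x * g x))\<^sup>2 - e\<^sup>2 * (norm (g x))\<^sup>2" for x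
    using e by (auto simp: g_def intro!: power_mono)
  have "(\<integral>x. (norm (f x * g x))\<^sup>2 - e\<^sup>2 * (norm (g x))\<^sup>2 \<partial>M) = 0"
    using le0 ge by (intro antisym integral_nonneg) auto
  hence "AE x in M. (norm (f x * g x))\<^sup>2 - e\<^sup>2 * (norm (g x))\<^sup>2 = 0"
    using integral_nonneg_eq_0_iff_AE[of M "\<lambda>x. (norm (f x * g x))\<^sup>2 - e\<^sup>2 * (norm (g x))\<^sup>2"] int ge by simp
  thus ?thesis
  proof eventually_elim
    case (elim x)
    show ?case
    proof (rule ccontr)
      assume "\<not> norm (f x) \<le> e"
      hence "(norm (f x))\<^sup>2 = e\<^sup>2" "norm (f x) > e" using elim by (auto simp: g_def)
      thus False using e by (simp add: power2_eq_iff_nonneg)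
    qed
  qed
qed

section \<open>Uniqueness of the multiplicity on \<open>L\<^sup>2\<close>\<close>

lemma L2_rep_multiplicity_unique:
  assumes sys: "stacey_system (Linf M) \<alpha>"
    and S: "L2_stacey_rep M \<alpha> n S" and Q: "L2_stacey_rep M \<alpha> m Q"
  shows "n = m"
proof -
  interpret S: stacey_rep "Linf M" \<alpha> "L2 M" "mult_op M" S n
    using stacey_system.stacey_repI[OF sys L2_rep_mem[OF S]] .
  interpret Q: stacey_rep "Linf M" \<alpha> "L2 M" "mult_op M" Q m
    using stacey_system.stacey_repI[OF sys L2_rep_mem[OF Q]] .
  let ?T = "\<lambda>i j. adj L2.BH (S i) \<otimes>\<^bsub>L2.BH\<^esub> Q j"
  have T: "hnorm (L2 M) (adj L2.BH (Q j) (S i unit_vector)) = hnorm (L2 M) (adj L2.BH (S i) (Q j unit_vector))"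
    if ij: "i < n" "j < m" for i j
  proof -
    have "hnorm (L2 M) (adj L2.BH (?T i j) unit_vector) = hnorm (L2 M) (?T i j unit_vector)"
    proof (rule hnorm_adj_unit_vector)
      fix F assume F: "F \<in> carrier (Linf M)"
      show "?T i j \<otimes>\<^bsub>L2.BH\<^esub> mult_op M F = mult_op M F \<otimes>\<^bsub>L2.BH\<^esub> ?T i j"
      proof (rule L2.op_eqI)
        fix G assume G: "G \<in> carrier (L2 M)"
        have "Q j (mult_op M F G) = mult_op M (\<alpha> F) (Q j G)"
          using fun_cong[OF Q.covariance[OF F ij(2)], of G] G by simp
        moreover have "adj L2.BH (S i) (mult_op M (\<alpha> F) (Q j G)) = mult_op M F (adj L2.BH (S i) (Q j G))"
          using fun_cong[OF S.adj_covariance[OF F ij(1)], of "Q j G"] G ij by simp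
        ultimately show "(?T i j \<otimes>\<^bsub>L2.BH\<^esub> mult_op M F) G = (mult_op M F \<otimes>\<^bsub>L2.BH\<^esub> ?T i j) G"
          using G F ij by simp
      qed (use ij F mult_op_closed in auto)
    qed (use ij in auto)
    thus ?thesis using ij unit_vector by (simp add: L2.adj_compose L2.adj_adj)
  qed
  have "(\<Sum>i<n. (hnorm (L2 M) (adj L2.BH (S i) x))\<^sup>2) = (hnorm (L2 M) x)\<^sup>2" if "x \<in> carrier (L2 M)" for x
    using S.sum_ip_adj_Q[OF that that] that by (simp add: L2.ip_self flip: of_real_power of_real_sum)
  moreover have "(\<Sum>j<m. (hnorm (L2 M) (adj L2.BH (Q j) x))\<^sup>2) = (hnorm (L2 M) x)\<^sup>2" if "x \<in> carrier (L2 M)" for x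
    using Q.sum_ip_adj_Q[OF that that] that by (simp add: L2.ip_self flip: of_real_power of_real_sum)
  ultimately have "(\<Sum>j<m. \<Sum>i<n. (hnorm (L2 M) (adj L2.BH (S i) (Q j unit_vector)))\<^sup>2) = m"
    "(\<Sum>i<n. \<Sum>j<m. (hnorm (L2 M) (adj L2.BH (Q j) (S i unit_vector)))\<^sup>2) = n"
    using unit_vector by (auto simp: S.hnorm_Q Q.hnorm_Q)
  moreover have "(\<Sum>i<n. \<Sum>j<m. (hnorm (L2 M) (adj L2.BH (Q j) (S i unit_vector)))\<^sup>2)
      = (\<Sum>i<n. \<Sum>j<m. (hnorm (L2 M) (adj L2.BH (S i) (Q j unit_vector)))\<^sup>2)"
    by (intro sum.cong refl) (simp add: T)
  ultimately show "n = m" by (subst (asm) sum.swap) simp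
qed

end

section \<open>Generated subalgebras\<close>

lemma closed_subalgebraD:
  assumes "closed_subalgebra B V"
  shows "V \<subseteq> carrier B" "\<zero>\<^bsub>B\<^esub> \<in> V"
    and "\<And>x y. x \<in> V \<Longrightarrow> y \<in> V \<Longrightarrow> x \<oplus>\<^bsub>B\<^esub> y \<in> V"
    and "\<And>c x. x \<in> V \<Longrightarrow> c \<odot>\<^bsub>B\<^esub> x \<in> V"
    and "\<And>x y. x \<in> V \<Longrightarrow> y \<in> V \<Longrightarrow> x \<otimes>\<^bsub>B\<^esub> y \<in> V"
    and "\<And>x. x \<in> carrier B \<Longrightarrow> (\<And>e. e > 0 \<Longrightarrow> \<exists>v\<in>V. nrm B (x \<ominus>\<^bsub>B\<^esub> v) < e) \<Longrightarrow> x \<in> V"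
proof -
  have sm: "submodule V complex_ring B" using assms by (simp add: closed_subalgebra_def)
  have sg: "subgroup V (add_monoid B)" using sm by (rule submodule.axioms)
  show "V \<subseteq> carrier B" "\<zero>\<^bsub>B\<^esub> \<in> V" "\<And>x y. x \<in> V \<Longrightarrow> y \<in> V \<Longrightarrow> x \<oplus>\<^bsub>B\<^esub> y \<in> V"
    using subgroup.subset[OF sg] subgroup.one_closed[OF sg] subgroup.m_closed[OF sg] by auto
  show "\<And>c x. x \<in> V \<Longrightarrow> c \<odot>\<^bsub>B\<^esub> x \<in> V"
    using submodule.smult_closed[OF sm] by simp
qed (use assms in \<open>simp_all add: closed_subalgebra_def\<close>)

lemma closed_subalgebra_hull_closed:
  defines "D \<equiv> \<lambda>B G. closed_subalgebra B hull G"
  shows "x \<in> D B G \<Longrightarrow> y \<in> D B G \<Longrightarrow> x \<oplus>\<^bsub>B\<^esub> y \<in> D B G"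
    "x \<in> D B G \<Longrightarrow> y \<in> D B G \<Longrightarrow> x \<otimes>\<^bsub>B\<^esub> y \<in> D B G"
    "x \<in> D B G \<Longrightarrow> c \<odot>\<^bsub>B\<^esub> x \<in> D B G" "\<zero>\<^bsub>B\<^esub> \<in> D B G"
    "x \<in> carrier B \<Longrightarrow> (\<And>e. e > 0 \<Longrightarrow> \<exists>v\<in>D B G. nrm B (x \<ominus>\<^bsub>B\<^esub> v) < e) \<Longrightarrow> x \<in> D B G"
proof -
  show "x \<in> carrier B \<Longrightarrow> (\<And>e. e > 0 \<Longrightarrow> \<exists>v\<in>D B G. nrm B (x \<ominus>\<^bsub>B\<^esub> v) < e) \<Longrightarrow> x \<in> D B G"
    unfolding D_def hull_def
  proof (rule InterI, clarify)
    fix V assume x: "x \<in> carrier B" and V: "closed_subalgebra B V" "G \<subseteq> V"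
      and appr: "\<And>e. e > 0 \<Longrightarrow> \<exists>v\<in>\<Inter>{t. closed_subalgebra B t \<and> G \<subseteq> t}. nrm B (x \<ominus>\<^bsub>B\<^esub> v) < e"
    show "x \<in> V" by (rule closed_subalgebraD(6)[OF V(1) x]) (use appr V in blast)
  qed
qed (auto simp: D_def hull_def dest: closed_subalgebraD)

lemma closed_star_subalgebra_hull_closed:
  defines "D \<equiv> \<lambda>B G. closed_star_subalgebra B hull G"
  shows "x \<in> D B G \<Longrightarrow> y \<in> D B G \<Longrightarrow> x \<oplus>\<^bsub>B\<^esub> y \<in> D B G"
    "x \<in> D B G \<Longrightarrow> y \<in> D B G \<Longrightarrow> x \<otimes>\<^bsub>B\<^esub> y \<in> D B G"
    "x \<in> D B G \<Longrightarrow> adj B x \<in> D B G" "\<zero>\<^bsub>B\<^esub> \<in> D B G"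
  by (auto simp: D_def hull_def closed_star_subalgebra_def dest: closed_subalgebraD)

lemma crossed_product_simps [simp]:
  "carrier (stacey_crossed_product A \<alpha> n) = closed_star_subalgebra (stacey_ambient A \<alpha> n) hull stacey_gens A \<alpha> n"
  "x \<otimes>\<^bsub>stacey_crossed_product A \<alpha> n\<^esub> y = x \<otimes>\<^bsub>stacey_ambient A \<alpha> n\<^esub> y"
  "x \<oplus>\<^bsub>stacey_crossed_product A \<alpha> n\<^esub> y = x \<oplus>\<^bsub>stacey_ambient A \<alpha> n\<^esub> y"
  "c \<odot>\<^bsub>stacey_crossed_product A \<alpha> n\<^esub> y = c \<odot>\<^bsub>stacey_ambient A \<alpha> n\<^esub> y"
  "adj (stacey_crossed_product A \<alpha> n) x = adj (stacey_ambient A \<alpha> n) x"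
  by (simp_all add: stacey_crossed_product_def)

lemma semicrossed_product_simps [simp]:
  "carrier (semicrossed_product A \<alpha> n) = closed_subalgebra (stacey_ambient A \<alpha> n) hull stacey_gens A \<alpha> n"
  "x \<otimes>\<^bsub>semicrossed_product A \<alpha> n\<^esub> y = x \<otimes>\<^bsub>stacey_ambient A \<alpha> n\<^esub> y"
  "x \<oplus>\<^bsub>semicrossed_product A \<alpha> n\<^esub> y = x \<oplus>\<^bsub>stacey_ambient A \<alpha> n\<^esub> y"
  "c \<odot>\<^bsub>semicrossed_product A \<alpha> n\<^esub> y = c \<odot>\<^bsub>stacey_ambient A \<alpha> n\<^esub> y"
  by (simp_all add: semicrossed_product_def)

lemma stacey_incl_gens: "a \<in> carrier A \<Longrightarrow> stacey_incl A \<alpha> n a \<in> stacey_gens A \<alpha> n"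
  and stacey_isom_gens: "i < n \<Longrightarrow> stacey_isom A \<alpha> n i \<in> stacey_gens A \<alpha> n"
  by (auto simp: stacey_gens_def)

section \<open>Isomorphic crossed products\<close>

context stacey_universal
begin

lemma \<iota>_\<alpha>_apply:
  assumes a: "a \<in> carrier A" and r: "(H, \<pi>, Q) \<in> stacey_reps A \<alpha> n" and k: "k \<le> n"
  shows "finsum U (\<lambda>i. t i \<otimes>\<^bsub>U\<^esub> \<iota> a \<otimes>\<^bsub>U\<^esub> adj U (t i)) {..<k} \<in> carrier U \<and>
     finsum U (\<lambda>i. t i \<otimes>\<^bsub>U\<^esub> \<iota> a \<otimes>\<^bsub>U\<^esub> adj U (t i)) {..<k} (H, \<pi>, Q)
      = finsum (bounded_ops H) (\<lambda>i. Q i \<otimes>\<^bsub>bounded_ops H\<^esub> \<pi> a \<otimes>\<^bsub>bounded_ops H\<^esub> adj (bounded_ops H) (Q i)) {..<k}"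
  using k
proof (induction k)
  case 0
  interpret stacey_rep A \<alpha> H \<pi> Q n by (rule stacey_repI[OF r])
  interpret B: normed_algebra Hil.BH by (rule Hil.normed_algebra_BH)
  show ?case by (simp add: U_apply[OF r])
next
  case (Suc k)
  interpret stacey_rep A \<alpha> H \<pi> Q n by (rule stacey_repI[OF r])
  interpret B: normed_algebra Hil.BH by (rule Hil.normed_algebra_BH)
  have "finsum U (\<lambda>i. t i \<otimes>\<^bsub>U\<^esub> \<iota> a \<otimes>\<^bsub>U\<^esub> adj U (t i)) {..<Suc k} =
      t k \<otimes>\<^bsub>U\<^esub> \<iota> a \<otimes>\<^bsub>U\<^esub> adj U (t k) \<oplus>\<^bsub>U\<^esub> finsum U (\<lambda>i. t i \<otimes>\<^bsub>U\<^esub> \<iota> a \<otimes>\<^bsub>U\<^esub> adj U (t i)) {..<k}"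
    using Suc.prems a by (intro U.finsum_lessThan_Suc) (auto intro!: adj_U_closed)
  moreover have "finsum Hil.BH (\<lambda>i. Q i \<otimes>\<^bsub>Hil.BH\<^esub> \<pi> a \<otimes>\<^bsub>Hil.BH\<^esub> adj Hil.BH (Q i)) {..<Suc k} =
      Q k \<otimes>\<^bsub>Hil.BH\<^esub> \<pi> a \<otimes>\<^bsub>Hil.BH\<^esub> adj Hil.BH (Q k) \<oplus>\<^bsub>Hil.BH\<^esub> finsum Hil.BH (\<lambda>i. Q i \<otimes>\<^bsub>Hil.BH\<^esub> \<pi> a \<otimes>\<^bsub>Hil.BH\<^esub> adj Hil.BH (Q i)) {..<k}"
    using Suc.prems a by (intro B.finsum_lessThan_Suc) auto
  ultimately show ?case using Suc a by (simp add: U_apply[OF r] adj_U_closed)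
qed

lemma \<iota>_\<alpha>: 
  assumes a: "a \<in> carrier A"
  shows "\<iota> (\<alpha> a) = finsum U (\<lambda>i. t i \<otimes>\<^bsub>U\<^esub> \<iota> a \<otimes>\<^bsub>U\<^esub> adj U (t i)) {..<n}"
proof (rule U_eqI)
  obtain H0 \<pi>0 Q0 where "(H0, \<pi>0, Q0) \<in> stacey_reps A \<alpha> n"
    using reps_nonempty by (metis ex_in_conv prod_cases3)
  thus "finsum U (\<lambda>i. t i \<otimes>\<^bsub>U\<^esub> \<iota> a \<otimes>\<^bsub>U\<^esub> adj U (t i)) {..<n} \<in> carrier U" using \<iota>_\<alpha>_apply[OF a] by blast
  fix H \<pi> Q assume "stacey_rep A \<alpha> H \<pi> Q n"
  then interpret stacey_rep A \<alpha> H \<pi> Q n .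
  show "\<iota> (\<alpha> a) (H, \<pi>, Q) = finsum U (\<lambda>i. t i \<otimes>\<^bsub>U\<^esub> \<iota> a \<otimes>\<^bsub>U\<^esub> adj U (t i)) {..<n} (H, \<pi>, Q)"
    using \<iota>_\<alpha>_apply[OF a rep order.refl] by (simp add: U_apply[OF rep] \<pi>_\<alpha> a)
qed (use a \<alpha>_closed in auto)

lemma t_orth: "i < n \<Longrightarrow> j < n \<Longrightarrow> adj U (t i) \<otimes>\<^bsub>U\<^esub> t j = (if i = j then \<one>\<^bsub>U\<^esub> else \<zero>\<^bsub>U\<^esub>)"
  by (rule U_eqI) (auto simp: U_apply stacey_rep.rep stacey_rep.Q_orth adj_U_closed)

end

context prob_space
begin

lemma star_iso_imp_L2_rep:
  assumes sys: "stacey_system (Linf M) \<alpha>" and S: "L2_stacey_rep M \<alpha> n S"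
    and ne: "stacey_reps (Linf M) \<alpha> m \<noteq> {}"
    and iso: "star_iso (stacey_crossed_product (Linf M) \<alpha> n) (stacey_crossed_product (Linf M) \<alpha> m) \<Phi>"
    and fixes_A: "\<And>F. F \<in> carrier (Linf M) \<Longrightarrow> \<Phi> (stacey_incl (Linf M) \<alpha> n F) = stacey_incl (Linf M) \<alpha> m F"
  shows "\<exists>Q. L2_stacey_rep M \<alpha> m Q"
proof -
  have r0: "(L2 M, mult_op M, S) \<in> stacey_reps (Linf M) \<alpha> n" using S by (rule L2_rep_mem)
  interpret stacey_system "Linf M" \<alpha> by (rule sys)
  interpret N: stacey_universal "Linf M" \<alpha> n using r0 by unfold_locales auto
  interpret K: stacey_universal "Linf M" \<alpha> m using ne by unfold_locales auto
  interpret B: normed_algebra L2.BH by (rule L2.normed_algebra_BH)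
  let ?C = "stacey_crossed_product (Linf M) \<alpha> n" and ?D = "stacey_crossed_product (Linf M) \<alpha> m"
  note hull = closed_star_subalgebra_hull_closed
  have CN: "carrier ?C \<subseteq> carrier N.U" by (rule N.carrier_crossed_product)
  have gen: "N.\<iota> F \<in> carrier ?C" "K.\<iota> F \<in> carrier ?D" if "F \<in> carrier (Linf M)" for F
    using that by (auto intro: hull_inc stacey_incl_gens)
  have tD: "K.t i \<in> carrier ?D" if "i < m" for i
    using that by (auto intro: hull_inc stacey_isom_gens)
  define \<Psi> where "\<Psi> = inv_into (carrier ?C) \<Phi>"
  have bij: "bij_betw \<Phi> (carrier ?C) (carrier ?D)" using iso by (simp add: star_iso_def)
  have img: "\<Phi> ` carrier ?C = carrier ?D" and inj: "inj_on \<Phi> (carrier ?C)"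
    using bij by (simp_all only: bij_betw_def)
  have \<Psi>_cl: "\<Psi> y \<in> carrier ?C" if "y \<in> carrier ?D" for y
    unfolding \<Psi>_def using inv_into_into[of y \<Phi> "carrier ?C", unfolded img, OF that] .
  have \<Phi>\<Psi>: "\<Phi> (\<Psi> y) = y" if "y \<in> carrier ?D" for y
    unfolding \<Psi>_def using f_inv_into_f[of y \<Phi> "carrier ?C", unfolded img, OF that] .
  have \<Psi>I: "\<Psi> y = x" if "x \<in> carrier ?C" "\<Phi> x = y" for x y
    unfolding \<Psi>_def using inv_into_f_f[OF inj that(1)] that(2) by simp
  have \<Phi>: "\<Phi> (x \<oplus>\<^bsub>N.U\<^esub> y) = \<Phi> x \<oplus>\<^bsub>K.U\<^esub> \<Phi> y" "\<Phi> (x \<otimes>\<^bsub>N.U\<^esub> y) = \<Phi> x \<otimes>\<^bsub>K.U\<^esub> \<Phi> y" 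
    "\<Phi> (adj N.U x) = adj K.U (\<Phi> x)"
    if "x \<in> carrier ?C" "y \<in> carrier ?C" for x y
    using iso that by (auto simp: star_iso_def star_hom_def alg_hom_def)
  have \<Psi>_add: "\<Psi> (x \<oplus>\<^bsub>K.U\<^esub> y) = \<Psi> x \<oplus>\<^bsub>N.U\<^esub> \<Psi> y" and \<Psi>_mult: "\<Psi> (x \<otimes>\<^bsub>K.U\<^esub> y) = \<Psi> x \<otimes>\<^bsub>N.U\<^esub> \<Psi> y"
    and \<Psi>_adj: "\<Psi> (adj K.U x) = adj N.U (\<Psi> x)"
    if "x \<in> carrier ?D" "y \<in> carrier ?D" for x y
    using that \<Psi>_cl[OF that(1)] \<Psi>_cl[OF that(2)] \<Phi>[OF \<Psi>_cl[OF that(1)] \<Psi>_cl[OF that(2)]] hull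
    by (auto intro!: \<Psi>I simp: \<Phi>\<Psi>)
  have \<Psi>_\<iota>: "\<Psi> (K.\<iota> F) = N.\<iota> F" if "F \<in> carrier (Linf M)" for F
    using that gen fixes_A by (intro \<Psi>I) auto
  have \<Psi>_one: "\<Psi> \<one>\<^bsub>K.U\<^esub> = \<one>\<^bsub>N.U\<^esub>"
    using \<Psi>_\<iota>[OF one_closed] by (simp only: K.\<iota>_one N.\<iota>_one)
  have \<Psi>_zero: "\<Psi> \<zero>\<^bsub>K.U\<^esub> = \<zero>\<^bsub>N.U\<^esub>"
    using \<Psi>_\<iota>[OF scalar_closed, of 0] by (simp only: K.\<iota>_scalar N.\<iota>_scalar K.U.smult_0[OF K.U.one_closed] N.U.smult_0[OF N.U.one_closed])
  define Q where "Q j = \<Psi> (K.t j) (L2 M, mult_op M, S)" for j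
  have Qc: "Q j \<in> bounded_op_set (L2 M)" if "j < m" for j
    using N.U_coord[OF _ r0] CN \<Psi>_cl[OF tD[OF that]] unfolding Q_def by blast
  have adjD: "adj K.U x \<in> carrier ?D" if "x \<in> carrier ?D" for x using that hull by auto
  have multD: "x \<otimes>\<^bsub>K.U\<^esub> y \<in> carrier ?D" if "x \<in> carrier ?D" "y \<in> carrier ?D" for x y using that hull by auto
  have addD: "x \<oplus>\<^bsub>K.U\<^esub> y \<in> carrier ?D" if "x \<in> carrier ?D" "y \<in> carrier ?D" for x y using that hull by auto
  have TC: "toeplitz_cuntz_family L2.BH m Q"
    unfolding toeplitz_cuntz_family_def
  proof (intro conjI allI impI)
    fix i j assume ij: "i < m" "j < m"
    have "adj L2.BH (Q i) \<otimes>\<^bsub>L2.BH\<^esub> Q j = (adj N.U (\<Psi> (K.t i)) \<otimes>\<^bsub>N.U\<^esub> \<Psi> (K.t j)) (L2 M, mult_op M, S)"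
      by (simp only: Q_def N.U_apply[OF r0])
    also have "adj N.U (\<Psi> (K.t i)) \<otimes>\<^bsub>N.U\<^esub> \<Psi> (K.t j) = \<Psi> (adj K.U (K.t i) \<otimes>\<^bsub>K.U\<^esub> K.t j)"
      using tD[OF ij(1)] tD[OF ij(2)] adjD by (simp only: \<Psi>_mult \<Psi>_adj)
    also have "\<dots> = (if i = j then \<one>\<^bsub>N.U\<^esub> else \<zero>\<^bsub>N.U\<^esub>)" using ij by (simp add: K.t_orth \<Psi>_one \<Psi>_zero)
    finally show "adj L2.BH (Q i) \<otimes>\<^bsub>L2.BH\<^esub> Q j = (if i = j then \<one>\<^bsub>L2.BH\<^esub> else \<zero>\<^bsub>L2.BH\<^esub>)"
      by (simp add: N.U_apply[OF r0] split: if_splits)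
  qed (use Qc in auto)
  have impl: "mult_op M (\<alpha> F) = finsum L2.BH (\<lambda>i. Q i \<otimes>\<^bsub>L2.BH\<^esub> mult_op M F \<otimes>\<^bsub>L2.BH\<^esub> adj L2.BH (Q i)) {..<m}"
    if F: "F \<in> carrier (Linf M)" for F
  proof -
    let ?r = "(L2 M, mult_op M, S)" and ?g = "\<lambda>i. Q i \<otimes>\<^bsub>L2.BH\<^esub> mult_op M F \<otimes>\<^bsub>L2.BH\<^esub> adj L2.BH (Q i)"
    let ?f = "\<lambda>i. K.t i \<otimes>\<^bsub>K.U\<^esub> K.\<iota> F \<otimes>\<^bsub>K.U\<^esub> adj K.U (K.t i)"
    have f: "?f i \<in> carrier ?D" if "i < m" for i using tD[OF that] gen(2)[OF F] multD adjD by blast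
    have "finsum K.U ?f {..<k} \<in> carrier ?D \<and> \<Psi> (finsum K.U ?f {..<k}) ?r
        = finsum L2.BH ?g {..<k}" if "k \<le> m" for k
      using that
    proof (induction k)
      case 0
      have "\<zero>\<^bsub>K.U\<^esub> \<in> carrier ?D" using hull by simp
      thus ?case by (simp add: \<Psi>_zero N.U_apply[OF r0])
    next
      case (Suc k)
      hence k: "k < m" by simp
      have e1: "finsum K.U ?f {..<Suc k} = ?f k \<oplus>\<^bsub>K.U\<^esub> finsum K.U ?f {..<k}"
        using Suc.prems F by (intro K.U.finsum_lessThan_Suc) (auto intro!: K.adj_U_closed)
      have e2: "finsum L2.BH ?g {..<Suc k} =
         ?g k \<oplus>\<^bsub>L2.BH\<^esub>
         finsum L2.BH ?g {..<k}"
        using Suc.prems F Qc mult_op_closed by (intro B.finsum_lessThan_Suc) auto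
      have IH: "finsum K.U ?f {..<k} \<in> carrier ?D" "\<Psi> (finsum K.U ?f {..<k}) ?r
        = finsum L2.BH ?g {..<k}" using Suc by auto
      have "\<Psi> (?f k \<oplus>\<^bsub>K.U\<^esub> finsum K.U ?f {..<k}) = \<Psi> (K.t k) \<otimes>\<^bsub>N.U\<^esub> N.\<iota> F \<otimes>\<^bsub>N.U\<^esub> adj N.U (\<Psi> (K.t k)) \<oplus>\<^bsub>N.U\<^esub> \<Psi> (finsum K.U ?f {..<k})"
        using f[OF k] IH(1) tD[OF k] gen(2)[OF F] multD adjD F by (simp only: \<Psi>_add \<Psi>_mult \<Psi>_adj \<Psi>_\<iota>)
      hence "\<Psi> (?f k \<oplus>\<^bsub>K.U\<^esub> finsum K.U ?f {..<k}) ?r = 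
         ?g k \<oplus>\<^bsub>L2.BH\<^esub> \<Psi> (finsum K.U ?f {..<k}) ?r"
        by (simp only: N.U_apply[OF r0] Q_def)
      thus ?case unfolding e1 e2 using addD[OF f[OF k] IH(1)] IH(2) by (simp only: simp_thms)
    qed
    from this[OF order.refl] have "\<Psi> (K.\<iota> (\<alpha> F)) ?r
        = finsum L2.BH ?g {..<m}"
      by (simp only: K.\<iota>_\<alpha>[OF F])
    thus ?thesis by (simp only: \<Psi>_\<iota>[OF \<alpha>_closed[OF F]] N.U_apply[OF r0])
  qed
  have "finsum L2.BH (\<lambda>i. Q i \<otimes>\<^bsub>L2.BH\<^esub> adj L2.BH (Q i)) {..<m} =
      finsum L2.BH (\<lambda>i. Q i \<otimes>\<^bsub>L2.BH\<^esub> mult_op M \<one>\<^bsub>Linf M\<^esub> \<otimes>\<^bsub>L2.BH\<^esub> adj L2.BH (Q i)) {..<m}"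
    using Qc by (intro B.finsum_cong') (auto simp: mult_op_one)
  also have "\<dots> = \<one>\<^bsub>L2.BH\<^esub>" using impl[OF one_closed] by (simp add: \<alpha>_one mult_op_one)
  finally have "cuntz_family L2.BH m Q" using TC by (simp add: cuntz_family_def)
  thus ?thesis using impl unfolding L2_stacey_rep_def implements_def by blast
qed

end

section \<open>Linear parts of noncommutative polynomials\<close>

text \<open>A list of pairs \<open>(a, [i\<^sub>1, \<dots>, i\<^sub>k])\<close> stands for the sum of the words \<open>a t\<^bsub>i\<^sub>1\<^esub> \<cdots> t\<^bsub>i\<^sub>k\<^esub>\<close>; by covariance
  every element of the algebra generated by \<open>A\<close> and the \<open>t\<^sub>i\<close> has this form.\<close>

type_synonym 'c wpoly = "('c \<times> nat list) list"

context stacey_system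
begin

definition wpolys :: "nat \<Rightarrow> 'c wpoly set" where
  "wpolys n = lists (carrier A \<times> lists {..<n})"

fun coef :: "nat list \<Rightarrow> 'c wpoly \<Rightarrow> 'c" where
  "coef u [] = \<zero>"
| "coef u ((a, w) # L) = (if w = u then a \<oplus> coef u L else coef u L)"

definition monom_mult :: "'c \<Rightarrow> nat list \<Rightarrow> 'c wpoly \<Rightarrow> 'c wpoly" where
  "monom_mult a w L = map (\<lambda>(b, v). (a \<otimes> (\<alpha> ^^ length w) b, w @ v)) L"

fun poly_mult :: "'c wpoly \<Rightarrow> 'c wpoly \<Rightarrow> 'c wpoly" where
  "poly_mult [] K = []"
| "poly_mult ((a, w) # L) K = monom_mult a w K @ poly_mult L K"

lemma \<alpha>_zero: "\<alpha> \<zero> = \<zero>"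
  using \<alpha>_add[of \<zero> \<zero>] \<alpha>_closed[of \<zero>] by (metis add.l_cancel_one' l_zero zero_closed)

lemma funpow_\<alpha>_closed: "a \<in> carrier A \<Longrightarrow> (\<alpha> ^^ k) a \<in> carrier A"
  by (induction k) (auto simp: \<alpha>_closed)

lemma wpolys_simps [simp]: "[] \<in> wpolys n"
  "(a, w) # L \<in> wpolys n \<longleftrightarrow> a \<in> carrier A \<and> set w \<subseteq> {..<n} \<and> L \<in> wpolys n"
  "L @ K \<in> wpolys n \<longleftrightarrow> L \<in> wpolys n \<and> K \<in> wpolys n"
  by (auto simp: wpolys_def)

lemma coef_closed [simp, intro]: "L \<in> wpolys n \<Longrightarrow> coef u L \<in> carrier A"
  by (induction L) auto

lemma monom_mult_closed:
  "a \<in> carrier A \<Longrightarrow> set w \<subseteq> {..<n} \<Longrightarrow> L \<in> wpolys n \<Longrightarrow> monom_mult a w L \<in> wpolys n"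
  by (induction L) (auto simp: monom_mult_def funpow_\<alpha>_closed)

lemma poly_mult_closed: "L \<in> wpolys n \<Longrightarrow> K \<in> wpolys n \<Longrightarrow> poly_mult L K \<in> wpolys n"
  by (induction L K rule: poly_mult.induct) (auto simp: monom_mult_closed)

lemma coef_append: "L \<in> wpolys n \<Longrightarrow> K \<in> wpolys n \<Longrightarrow> coef u (L @ K) = coef u L \<oplus> coef u K"
  by (induction L) (auto simp: a_assoc coef_closed[of _ n])

lemma coef_single_monom_mult:
  assumes a: "a \<in> carrier A" and "L \<in> wpolys n"
  shows "coef [l] (monom_mult a w L) =
    (if w = [] then a \<otimes> coef [l] L else if w = [l] then a \<otimes> \<alpha> (coef [] L) else \<zero>)"
  using assms(2)
proof (induction L)
  case (Cons p L)
  obtain b v where p: "p = (b, v)" by (cases p)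
  have b: "b \<in> carrier A" "L \<in> wpolys n" using Cons.prems p by auto
  have "w @ v = [l] \<longleftrightarrow> (w = [] \<and> v = [l]) \<or> (w = [l] \<and> v = [])" by (auto simp: append_eq_Cons_conv)
  thus ?case using Cons b a
    by (auto simp: p monom_mult_def r_distr \<alpha>_add \<alpha>_closed coef_closed[of _ n])
qed (auto simp: monom_mult_def a \<alpha>_zero)

lemma coef_single_poly_mult:
  "L \<in> wpolys n \<Longrightarrow> K \<in> wpolys n \<Longrightarrow>
    coef [l] (poly_mult L K) = coef [] L \<otimes> coef [l] K \<oplus> coef [l] L \<otimes> \<alpha> (coef [] K)"
proof (induction L K rule: poly_mult.induct)
  case (2 a w L K)
  have cl: "a \<in> carrier A" "coef [] L \<in> carrier A" "coef [l] L \<in> carrier A" "coef [l] K \<in> carrier A" "\<alpha> (coef [] K) \<in> carrier A"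
    using 2(2,3) \<alpha>_closed by (auto simp: coef_closed[of _ n])
  have "coef [l] (poly_mult ((a, w) # L) K) = coef [l] (monom_mult a w K) \<oplus> coef [l] (poly_mult L K)"
    using 2(2,3) by (simp add: coef_append[of _ n] monom_mult_closed poly_mult_closed)
  also have "\<dots> = coef [] ((a, w) # L) \<otimes> coef [l] K \<oplus> coef [l] ((a, w) # L) \<otimes> \<alpha> (coef [] K)"
    using 2 cl by (auto simp: coef_single_monom_mult[of _ _ n] l_distr a_ac)
  finally show ?case .
qed (auto simp: coef_closed[of _ n] \<alpha>_closed)

end

context stacey_universal
begin

fun word :: "nat list \<Rightarrow> 'c rep \<Rightarrow> 'c \<Rightarrow> 'c" where
  "word [] = \<one>\<^bsub>U\<^esub>"
| "word (i # w) = t i \<otimes>\<^bsub>U\<^esub> word w"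

fun ev :: "'c wpoly \<Rightarrow> 'c rep \<Rightarrow> 'c \<Rightarrow> 'c" where
  "ev [] = \<zero>\<^bsub>U\<^esub>"
| "ev ((a, w) # L) = \<iota> a \<otimes>\<^bsub>U\<^esub> word w \<oplus>\<^bsub>U\<^esub> ev L"

lemma word_closed [simp, intro]: "set w \<subseteq> {..<n} \<Longrightarrow> word w \<in> carrier U"
  by (induction w) auto

lemma ev_closed [simp, intro]: "L \<in> wpolys n \<Longrightarrow> ev L \<in> carrier U"
  by (induction L rule: ev.induct) auto

lemma word_append: "set v \<subseteq> {..<n} \<Longrightarrow> set w \<subseteq> {..<n} \<Longrightarrow> word (v @ w) = word v \<otimes>\<^bsub>U\<^esub> word w"
  by (induction v) (auto simp: U.m_assoc)

lemma word_\<iota>: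
  assumes "set w \<subseteq> {..<n}" "a \<in> carrier A"
  shows "word w \<otimes>\<^bsub>U\<^esub> \<iota> a = \<iota> ((\<alpha> ^^ length w) a) \<otimes>\<^bsub>U\<^esub> word w"
  using assms(1)
proof (induction w)
  case (Cons i w)
  let ?b = "(\<alpha> ^^ length w) a"
  have cl: "i < n" "set w \<subseteq> {..<n}" "?b \<in> carrier A" "\<alpha> ?b \<in> carrier A"
    using Cons.prems assms(2) funpow_\<alpha>_closed \<alpha>_closed by auto
  have "word (i # w) \<otimes>\<^bsub>U\<^esub> \<iota> a = t i \<otimes>\<^bsub>U\<^esub> (word w \<otimes>\<^bsub>U\<^esub> \<iota> a)" using cl assms(2) by (simp add: U.m_assoc)
  also have "\<dots> = (t i \<otimes>\<^bsub>U\<^esub> \<iota> ?b) \<otimes>\<^bsub>U\<^esub> word w" using cl Cons.IH by (simp add: U.m_assoc)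
  also have "\<dots> = \<iota> (\<alpha> ?b) \<otimes>\<^bsub>U\<^esub> word (i # w)" using cl by (simp add: t_\<iota> U.m_assoc)
  finally show ?case by simp
qed (use assms(2) in auto)

lemma ev_append: "L \<in> wpolys n \<Longrightarrow> K \<in> wpolys n \<Longrightarrow> ev (L @ K) = ev L \<oplus>\<^bsub>U\<^esub> ev K"
  by (induction L rule: ev.induct) (auto simp: U.a_assoc)

lemma ev_monom_mult:
  assumes "a \<in> carrier A" "set w \<subseteq> {..<n}" "L \<in> wpolys n"
  shows "ev (monom_mult a w L) = \<iota> a \<otimes>\<^bsub>U\<^esub> word w \<otimes>\<^bsub>U\<^esub> ev L"
  using assms(3)
proof (induction L rule: ev.induct)
  case 1
  show ?case using assms by (simp add: monom_mult_def)
next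
  case (2 b v L)
  let ?b = "(\<alpha> ^^ length w) b"
  have cl: "b \<in> carrier A" "?b \<in> carrier A" "set v \<subseteq> {..<n}" "L \<in> wpolys n" using 2 funpow_\<alpha>_closed by auto
  have "\<iota> (a \<otimes> ?b) \<otimes>\<^bsub>U\<^esub> word (w @ v) = \<iota> a \<otimes>\<^bsub>U\<^esub> (\<iota> ?b \<otimes>\<^bsub>U\<^esub> word w) \<otimes>\<^bsub>U\<^esub> word v"
    using cl assms by (simp add: \<iota>_mult word_append U.m_assoc)
  also have "\<dots> = \<iota> a \<otimes>\<^bsub>U\<^esub> (word w \<otimes>\<^bsub>U\<^esub> \<iota> b) \<otimes>\<^bsub>U\<^esub> word v"
    using cl assms by (simp add: word_\<iota>)
  also have "\<dots> = \<iota> a \<otimes>\<^bsub>U\<^esub> word w \<otimes>\<^bsub>U\<^esub> (\<iota> b \<otimes>\<^bsub>U\<^esub> word v)"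
    using cl assms by (simp add: U.m_assoc)
  finally show ?case using 2 cl assms
    by (simp add: monom_mult_def U.r_distr)
qed

lemma ev_poly_mult: "L \<in> wpolys n \<Longrightarrow> K \<in> wpolys n \<Longrightarrow> ev (poly_mult L K) = ev L \<otimes>\<^bsub>U\<^esub> ev K"
  by (induction L K rule: poly_mult.induct)
     (auto simp: ev_append monom_mult_closed poly_mult_closed ev_monom_mult U.l_distr)

end

section \<open>The gauge bound for linear coefficients\<close>

lemma norm_linear_coefficient_le:
  fixes K :: "(nat \<times> complex) list"
  assumes "\<And>\<zeta>. cmod \<zeta> = 1 \<Longrightarrow> cmod (\<Sum>(k, b)\<leftarrow>K. b * \<zeta> ^ k) \<le> C"
  shows "cmod (\<Sum>(k, b)\<leftarrow>K. if k = 1 then b else 0) \<le> C"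
proof -
  let ?f = "\<lambda>\<zeta>. \<Sum>(k, b)\<leftarrow>K. b * \<zeta> ^ k"
  have D: "(?f has_field_derivative (\<Sum>(k, b)\<leftarrow>K. b * (of_nat k * z ^ (k - 1)))) (at z)" for z
    by (induction K) (auto intro!: derivative_eq_intros)
  have hol: "?f holomorphic_on S" for S
    using D by (auto simp: holomorphic_on_def field_differentiable_def intro: has_field_derivative_at_within)
  have "cmod ((deriv ^^ 1) ?f 0) \<le> fact 1 * C / 1 ^ 1"
    by (rule Cauchy_inequality) (use hol assms in \<open>auto intro: holomorphic_on_imp_continuous_on\<close>)
  moreover have "deriv ?f 0 = (\<Sum>(k, b)\<leftarrow>K. b * (of_nat k * 0 ^ (k - 1)))"
    by (rule DERIV_imp_deriv[OF D])
  moreover have "(\<Sum>(k, b)\<leftarrow>K. b * (of_nat k * 0 ^ (k - 1))) = (\<Sum>(k, b)\<leftarrow>K. if k = 1 then b else 0)"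
    by (intro arg_cong[of _ _ sum_list] map_cong) (auto simp: power_0_left)
  ultimately show ?thesis by simp
qed

context stacey_rep
begin

lemma foldr_Q_closed [simp, intro]: "set w \<subseteq> {..<n} \<Longrightarrow> x \<in> carrier H \<Longrightarrow> foldr Q w x \<in> carrier H"
  by (induction w) auto

lemma foldr_gauge:
  assumes "set w \<subseteq> {..<n}" "\<sigma> ` {..<n} \<subseteq> {..<n}" "x \<in> carrier H"
  shows "foldr (\<lambda>i. z i \<odot>\<^bsub>Hil.BH\<^esub> Q (\<sigma> i)) w x = prod_list (map z w) \<odot>\<^bsub>H\<^esub> foldr Q (map \<sigma> w) x"
  using assms(1)
proof (induction w)
  case (Cons i w)
  have \<sigma>: "set (map \<sigma> w) \<subseteq> {..<n}" "\<sigma> i < n" using Cons.prems assms(2) by auto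
  note cl = foldr_Q_closed[OF \<sigma>(1) assms(3)]
  show ?case using Cons cl \<sigma>(2) by (simp add: Hil.op_smult mult.commute flip: Hil.smult_assoc)
qed (use assms(3) in simp)

end

context stacey_universal
begin

lemma word_apply:
  assumes r: "(H, \<pi>, Q) \<in> stacey_reps A \<alpha> n" and w: "set w \<subseteq> {..<n}" and x: "x \<in> carrier H"
  shows "word w (H, \<pi>, Q) x = foldr Q w x"
proof -
  interpret stacey_rep A \<alpha> H \<pi> Q n by (rule stacey_repI[OF r])
  show ?thesis using w x by (induction w) (auto simp: U_apply[OF r])
qed

lemma ip_ev:
  assumes r: "(H, \<pi>, Q) \<in> stacey_reps A \<alpha> n" and L: "L \<in> wpolys n" and x: "x \<in> carrier H" "y \<in> carrier H"
  shows "ip H (ev L (H, \<pi>, Q) x) y = (\<Sum>(a, w)\<leftarrow>L. ip H (\<pi> a (foldr Q w x)) y)"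
proof -
  interpret stacey_rep A \<alpha> H \<pi> Q n by (rule stacey_repI[OF r])
  show ?thesis using L
  proof (induction L rule: ev.induct)
    case (2 a w L)
    have "ev L (H, \<pi>, Q) \<in> bounded_op_set H" using 2 by (intro U_coord[OF _ r]) auto
    thus ?case using 2 x by (simp add: U_apply[OF r] word_apply[OF r] Hil.ip_add)
  qed (use x in \<open>simp add: U_apply[OF r]\<close>)
qed

text \<open>Replacing \<open>Q\<^sub>l\<close> by \<open>\<zeta> Q\<^sub>k\<close> and the other isometries by \<open>\<zeta>\<^sup>2\<close>-multiples of \<open>Q\<^sub>j\<close> turns a polynomial into
  a polynomial in \<open>\<zeta>\<close> whose linear coefficient comes from the word \<open>[l]\<close> alone.\<close>

lemma ip_coef_le:
  assumes r: "(H, \<pi>, Q) \<in> stacey_reps A \<alpha> n" and L: "L \<in> wpolys n" and l: "l < n" and k: "k < n"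
    and x: "x \<in> carrier H" and y: "y \<in> carrier H"
  shows "cmod (ip H (\<pi> (coef [l] L) (Q k x)) y) \<le> nrm U (ev L) * hnorm H x * hnorm H y"
proof -
  interpret stacey_rep A \<alpha> H \<pi> Q n by (rule stacey_repI[OF r])
  define \<sigma> where "\<sigma> i = (if i = l then k else if i = k then l else i)" for i
  have \<sigma>: "bij_betw \<sigma> {..<n} {..<n}"
    by (rule bij_betw_byWitness[where f' = \<sigma>]) (use l k in \<open>auto simp: \<sigma>_def\<close>)
  hence \<sigma>n: "\<sigma> ` {..<n} \<subseteq> {..<n}" by (simp add: bij_betw_def)
  define wt where "wt w = sum_list (map (\<lambda>i. if i = l then 1 else 2 :: nat) w)" for w
  have wt1: "wt w = 1 \<longleftrightarrow> w = [l]" for w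
  proof (cases w)
    case (Cons i v)
    thus ?thesis by (cases v) (auto simp: wt_def split: if_splits)
  qed (simp add: wt_def)
  define K where "K = map (\<lambda>(a, w). (wt w, ip H (\<pi> a (foldr Q (map \<sigma> w) x)) y)) L"
  have bound: "cmod (\<Sum>(k, b)\<leftarrow>K. b * \<zeta> ^ k) \<le> nrm U (ev L) * hnorm H x * hnorm H y" if \<zeta>: "cmod \<zeta> = 1" for \<zeta>
  proof -
    define z where "z i = (if i = l then \<zeta> else \<zeta>\<^sup>2)" for i
    let ?Q = "\<lambda>i. z i \<odot>\<^bsub>Hil.BH\<^esub> Q (\<sigma> i)"
    have r': "(H, \<pi>, ?Q) \<in> stacey_reps A \<alpha> n"
      by (rule gauge[OF _ \<sigma>]) (auto simp: z_def \<zeta> norm_power)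
    have zw: "prod_list (map z w) = \<zeta> ^ wt w" for w
      by (induction w) (auto simp: z_def wt_def power_add power2_eq_square)
    have step: "(case p of (a, w) \<Rightarrow> ip H (\<pi> a (foldr ?Q w x)) y) =
        ((\<lambda>(k, b). b * \<zeta> ^ k) \<circ> (\<lambda>(a, w). (wt w, ip H (\<pi> a (foldr Q (map \<sigma> w) x)) y))) p"
      if "p \<in> set L" for p
    proof -
      obtain a w where p: "p = (a, w)" by (cases p)
      have aw: "a \<in> carrier A" "set w \<subseteq> {..<n}" using L that p by (auto simp: wpolys_def)
      have \<sigma>w: "set (map \<sigma> w) \<subseteq> {..<n}" using aw(2) \<sigma>n by auto
      have "foldr ?Q w x = \<zeta> ^ wt w \<odot>\<^bsub>H\<^esub> foldr Q (map \<sigma> w) x"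
        by (simp only: foldr_gauge[OF aw(2) \<sigma>n x] zw)
      thus ?thesis using aw foldr_Q_closed[OF \<sigma>w x] y by (simp add: p Hil.op_smult Hil.ip_smult)
    qed
    have "ip H (ev L (H, \<pi>, ?Q) x) y = (\<Sum>(a, w)\<leftarrow>L. ip H (\<pi> a (foldr ?Q w x)) y)"
      by (rule ip_ev[OF r' L x y])
    also have "\<dots> = (\<Sum>(k, b)\<leftarrow>K. b * \<zeta> ^ k)"
      unfolding K_def map_map by (intro arg_cong[of _ _ sum_list] map_cong refl step)
    finally have eq: "(\<Sum>(k, b)\<leftarrow>K. b * \<zeta> ^ k) = ip H (ev L (H, \<pi>, ?Q) x) y" by (rule sym)
    have cl: "ev L (H, \<pi>, ?Q) \<in> bounded_op_set H" using L by (intro U_coord[OF _ r']) auto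
    have "cmod (ip H (ev L (H, \<pi>, ?Q) x) y) \<le> hnorm H (ev L (H, \<pi>, ?Q) x) * hnorm H y"
      using cl x y by (intro Hil.Cauchy_Schwarz) auto
    also have "\<dots> \<le> (nrm Hil.BH (ev L (H, \<pi>, ?Q)) * hnorm H x) * hnorm H y"
      using cl x y by (intro mult_right_mono Hil.nrm_op) auto
    also have "\<dots> \<le> (nrm U (ev L) * hnorm H x) * hnorm H y"
      using L x y by (intro mult_right_mono U_nrm_coord[OF _ r']) auto
    finally show ?thesis by (simp only: eq)
  qed
  have Qk: "Q k x \<in> carrier H" using k x by auto
  have "ip H (\<pi> (coef [l] L) (Q k x)) y = (\<Sum>(a, w)\<leftarrow>L. if w = [l] then ip H (\<pi> a (Q k x)) y else 0)"
    using L
  proof (induction L rule: ev.induct)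
    case 1
    have "\<pi> \<zero> \<oplus>\<^bsub>Hil.BH\<^esub> \<pi> \<zero> = \<pi> \<zero>" using \<pi>_add[of \<zero> \<zero>] by simp
    hence "ip H (\<pi> \<zero> (Q k x)) y + ip H (\<pi> \<zero> (Q k x)) y = ip H (\<pi> \<zero> (Q k x)) y"
      using Qk y by (metis Hil.BH_apply(1) Hil.ip_add Hil.op_cl \<pi>_closed zero_closed)
    thus ?case by simp
  next
    case (2 a w L)
    thus ?case using Qk y by (auto simp: \<pi>_add Hil.ip_add coef_closed[of _ n])
  qed
  also have "\<dots> = (\<Sum>(k, b)\<leftarrow>K. if k = 1 then b else 0)"
    unfolding K_def map_map
    by (intro arg_cong[of _ _ sum_list] map_cong refl) (auto simp: wt1[unfolded One_nat_def] \<sigma>_def)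
  finally show ?thesis using norm_linear_coefficient_le[of K, OF bound] by simp
qed

lemma nrm_\<iota>_coef_le:
  assumes L: "L \<in> wpolys n" and l: "l < n"
  shows "nrm U (\<iota> (coef [l] L)) \<le> real n * nrm U (ev L)"
  unfolding stacey_ambient_def
proof (rule nrm_cstar_prod_le[OF reps_nonempty])
  fix r assume rR: "r \<in> stacey_reps A \<alpha> n"
  then obtain H \<pi> Q where r: "r = (H, \<pi>, Q)" "stacey_rep A \<alpha> H \<pi> Q n" by (rule rep_cases)
  interpret stacey_rep A \<alpha> H \<pi> Q n by (rule r)
  let ?c = "coef [l] L" and ?N = "nrm U (ev L)"
  have N: "0 \<le> ?N" using L by (intro U.nrm_nonneg) auto
  have c: "\<pi> ?c \<in> bounded_op_set H" using L by (auto simp: coef_closed[of _ n])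
  have "nrm Hil.BH (\<pi> ?c) \<le> real n * ?N"
  proof (rule Hil.nrm_op_le)
    fix x assume x: "x \<in> carrier H"
    show "hnorm H (\<pi> ?c x) \<le> real n * ?N * hnorm H x"
    proof (rule Hil.hnorm_le_by_ip)
      fix y assume y: "y \<in> carrier H"
      have cy: "adj Hil.BH (\<pi> ?c) y \<in> carrier H" using c y by auto
      have "ip H (\<pi> ?c x) y = ip H x (adj Hil.BH (\<pi> ?c) y)" using c x y by (simp add: Hil.adj_ip)
      also have "\<dots> = (\<Sum>k<n. ip H (adj Hil.BH (Q k) x) (adj Hil.BH (Q k) (adj Hil.BH (\<pi> ?c) y)))"
        using sum_ip_adj_Q[OF x cy] ..
      also have "\<dots> = (\<Sum>k<n. ip H (\<pi> ?c (Q k (adj Hil.BH (Q k) x))) y)"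
        using c x y cy by (intro sum.cong refl) (simp add: Hil.adj_ip)
      finally have "cmod (ip H (\<pi> ?c x) y) \<le> (\<Sum>k<n. cmod (ip H (\<pi> ?c (Q k (adj Hil.BH (Q k) x))) y))"
        by (simp add: norm_sum)
      also have "\<dots> \<le> (\<Sum>k<n. ?N * hnorm H x * hnorm H y)"
      proof (rule sum_mono)
        fix k assume "k \<in> {..<n}"
        hence k: "k < n" by simp
        have "cmod (ip H (\<pi> ?c (Q k (adj Hil.BH (Q k) x))) y) \<le> ?N * hnorm H (adj Hil.BH (Q k) x) * hnorm H y"
          using k x y by (intro ip_coef_le[OF rep L l]) auto
        also have "\<dots> \<le> ?N * hnorm H x * hnorm H y"
          using hnorm_adj_Q[OF k x] N y by (intro mult_right_mono mult_left_mono) auto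
        finally show "cmod (ip H (\<pi> ?c (Q k (adj Hil.BH (Q k) x))) y) \<le> ?N * hnorm H x * hnorm H y" .
      qed
      finally show "cmod (ip H (\<pi> ?c x) y) \<le> real n * ?N * hnorm H x * hnorm H y" by (simp add: mult_ac)
    qed (use c x N in auto)
  qed (use N in auto)
  thus "nrm (bounded_ops (fst r)) (\<iota> ?c r) \<le> real n * nrm (cstar_prod (stacey_reps A \<alpha> n) (\<lambda>r. bounded_ops (fst r))) (ev L)"
    using r rep by (simp add: U_apply[OF rep] flip: stacey_ambient_def)
qed

end

section \<open>Isomorphic semicrossed products have comparable linear parts\<close>

context stacey_universal
begin

lemma closed_subalgebra_limits:
  fixes S :: "nat \<Rightarrow> 'c wpoly set"
  assumes S: "\<And>k. S k \<subseteq> wpolys n"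
    and app: "\<And>k L K. L \<in> S k \<Longrightarrow> K \<in> S k \<Longrightarrow> L @ K \<in> S k"
    and mult: "\<And>k L K. L \<in> S k \<Longrightarrow> K \<in> S k \<Longrightarrow> poly_mult L K \<in> S k"
    and const: "\<And>k a. a \<in> carrier A \<Longrightarrow> [(a, [])] \<in> S k"
  defines "V \<equiv> {y \<in> carrier U. \<forall>e>0. \<forall>\<^sub>F k in sequentially. \<exists>L\<in>S k. nrm U (y \<ominus>\<^bsub>U\<^esub> ev L) < e}"
  shows "closed_subalgebra U V" and "\<And>a. a \<in> carrier A \<Longrightarrow> \<iota> a \<in> V"
proof -
  have evc: "ev L \<in> carrier U" if "L \<in> S k" for L k using S that by blast
  show \<iota>V: "\<iota> a \<in> V" if a: "a \<in> carrier A" for a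
  proof -
    have "ev [(a, [])] = \<iota> a" using a by simp
    hence "nrm U (\<iota> a \<ominus>\<^bsub>U\<^esub> ev [(a, [])]) = 0" using a by (simp add: U.r_neg U.nrm_zero U.minus_eq)
    thus ?thesis unfolding V_def using const[OF a] a
      by (auto intro!: always_eventually bexI[of _ "[(a, [])]"] simp del: ev.simps)
  qed
  have multV: "x \<otimes>\<^bsub>U\<^esub> y \<in> V" if xV: "x \<in> V" and yV: "y \<in> V" for x y
    unfolding V_def
  proof (intro CollectI conjI allI impI)
    have x: "x \<in> carrier U" and y: "y \<in> carrier U" using xV yV by (auto simp: V_def)
    show "x \<otimes>\<^bsub>U\<^esub> y \<in> carrier U" using x y by simp
    fix e :: real assume e: "e > 0"
    define D where "D = nrm U x + nrm U y + 1"
    have D: "D > 0" using U.nrm_nonneg[OF x] U.nrm_nonneg[OF y] by (simp add: D_def)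
    define d where "d = min 1 (e / (2 * D))"
    have d: "d > 0" "d \<le> 1" "d * D < e"
    proof -
      show "d > 0" "d \<le> 1" using e D by (auto simp: d_def)
      have "d * D \<le> e / (2 * D) * D" using D by (intro mult_right_mono) (auto simp: d_def)
      thus "d * D < e" using D e by simp
    qed
    have "\<forall>\<^sub>F k in sequentially. \<exists>L\<in>S k. nrm U (x \<ominus>\<^bsub>U\<^esub> ev L) < d"
      "\<forall>\<^sub>F k in sequentially. \<exists>L\<in>S k. nrm U (y \<ominus>\<^bsub>U\<^esub> ev L) < d"
      using xV yV d by (auto simp: V_def)
    thus "\<forall>\<^sub>F k in sequentially. \<exists>L\<in>S k. nrm U (x \<otimes>\<^bsub>U\<^esub> y \<ominus>\<^bsub>U\<^esub> ev L) < e"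
    proof eventually_elim
      case (elim k)
      then obtain L K where L: "L \<in> S k" "nrm U (x \<ominus>\<^bsub>U\<^esub> ev L) < d" and K: "K \<in> S k" "nrm U (y \<ominus>\<^bsub>U\<^esub> ev K) < d" by blast
      have cl: "ev L \<in> carrier U" "ev K \<in> carrier U" using evc L K by auto
      have "ev K = y \<ominus>\<^bsub>U\<^esub> (y \<ominus>\<^bsub>U\<^esub> ev K)" using cl y by algebra
      hence "nrm U (ev K) \<le> nrm U y + nrm U (y \<ominus>\<^bsub>U\<^esub> ev K)"
        using U.nrm_triangle_minus[of y "y \<ominus>\<^bsub>U\<^esub> ev K"] cl y by simp
      hence nK: "nrm U (ev K) \<le> nrm U y + 1" using K d by simp
      have "x \<otimes>\<^bsub>U\<^esub> y \<ominus>\<^bsub>U\<^esub> ev L \<otimes>\<^bsub>U\<^esub> ev K = x \<otimes>\<^bsub>U\<^esub> (y \<ominus>\<^bsub>U\<^esub> ev K) \<oplus>\<^bsub>U\<^esub> (x \<ominus>\<^bsub>U\<^esub> ev L) \<otimes>\<^bsub>U\<^esub> ev K"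
        using cl x y by algebra
      hence "nrm U (x \<otimes>\<^bsub>U\<^esub> y \<ominus>\<^bsub>U\<^esub> ev L \<otimes>\<^bsub>U\<^esub> ev K)
          \<le> nrm U (x \<otimes>\<^bsub>U\<^esub> (y \<ominus>\<^bsub>U\<^esub> ev K)) + nrm U ((x \<ominus>\<^bsub>U\<^esub> ev L) \<otimes>\<^bsub>U\<^esub> ev K)"
        using cl x y U.nrm_triangle by simp
      also have "\<dots> \<le> nrm U x * nrm U (y \<ominus>\<^bsub>U\<^esub> ev K) + nrm U (x \<ominus>\<^bsub>U\<^esub> ev L) * nrm U (ev K)"
        using cl x y by (intro add_mono U.nrm_mult) auto
      also have "\<dots> \<le> nrm U x * d + d * (nrm U y + 1)"
        using cl x y L K nK d U.nrm_nonneg by (intro add_mono mult_mono) (auto intro: less_imp_le)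
      also have "\<dots> = d * D" by (simp add: D_def algebra_simps)
      finally have "nrm U (x \<otimes>\<^bsub>U\<^esub> y \<ominus>\<^bsub>U\<^esub> ev (poly_mult L K)) < e"
        using d L K S by (subst ev_poly_mult) auto
      thus ?case using mult L K by blast
    qed
  qed
  show "closed_subalgebra U V"
  proof (rule U.closed_subalgebraI)
    show "V \<subseteq> carrier U" by (auto simp: V_def)
    show "\<zero>\<^bsub>U\<^esub> \<in> V"
      using \<iota>V[OF scalar_closed, of 0] by (simp only: \<iota>_scalar U.smult_0[OF U.one_closed])
    show "c \<odot>\<^bsub>U\<^esub> x \<in> V" if x: "x \<in> V" for c x
    proof -
      have "c \<odot>\<^bsub>U\<^esub> x = \<iota> (c \<odot> \<one>) \<otimes>\<^bsub>U\<^esub> x" using x by (simp add: V_def \<iota>_scalar U.smult_mult_left)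
      thus ?thesis using multV[OF \<iota>V[OF scalar_closed] x] by simp
    qed
    show "x \<otimes>\<^bsub>U\<^esub> y \<in> V" if "x \<in> V" "y \<in> V" for x y using that by (rule multV)
    show "x \<oplus>\<^bsub>U\<^esub> y \<in> V" if xV: "x \<in> V" and yV: "y \<in> V" for x y
      unfolding V_def
    proof (intro CollectI conjI allI impI)
      have x: "x \<in> carrier U" and y: "y \<in> carrier U" using xV yV by (auto simp: V_def)
      show "x \<oplus>\<^bsub>U\<^esub> y \<in> carrier U" using x y by simp
      fix e :: real assume e: "e > 0"
      have "\<forall>\<^sub>F k in sequentially. \<exists>L\<in>S k. nrm U (x \<ominus>\<^bsub>U\<^esub> ev L) < e / 2"
        "\<forall>\<^sub>F k in sequentially. \<exists>L\<in>S k. nrm U (y \<ominus>\<^bsub>U\<^esub> ev L) < e / 2"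
        using xV yV half_gt_zero[OF e] unfolding V_def by blast+
      thus "\<forall>\<^sub>F k in sequentially. \<exists>L\<in>S k. nrm U (x \<oplus>\<^bsub>U\<^esub> y \<ominus>\<^bsub>U\<^esub> ev L) < e"
      proof eventually_elim
        case (elim k)
        then obtain L K where L: "L \<in> S k" "nrm U (x \<ominus>\<^bsub>U\<^esub> ev L) < e / 2"
          and K: "K \<in> S k" "nrm U (y \<ominus>\<^bsub>U\<^esub> ev K) < e / 2" by blast
        have cl: "ev L \<in> carrier U" "ev K \<in> carrier U" using evc L K by auto
        have "x \<oplus>\<^bsub>U\<^esub> y \<ominus>\<^bsub>U\<^esub> (ev L \<oplus>\<^bsub>U\<^esub> ev K) = (x \<ominus>\<^bsub>U\<^esub> ev L) \<oplus>\<^bsub>U\<^esub> (y \<ominus>\<^bsub>U\<^esub> ev K)"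
          using cl x y by algebra
        hence "nrm U (x \<oplus>\<^bsub>U\<^esub> y \<ominus>\<^bsub>U\<^esub> ev (L @ K)) < e"
          using U.nrm_triangle[of "x \<ominus>\<^bsub>U\<^esub> ev L" "y \<ominus>\<^bsub>U\<^esub> ev K"] cl x y L K S
          by (subst ev_append) auto
        thus ?case using app L K by blast
      qed
    qed
    show "x \<in> V" if x: "x \<in> carrier U" and lim: "\<And>e. e > 0 \<Longrightarrow> \<exists>v\<in>V. nrm U (x \<ominus>\<^bsub>U\<^esub> v) < e" for x
      unfolding V_def
    proof (intro CollectI conjI x allI impI)
      fix e :: real assume e: "e > 0"
      obtain v where v: "v \<in> V" "nrm U (x \<ominus>\<^bsub>U\<^esub> v) < e / 2" using lim[of "e / 2"] e by auto
      have "\<forall>\<^sub>F k in sequentially. \<exists>L\<in>S k. nrm U (v \<ominus>\<^bsub>U\<^esub> ev L) < e / 2"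
        using v half_gt_zero[OF e] unfolding V_def by blast
      thus "\<forall>\<^sub>F k in sequentially. \<exists>L\<in>S k. nrm U (x \<ominus>\<^bsub>U\<^esub> ev L) < e"
      proof eventually_elim
        case (elim k)
        then obtain L where L: "L \<in> S k" "nrm U (v \<ominus>\<^bsub>U\<^esub> ev L) < e / 2" by blast
        have "nrm U (x \<ominus>\<^bsub>U\<^esub> ev L) < e"
          using U.nrm_minus_trans[OF x _ evc[OF L(1)], of v] v L by (simp add: V_def)
        thus ?case using L by blast
      qed
    qed
  qed
qed

lemma semicrossed_dense:
  assumes y: "y \<in> carrier (semicrossed_product A \<alpha> n)" and e: "e > 0"
  shows "\<exists>L\<in>wpolys n. nrm U (y \<ominus>\<^bsub>U\<^esub> ev L) < e"
proof -
  let ?V = "{y \<in> carrier U. \<forall>e>0. \<forall>\<^sub>F k in sequentially. \<exists>L\<in>wpolys n. nrm U (y \<ominus>\<^bsub>U\<^esub> ev L) < e}"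
  have V: "closed_subalgebra U ?V" "\<And>a. a \<in> carrier A \<Longrightarrow> \<iota> a \<in> ?V"
    by (rule closed_subalgebra_limits; simp add: poly_mult_closed)+
  have "t i \<in> ?V" if i: "i < n" for i
  proof -
    have "ev [(\<one>, [i])] = t i" using i by (simp add: \<iota>_one)
    hence "nrm U (t i \<ominus>\<^bsub>U\<^esub> ev [(\<one>, [i])]) = 0" using i by (simp add: U.r_neg U.nrm_zero U.minus_eq)
    thus ?thesis using i by (auto intro!: always_eventually bexI[of _ "[(\<one>, [i])]"] simp del: ev.simps)
  qed
  hence "stacey_gens A \<alpha> n \<subseteq> ?V" using V(2) by (auto simp: stacey_gens_def)
  hence "y \<in> ?V" using hull_minimal[of "stacey_gens A \<alpha> n" ?V "closed_subalgebra U"] V(1) y by auto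
  thus ?thesis using e by auto
qed

end

definition identity_defect :: "'c cstar \<Rightarrow> nat \<Rightarrow> (nat \<Rightarrow> nat \<Rightarrow> 'c) \<Rightarrow> (nat \<Rightarrow> nat \<Rightarrow> 'c) \<Rightarrow> nat \<Rightarrow> nat \<Rightarrow> 'c" where
  "identity_defect A k d c j l = (if l = j then \<one>\<^bsub>A\<^esub> else \<zero>\<^bsub>A\<^esub>) \<oplus>\<^bsub>A\<^esub>
     ((-1) \<odot>\<^bsub>A\<^esub> \<one>\<^bsub>A\<^esub>) \<otimes>\<^bsub>A\<^esub> finsum A (\<lambda>i. d j i \<otimes>\<^bsub>A\<^esub> c i l) {..<k}"

context stacey_system
begin

lemma identity_defect_closed:
  assumes "\<And>i. i < k \<Longrightarrow> d j i \<in> carrier A" "\<And>i. i < k \<Longrightarrow> c i l \<in> carrier A"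
  shows "identity_defect A k d c j l \<in> carrier A"
  using assms scalar_closed by (auto simp: identity_defect_def intro!: a_closed m_closed finsum_closed)

text \<open>Here \<open>c\<close> and \<open>d\<close> are the linear parts of \<open>\<Phi>\<close> at the generators \<open>s\<^sub>i\<close> and of \<open>\<Phi>\<^sup>-\<^sup>1\<close> at the generators \<open>t\<^sub>j\<close>; the chain
  rule for \<open>\<Phi> \<circ> \<Phi>\<^sup>-\<^sup>1\<close> is applied in the set \<open>V\<close> of limits of polynomials whose linear part factors through \<open>c\<close>.\<close>

lemma identity_matrix_factors:
  assumes ne: "stacey_reps A \<alpha> n \<noteq> {}" "stacey_reps A \<alpha> m \<noteq> {}"
    and hom: "alg_hom (semicrossed_product A \<alpha> n) (semicrossed_product A \<alpha> m) \<Phi>"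
    and onto: "\<Phi> ` carrier (semicrossed_product A \<alpha> n) = carrier (semicrossed_product A \<alpha> m)"
    and isom: "\<And>x. x \<in> carrier (semicrossed_product A \<alpha> n) \<Longrightarrow>
        nrm (stacey_ambient A \<alpha> m) (\<Phi> x) = nrm (stacey_ambient A \<alpha> n) x"
    and fixes_A: "\<And>a. a \<in> carrier A \<Longrightarrow> \<Phi> (stacey_incl A \<alpha> n a) = stacey_incl A \<alpha> m a"
    and e: "e > 0"
  shows "\<exists>d c. (\<forall>j<m. \<forall>i<n. d j i \<in> carrier A) \<and> (\<forall>i<n. \<forall>l<m. c i l \<in> carrier A) \<and>
    (\<forall>j<m. \<forall>l<m. nrm (stacey_ambient A \<alpha> m) (stacey_incl A \<alpha> m (identity_defect A n d c j l)) \<le> e)"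
proof -
  interpret N: stacey_universal A \<alpha> n by unfold_locales (rule ne)
  interpret K: stacey_universal A \<alpha> m by unfold_locales (rule ne)
  let ?C = "semicrossed_product A \<alpha> n" and ?D = "semicrossed_product A \<alpha> m"
  have CN: "carrier ?C \<subseteq> carrier N.U" and DK: "carrier ?D \<subseteq> carrier K.U"
    by (rule N.carrier_semicrossed_product K.carrier_semicrossed_product)+
  have \<Phi>_cl: "\<Phi> x \<in> carrier ?D" if "x \<in> carrier ?C" for x using hom that by (auto simp: alg_hom_def)
  have \<Phi>: "\<Phi> (x \<oplus>\<^bsub>N.U\<^esub> y) = \<Phi> x \<oplus>\<^bsub>K.U\<^esub> \<Phi> y" "\<Phi> (x \<otimes>\<^bsub>N.U\<^esub> y) = \<Phi> x \<otimes>\<^bsub>K.U\<^esub> \<Phi> y"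
    "\<Phi> (c \<odot>\<^bsub>N.U\<^esub> x) = c \<odot>\<^bsub>K.U\<^esub> \<Phi> x"
    if "x \<in> carrier ?C" "y \<in> carrier ?C" for x y c
    using hom that by (auto simp: alg_hom_def)
  have Ccl: "x \<oplus>\<^bsub>N.U\<^esub> y \<in> carrier ?C" "x \<otimes>\<^bsub>N.U\<^esub> y \<in> carrier ?C" "c \<odot>\<^bsub>N.U\<^esub> x \<in> carrier ?C"
    if "x \<in> carrier ?C" "y \<in> carrier ?C" for x y c
    using that closed_subalgebra_hull_closed by auto
  have \<Phi>_minus: "\<Phi> (x \<ominus>\<^bsub>N.U\<^esub> y) = \<Phi> x \<ominus>\<^bsub>K.U\<^esub> \<Phi> y" and C_minus: "x \<ominus>\<^bsub>N.U\<^esub> y \<in> carrier ?C"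
    if "x \<in> carrier ?C" "y \<in> carrier ?C" for x y
  proof -
    have cl: "x \<in> carrier N.U" "y \<in> carrier N.U" "\<Phi> x \<in> carrier K.U" "\<Phi> y \<in> carrier K.U"
      using that CN DK \<Phi>_cl by blast+
    note y' = Ccl(3)[OF that(2) that(2), of "-1"]
    show "x \<ominus>\<^bsub>N.U\<^esub> y \<in> carrier ?C" using Ccl(1)[OF that(1) y'] cl by (simp only: N.U.minus_eq_smult)
    show "\<Phi> (x \<ominus>\<^bsub>N.U\<^esub> y) = \<Phi> x \<ominus>\<^bsub>K.U\<^esub> \<Phi> y"
      by (simp only: N.U.minus_eq_smult[OF cl(1,2)] K.U.minus_eq_smult[OF cl(3,4)] \<Phi>(1)[OF that(1) y'] \<Phi>(3)[OF that(2) that(2)])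
  qed
  have tC: "N.t i \<in> carrier ?C" if "i < n" for i using that by (auto intro: hull_inc stacey_isom_gens)
  have \<iota>C: "N.\<iota> a \<in> carrier ?C" if "a \<in> carrier A" for a using that by (auto intro: hull_inc stacey_incl_gens)
  have tD: "K.t j \<in> carrier ?D" if "j < m" for j using that by (auto intro: hull_inc stacey_isom_gens)
  have "\<forall>k i. \<exists>L. i < n \<longrightarrow> L \<in> wpolys m \<and> nrm K.U (\<Phi> (N.t i) \<ominus>\<^bsub>K.U\<^esub> K.ev L) < 1 / real (Suc k)"
    using K.semicrossed_dense[OF \<Phi>_cl[OF tC]] by (metis of_nat_0_less_iff zero_less_Suc zero_less_divide_1_iff)
  then obtain p where p: "\<And>k i. i < n \<Longrightarrow> p k i \<in> wpolys m"
    and pn: "\<And>k i. i < n \<Longrightarrow> nrm K.U (\<Phi> (N.t i) \<ominus>\<^bsub>K.U\<^esub> K.ev (p k i)) < 1 / real (Suc k)" by metis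
  have pc: "coef [l] (p k i) \<in> carrier A" if "i < n" for k i l using p[OF that] by (rule coef_closed)
  define comb where "comb k d L \<longleftrightarrow> (\<forall>i<n. d i \<in> carrier A) \<and>
      (\<forall>l<m. coef [l] L = (\<Oplus>i\<in>{..<n}. d i \<otimes> coef [l] (p k i)))" for k d L
  define S where "S k = {L \<in> wpolys m. \<exists>d. comb k d L}" for k
  have combI: "L \<in> S k" if "L \<in> wpolys m" "\<And>i. i < n \<Longrightarrow> d i \<in> carrier A"
    "\<And>l. l < m \<Longrightarrow> coef [l] L = (\<Oplus>i\<in>{..<n}. d i \<otimes> coef [l] (p k i))" for L k d
    using that unfolding S_def comb_def by blast
  have Sapp: "L @ K \<in> S k" if LS: "L \<in> S k" and KS: "K \<in> S k" for L K k
  proof -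
    obtain d f where d: "L \<in> wpolys m" "comb k d L" and f: "K \<in> wpolys m" "comb k f K"
      using LS KS by (auto simp: S_def)
    have cl: "d i \<in> carrier A" "f i \<in> carrier A" if "i < n" for i using that d f by (auto simp: comb_def)
    show ?thesis
    proof (rule combI[where d = "\<lambda>i. d i \<oplus> f i"])
      fix l assume l: "l < m"
      have "(\<Oplus>i\<in>{..<n}. (d i \<oplus> f i) \<otimes> coef [l] (p k i))
          = (\<Oplus>i\<in>{..<n}. d i \<otimes> coef [l] (p k i) \<oplus> f i \<otimes> coef [l] (p k i))"
        using cl pc by (intro finsum_cong') (auto simp: l_distr)
      also have "\<dots> = (\<Oplus>i\<in>{..<n}. d i \<otimes> coef [l] (p k i)) \<oplus> (\<Oplus>i\<in>{..<n}. f i \<otimes> coef [l] (p k i))"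
        using cl pc by (intro finsum_addf) auto
      finally show "coef [l] (L @ K) = (\<Oplus>i\<in>{..<n}. (d i \<oplus> f i) \<otimes> coef [l] (p k i))"
        using d f l by (simp add: coef_append[of _ m] comb_def)
    qed (use d f cl in auto)
  qed
  have Smult: "poly_mult L K \<in> S k" if LS: "L \<in> S k" and KS: "K \<in> S k" for L K k
  proof -
    obtain d f where d: "L \<in> wpolys m" "comb k d L" and f: "K \<in> wpolys m" "comb k f K"
      using LS KS by (auto simp: S_def)
    have cl: "d i \<in> carrier A" "f i \<in> carrier A" if "i < n" for i using that d f by (auto simp: comb_def)
    let ?a = "coef [] L" and ?b = "\<alpha> (coef [] K)"
    have ab: "?a \<in> carrier A" "?b \<in> carrier A" using d f \<alpha>_closed by (auto simp: coef_closed[of _ m])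
    show ?thesis
    proof (rule combI[where d = "\<lambda>i. ?a \<otimes> f i \<oplus> ?b \<otimes> d i"])
      fix l assume l: "l < m"
      have "(\<Oplus>i\<in>{..<n}. (?a \<otimes> f i \<oplus> ?b \<otimes> d i) \<otimes> coef [l] (p k i))
          = (\<Oplus>i\<in>{..<n}. ?a \<otimes> (f i \<otimes> coef [l] (p k i)) \<oplus> ?b \<otimes> (d i \<otimes> coef [l] (p k i)))"
        using cl pc ab by (intro finsum_cong') (auto simp: l_distr m_assoc)
      also have "\<dots> = (\<Oplus>i\<in>{..<n}. ?a \<otimes> (f i \<otimes> coef [l] (p k i))) \<oplus> (\<Oplus>i\<in>{..<n}. ?b \<otimes> (d i \<otimes> coef [l] (p k i)))"
        using cl pc ab by (intro finsum_addf) auto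
      also have "\<dots> = ?a \<otimes> (\<Oplus>i\<in>{..<n}. f i \<otimes> coef [l] (p k i)) \<oplus> ?b \<otimes> (\<Oplus>i\<in>{..<n}. d i \<otimes> coef [l] (p k i))"
        using cl pc ab by (subst (1 2) finsum_rdistr) auto
      also have "\<dots> = ?a \<otimes> coef [l] K \<oplus> coef [l] L \<otimes> ?b"
        using d f l ab m_comm[of ?b "coef [l] L"] coef_closed[of L m "[l]"] by (simp add: comb_def)
      finally show "coef [l] (poly_mult L K) = (\<Oplus>i\<in>{..<n}. (?a \<otimes> f i \<oplus> ?b \<otimes> d i) \<otimes> coef [l] (p k i))"
        using d f by (simp add: coef_single_poly_mult[of _ m])
    qed (use d f cl ab in \<open>auto simp: poly_mult_closed\<close>)
  qed
  have Sconst: "[(a, [])] \<in> S k" if a: "a \<in> carrier A" for a k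
  proof (rule combI[where d = "\<lambda>_. \<zero>"])
    fix l
    have "(\<Oplus>i\<in>{..<n}. \<zero> \<otimes> coef [l] (p k i)) = (\<Oplus>i\<in>{..<n}. \<zero>)"
      using pc by (intro finsum_cong') auto
    thus "coef [l] [(a, [])] = (\<Oplus>i\<in>{..<n}. \<zero> \<otimes> coef [l] (p k i))" by simp
  qed (use a in auto)
  have Sp: "p k i \<in> S k" if i: "i < n" for i k
  proof (rule combI[where d = "\<lambda>j. if j = i then \<one> else \<zero>"])
    fix l
    have "(\<Oplus>j\<in>{..<n}. (if j = i then \<one> else \<zero>) \<otimes> coef [l] (p k j))
       = (\<Oplus>j\<in>{..<n}. if i = j then coef [l] (p k j) else \<zero>)"
      using pc i by (intro finsum_cong') auto
    also have "\<dots> = coef [l] (p k i)" using i pc by (intro finsum_singleton) auto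
    finally show "coef [l] (p k i) = (\<Oplus>j\<in>{..<n}. (if j = i then \<one> else \<zero>) \<otimes> coef [l] (p k j))" by simp
  qed (use p i in auto)
  define V where "V = {y \<in> carrier K.U. \<forall>e>0. \<forall>\<^sub>F k in sequentially. \<exists>L\<in>S k. nrm K.U (y \<ominus>\<^bsub>K.U\<^esub> K.ev L) < e}"
  have Ssub: "S k \<subseteq> wpolys m" for k by (auto simp: S_def)
  have V: "closed_subalgebra K.U V" and V\<iota>: "\<And>a. a \<in> carrier A \<Longrightarrow> K.\<iota> a \<in> V"
    using K.closed_subalgebra_limits[of S, OF Ssub Sapp Smult Sconst, folded V_def] by blast+
  note VD = closed_subalgebraD[OF V]
  have Vt: "\<Phi> (N.t i) \<in> V" if i: "i < n" for i
    unfolding V_def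
  proof (intro CollectI conjI allI impI)
    show "\<Phi> (N.t i) \<in> carrier K.U" using \<Phi>_cl[OF tC[OF i]] DK by blast
    fix e :: real assume e: "e > 0"
    obtain k0 where k0: "1 / real (Suc k0) < e" using e nat_approx_posE by blast
    show "\<forall>\<^sub>F k in sequentially. \<exists>L\<in>S k. nrm K.U (\<Phi> (N.t i) \<ominus>\<^bsub>K.U\<^esub> K.ev L) < e"
    proof (rule eventually_sequentiallyI[of k0])
      fix k assume "k \<ge> k0"
      hence "1 / real (Suc k) \<le> 1 / real (Suc k0)" by (auto intro!: divide_left_mono)
      hence "1 / real (Suc k) < e" using k0 by (rule le_less_trans)
      hence "nrm K.U (\<Phi> (N.t i) \<ominus>\<^bsub>K.U\<^esub> K.ev (p k i)) < e" using pn[OF i, of k] by (rule less_trans[rotated])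
      thus "\<exists>L\<in>S k. nrm K.U (\<Phi> (N.t i) \<ominus>\<^bsub>K.U\<^esub> K.ev L) < e" using Sp[OF i] by blast
    qed
  qed
  let ?W = "{x \<in> carrier ?C. \<Phi> x \<in> V}"
  have "closed_subalgebra N.U ?W"
  proof (rule N.U.closed_subalgebraI)
    show "?W \<subseteq> carrier N.U" using CN by blast
    have z: "N.\<iota> (0 \<odot> \<one>) = \<zero>\<^bsub>N.U\<^esub>" by (simp only: N.\<iota>_scalar N.U.smult_0[OF N.U.one_closed])
    have "N.\<iota> (0 \<odot> \<one>) \<in> ?W" using \<iota>C[OF scalar_closed] V\<iota>[OF scalar_closed] fixes_A[OF scalar_closed] by simp
    thus "\<zero>\<^bsub>N.U\<^esub> \<in> ?W" by (simp only: z)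
    show "x \<oplus>\<^bsub>N.U\<^esub> y \<in> ?W" "x \<otimes>\<^bsub>N.U\<^esub> y \<in> ?W" if "x \<in> ?W" "y \<in> ?W" for x y
      using that Ccl VD \<Phi> by (simp_all del: semicrossed_product_simps)
    show "c \<odot>\<^bsub>N.U\<^esub> x \<in> ?W" if "x \<in> ?W" for c x
      using that Ccl(3)[of x x c] VD(4) \<Phi>(3)[of x x c] by (simp del: semicrossed_product_simps)
    fix x assume x: "x \<in> carrier N.U" and lim: "\<And>e. e > 0 \<Longrightarrow> \<exists>v\<in>?W. nrm N.U (x \<ominus>\<^bsub>N.U\<^esub> v) < e"
    have xC: "x \<in> carrier ?C"
      unfolding semicrossed_product_simps
      by (rule closed_subalgebra_hull_closed(5)[OF x]) (use lim in fastforce)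
    moreover have "\<Phi> x \<in> V"
    proof (rule VD(6))
      show "\<Phi> x \<in> carrier K.U" using \<Phi>_cl[OF xC] DK by blast
      fix e :: real assume "e > 0"
      then obtain v where v: "v \<in> carrier ?C" "\<Phi> v \<in> V" "nrm N.U (x \<ominus>\<^bsub>N.U\<^esub> v) < e" using lim by blast
      hence "nrm K.U (\<Phi> x \<ominus>\<^bsub>K.U\<^esub> \<Phi> v) < e"
        using isom[OF C_minus[OF xC v(1)]] \<Phi>_minus[OF xC v(1)] by simp
      thus "\<exists>v\<in>V. nrm K.U (\<Phi> x \<ominus>\<^bsub>K.U\<^esub> v) < e" using v by blast
    qed
    ultimately show "x \<in> ?W" by blast
  qed
  moreover have "stacey_gens A \<alpha> n \<subseteq> ?W"
    using \<iota>C tC V\<iota> Vt fixes_A by (auto simp: stacey_gens_def simp del: semicrossed_product_simps)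
  ultimately have CW: "carrier ?C \<subseteq> ?W"
    using hull_minimal[of "stacey_gens A \<alpha> n" ?W "closed_subalgebra N.U"] by simp
  have DV: "carrier ?D \<subseteq> V"
  proof
    fix y assume "y \<in> carrier ?D"
    hence "y \<in> \<Phi> ` carrier ?C" by (simp only: onto)
    then obtain x where "y = \<Phi> x" "x \<in> carrier ?C" by (rule imageE)
    thus "y \<in> V" using subsetD[OF CW] by simp
  qed
  define e' where "e' = e / (real m + 1)"
  have e': "e' > 0" "real m * e' \<le> e" using e by (auto simp: e'_def field_simps)
  have "\<forall>\<^sub>F k in sequentially. \<forall>j\<in>{..<m}. \<exists>L\<in>S k. nrm K.U (K.t j \<ominus>\<^bsub>K.U\<^esub> K.ev L) < e'"
    using tD DV e' by (intro eventually_ball_finite ballI) (auto simp: V_def simp del: semicrossed_product_simps)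
  then obtain k where "\<forall>j\<in>{..<m}. \<exists>L\<in>S k. nrm K.U (K.t j \<ominus>\<^bsub>K.U\<^esub> K.ev L) < e'"
    using eventually_happens'[OF sequentially_bot] by blast
  hence "\<forall>j\<in>{..<m}. \<exists>L. L \<in> S k \<and> nrm K.U (K.t j \<ominus>\<^bsub>K.U\<^esub> K.ev L) < e'" by (simp only: Bex_def)
  then obtain L where LS: "\<forall>j\<in>{..<m}. L j \<in> S k \<and> nrm K.U (K.t j \<ominus>\<^bsub>K.U\<^esub> K.ev (L j)) < e'"
    by (rule bchoice[THEN exE])
  hence "\<forall>j\<in>{..<m}. \<exists>d. comb k d (L j)" by (simp add: S_def)
  then obtain d where d: "\<forall>j\<in>{..<m}. comb k (d j) (L j)" by (rule bchoice[THEN exE])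
  have Ld: "L j \<in> wpolys m \<and> comb k (d j) (L j) \<and> nrm K.U (K.t j \<ominus>\<^bsub>K.U\<^esub> K.ev (L j)) < e'" if "j < m" for j
    using that LS d by (simp add: S_def)
  have "nrm K.U (K.\<iota> (identity_defect A n d (\<lambda>i l. coef [l] (p k i)) j l)) \<le> e"
    if jl: "j < m" "l < m" for j l
  proof -
    have L: "L j \<in> wpolys m" "comb k (d j) (L j)" "nrm K.U (K.t j \<ominus>\<^bsub>K.U\<^esub> K.ev (L j)) < e'" using Ld[OF jl(1)] by auto
    let ?L = "(\<one>, [j]) # monom_mult ((-1) \<odot> \<one>) [] (L j)"
    have L': "monom_mult ((-1) \<odot> \<one>) [] (L j) \<in> wpolys m" by (rule monom_mult_closed[OF scalar_closed _ L(1)]) simp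
    hence LL: "?L \<in> wpolys m" using jl by simp
    have cm: "coef [l] (monom_mult ((-1) \<odot> \<one>) [] (L j)) = ((-1) \<odot> \<one>) \<otimes> coef [l] (L j)"
      by (simp add: coef_single_monom_mult[OF scalar_closed L(1)])
    have cs: "coef [l] (L j) = (\<Oplus>i\<in>{..<n}. d j i \<otimes> coef [l] (p k i))" using L(2) jl by (simp add: comb_def)
    have "coef [l] ?L = (if l = j then \<one> \<oplus> coef [l] (monom_mult ((-1) \<odot> \<one>) [] (L j))
        else coef [l] (monom_mult ((-1) \<odot> \<one>) [] (L j)))" by simp
    also have "\<dots> = (if l = j then \<one> else \<zero>) \<oplus> coef [l] (monom_mult ((-1) \<odot> \<one>) [] (L j))"
      using coef_closed[OF L', of "[l]"] by simp
    finally have c: "coef [l] ?L = identity_defect A n d (\<lambda>i l. coef [l] (p k i)) j l"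
      by (simp only: cm cs identity_defect_def)
    have "K.ev ?L = K.t j \<oplus>\<^bsub>K.U\<^esub> K.\<iota> ((-1) \<odot> \<one>) \<otimes>\<^bsub>K.U\<^esub> K.ev (L j)"
      using jl L(1) K.ev_monom_mult[OF scalar_closed _ L(1), of "[]" "-1"] by (simp add: K.\<iota>_one scalar_closed)
    also have "\<dots> = K.t j \<ominus>\<^bsub>K.U\<^esub> K.ev (L j)"
      using jl L(1) by (simp add: K.\<iota>_scalar K.U.smult_mult_left K.U.minus_eq_smult)
    finally have "nrm K.U (K.ev ?L) < e'" using L(3) by simp
    hence "real m * nrm K.U (K.ev ?L) \<le> real m * e'" by (intro mult_left_mono) auto
    thus ?thesis using K.nrm_\<iota>_coef_le[OF LL jl(2)] e' unfolding c by linarith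
  qed
  moreover have "d j i \<in> carrier A" if "j < m" "i < n" for j i using Ld[OF that(1)] that(2) by (auto simp: comb_def)
  ultimately show ?thesis using pc by (intro exI[of _ d] exI[of _ "\<lambda>i l. coef [l] (p k i)"]) auto
qed

end

section \<open>Ranks\<close>

lemma homogeneous_system_solution:
  fixes C :: "nat \<Rightarrow> 'i \<Rightarrow> complex"
  assumes "finite I" "card I > n"
  shows "\<exists>v. (\<exists>l\<in>I. v l \<noteq> 0) \<and> (\<forall>i<n. (\<Sum>l\<in>I. C i l * v l) = 0)"
  using assms
proof (induction n arbitrary: I C)
  case 0
  then obtain l where "l \<in> I" by fastforce
  thus ?case by (intro exI[of _ "\<lambda>_. 1"]) auto
next
  case (Suc n)
  show ?case
  proof (cases "\<forall>l\<in>I. C n l = 0")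
    case True
    obtain v where "\<exists>l\<in>I. v l \<noteq> 0" "\<forall>i<n. (\<Sum>l\<in>I. C i l * v l) = 0"
      using Suc.IH[OF Suc.prems(1), of C] Suc.prems(2) by auto
    thus ?thesis using True by (intro exI[of _ v]) (auto simp: less_Suc_eq)
  next
    case False
    then obtain l0 where l0: "l0 \<in> I" "C n l0 \<noteq> 0" by blast
    let ?I = "I - {l0}"
    have "card ?I > n" using Suc.prems l0 by simp
    then obtain v where v: "\<exists>l\<in>?I. v l \<noteq> 0" "\<forall>i<n. (\<Sum>l\<in>?I. (C i l - C i l0 * C n l / C n l0) * v l) = 0"
      using Suc.IH[of ?I "\<lambda>i l. C i l - C i l0 * C n l / C n l0"] Suc.prems by auto
    define s where "s = (\<Sum>l\<in>?I. C n l * v l)"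
    define v' where "v' = v(l0 := - s / C n l0)"
    have sum: "(\<Sum>l\<in>I. C i l * v' l) = - (C i l0 * s / C n l0) + (\<Sum>l\<in>?I. C i l * v l)" for i
    proof -
      have "(\<Sum>l\<in>I. C i l * v' l) = C i l0 * v' l0 + (\<Sum>l\<in>?I. C i l * v' l)"
        using Suc.prems l0 by (simp add: sum.remove)
      also have "(\<Sum>l\<in>?I. C i l * v' l) = (\<Sum>l\<in>?I. C i l * v l)" by (intro sum.cong) (auto simp: v'_def)
      finally show ?thesis by (simp add: v'_def)
    qed
    have "(\<Sum>l\<in>I. C i l * v' l) = 0" if "i < n" for i
    proof -
      have "(\<Sum>l\<in>?I. (C i l - C i l0 * C n l / C n l0) * v l)
          = (\<Sum>l\<in>?I. C i l * v l) - C i l0 / C n l0 * s"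
        unfolding s_def sum_distrib_left sum_subtractf[symmetric]
        by (intro sum.cong refl) (simp add: algebra_simps)
      thus ?thesis using v(2) that by (simp add: sum)
    qed
    moreover have "(\<Sum>l\<in>I. C n l * v' l) = 0" using l0 by (simp add: sum s_def)
    moreover have "\<exists>l\<in>I. v' l \<noteq> 0" using v(1) by (auto simp: v'_def)
    ultimately show ?thesis by (intro exI[of _ v']) (auto simp: less_Suc_eq)
  qed
qed

lemma identity_approx_factor_imp_le:
  fixes D :: "nat \<Rightarrow> nat \<Rightarrow> complex"
  assumes appr: "\<And>j l. j < m \<Longrightarrow> l < m \<Longrightarrow> cmod ((if l = j then 1 else 0) - (\<Sum>i<n. D j i * C i l)) \<le> e"
    and e: "real m * e < 1"
  shows "m \<le> n"
proof (rule ccontr)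
  assume "\<not> m \<le> n"
  then obtain v where v: "\<exists>l\<in>{..<m}. v l \<noteq> 0" "\<forall>i<n. (\<Sum>l<m. C i l * v l) = 0"
    using homogeneous_system_solution[of "{..<m}" n C] by auto
  define V where "V = Max ((\<lambda>l. cmod (v l)) ` {..<m})"
  have ne: "(\<lambda>l. cmod (v l)) ` {..<m} \<noteq> {}" using v(1) by auto
  have V: "cmod (v l) \<le> V" if "l < m" for l unfolding V_def using that by (intro Max_ge) auto
  have "V \<in> (\<lambda>l. cmod (v l)) ` {..<m}" unfolding V_def using ne by (intro Max_in) auto
  then obtain j where j: "j < m" "V = cmod (v j)" by auto
  have pos: "V > 0" using v(1) V by (meson lessThan_iff less_le_trans zero_less_norm_iff)
  have "(\<Sum>l<m. ((if l = j then 1 else 0) - (\<Sum>i<n. D j i * C i l)) * v l)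
      = (\<Sum>l<m. (if l = j then v l else 0)) - (\<Sum>l<m. \<Sum>i<n. D j i * (C i l * v l))"
    unfolding sum_subtractf[symmetric]
    by (intro sum.cong refl) (simp add: left_diff_distrib sum_distrib_right mult.assoc)
  also have "(\<Sum>l<m. \<Sum>i<n. D j i * (C i l * v l)) = (\<Sum>i<n. D j i * (\<Sum>l<m. C i l * v l))"
    unfolding sum_distrib_left by (rule sum.swap)
  also have "\<dots> = 0" using v(2) by simp
  finally have vj: "v j = (\<Sum>l<m. ((if l = j then 1 else 0) - (\<Sum>i<n. D j i * C i l)) * v l)"
    using j by simp
  have "V = cmod (\<Sum>l<m. ((if l = j then 1 else 0) - (\<Sum>i<n. D j i * C i l)) * v l)"
    unfolding j(2) by (rule arg_cong[OF vj])
  also have "\<dots> \<le> (\<Sum>l<m. cmod (((if l = j then 1 else 0) - (\<Sum>i<n. D j i * C i l)) * v l))"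
    by (rule norm_sum)
  also have "\<dots> \<le> (\<Sum>l<m. e * V)"
    unfolding norm_mult using j appr V pos by (intro sum_mono mult_mono) (auto intro: order_trans[OF norm_ge_zero])
  also have "\<dots> = (real m * e) * V" by simp
  also have "\<dots> < 1 * V" using e pos by (intro mult_strict_right_mono)
  finally show False by simp
qed

context prob_space
begin

lemma Linf_finsum_class:
  fixes n :: nat
  assumes "\<And>i. i < n \<Longrightarrow> ess_bounded M (f i)"
  shows "ess_bounded M (\<lambda>x. \<Sum>i<n. f i x) \<and>
     finsum (Linf M) (\<lambda>i. ae_class M (f i)) {..<n} = ae_class M (\<lambda>x. \<Sum>i<n. f i x)"
  using assms
proof (induction n)
  interpret cring "Linf M" by (rule Linf_cring)
  case 0
  show ?case by (simp add: Linf_simps)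
next
  interpret cring "Linf M" by (rule Linf_cring)
  case (Suc n)
  have IH: "ess_bounded M (\<lambda>x. \<Sum>i<n. f i x)"
     "finsum (Linf M) (\<lambda>i. ae_class M (f i)) {..<n} = ae_class M (\<lambda>x. \<Sum>i<n. f i x)" using Suc by auto
  have fn: "ess_bounded M (f n)" using Suc.prems by simp
  have "finsum (Linf M) (\<lambda>i. ae_class M (f i)) {..<Suc n} = ae_class M (f n) \<oplus>\<^bsub>Linf M\<^esub> finsum (Linf M) (\<lambda>i. ae_class M (f i)) {..<n}"
    using Suc.prems by (intro finsum_lessThan_Suc) auto
  thus ?case using IH fn ess_bounded_add[OF IH(1) fn]
    by (simp add: Linf_simps(3) ae_map2_class ess_bounded_measurable add.commute)
qed

lemma Linf_identity_factor_imp_le: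
  assumes d: "\<And>j i. j < m \<Longrightarrow> i < n \<Longrightarrow> d j i \<in> carrier (Linf M)"
    and c: "\<And>i l. i < n \<Longrightarrow> l < m \<Longrightarrow> c i l \<in> carrier (Linf M)"
    and nrm: "\<And>j l. j < m \<Longrightarrow> l < m \<Longrightarrow> nrm L2.BH (mult_op M (identity_defect (Linf M) n d c j l)) \<le> e"
    and e: "e \<ge> 0" "real m * e < 1"
  shows "m \<le> n"
proof -
  interpret cring "Linf M" by (rule Linf_cring)
  define D where "D j i = (SOME f. ess_bounded M f \<and> d j i = ae_class M f)" for j i
  define C where "C i l = (SOME f. ess_bounded M f \<and> c i l = ae_class M f)" for i l
  have D: "ess_bounded M (D j i)" "d j i = ae_class M (D j i)" if "j < m" "i < n" for j i
  proof -
    have "\<exists>f. ess_bounded M f \<and> d j i = ae_class M f" using d[OF that] by (auto simp: carrier_Linf)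
    from someI_ex[OF this, folded D_def] show "ess_bounded M (D j i)" "d j i = ae_class M (D j i)" by simp_all
  qed
  have C: "ess_bounded M (C i l)" "c i l = ae_class M (C i l)" if "i < n" "l < m" for i l
  proof -
    have "\<exists>f. ess_bounded M f \<and> c i l = ae_class M f" using c[OF that] by (auto simp: carrier_Linf)
    from someI_ex[OF this, folded C_def] show "ess_bounded M (C i l)" "c i l = ae_class M (C i l)" by simp_all
  qed
  have ae: "AE x in M. cmod ((if l = j then 1 else 0) - (\<Sum>i<n. D j i x * C i l x)) \<le> e" if jl: "j < m" "l < m" for j l
  proof -
    let ?s = "\<lambda>x. \<Sum>i<n. D j i x * C i l x" and ?\<delta> = "if l = j then 1 else 0 :: complex"
    have DC: "ess_bounded M (\<lambda>x. D j i x * C i l x)" if "i < n" for i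
      using D(1)[OF jl(1) that] C(1)[OF that jl(2)] by (rule ess_bounded_mult)
    have s: "ess_bounded M ?s" and s': "finsum (Linf M) (\<lambda>i. ae_class M (\<lambda>x. D j i x * C i l x)) {..<n} = ae_class M ?s"
      using Linf_finsum_class[of n "\<lambda>i x. D j i x * C i l x"] DC by auto
    have "finsum (Linf M) (\<lambda>i. d j i \<otimes>\<^bsub>Linf M\<^esub> c i l) {..<n} = finsum (Linf M) (\<lambda>i. ae_class M (\<lambda>x. D j i x * C i l x)) {..<n}"
    proof (rule finsum_cong')
      fix i assume "i \<in> {..<n}"
      hence i: "i < n" by simp
      show "d j i \<otimes>\<^bsub>Linf M\<^esub> c i l = ae_class M (\<lambda>x. D j i x * C i l x)"
        using D[OF jl(1) i] C[OF i jl(2)] by (simp add: Linf_simps(4) ae_map2_class ess_bounded_measurable)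
    qed (use DC in auto)
    note fs = this[unfolded s']
    have one: "(if l = j then \<one>\<^bsub>Linf M\<^esub> else \<zero>\<^bsub>Linf M\<^esub>) = ae_class M (\<lambda>_. ?\<delta>)" by (simp add: Linf_simps)
    have ms: "ess_bounded M (\<lambda>x. -1 * 1 * ?s x)" using ess_bounded_mult[OF ess_bounded_const s, of "-1 * 1"] by simp
    have "identity_defect (Linf M) n d c j l = ae_class M (\<lambda>x. ?\<delta> + -1 * 1 * ?s x)"
      unfolding identity_defect_def one fs unfolding Linf_simps using ms s by (simp add: ae_map_class ae_map2_class ess_bounded_measurable)
    also have "\<dots> = ae_class M (\<lambda>x. ?\<delta> - ?s x)" by simp
    finally have eq: "nrm L2.BH (mult_op M (ae_class M (\<lambda>x. ?\<delta> - ?s x))) \<le> e" using nrm[OF jl] by (simp only:)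
    have b: "ess_bounded M (\<lambda>x. ?\<delta> - ?s x)" using ess_bounded_add[OF ess_bounded_const ms, of ?\<delta>] by simp
    show ?thesis
    proof (rule mult_op_le_imp_AE[OF b e(1)])
      fix G assume G: "G \<in> carrier (L2 M)"
      have "hnorm (L2 M) (mult_op M (ae_class M (\<lambda>x. ?\<delta> - ?s x)) G) \<le> nrm L2.BH (mult_op M (ae_class M (\<lambda>x. ?\<delta> - ?s x))) * hnorm (L2 M) G"
        using G b by (intro L2.nrm_op mult_op_closed) auto
      also have "\<dots> \<le> e * hnorm (L2 M) G" using eq G by (intro mult_right_mono) auto
      finally show "hnorm (L2 M) (mult_op M (ae_class M (\<lambda>x. ?\<delta> - ?s x)) G) \<le> e * hnorm (L2 M) G" .
    qed
  qed
  have "AE x in M. \<forall>p\<in>{..<m} \<times> {..<m}. cmod ((if snd p = fst p then 1 else 0) - (\<Sum>i<n. D (fst p) i x * C i (snd p) x)) \<le> e"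
    by (intro AE_finite_allI ae) auto
  then obtain x where "\<forall>p\<in>{..<m} \<times> {..<m}. cmod ((if snd p = fst p then 1 else 0) - (\<Sum>i<n. D (fst p) i x * C i (snd p) x)) \<le> e"
    using eventually_happens'[OF ae_filter_bot[unfolded trivial_limit_def[symmetric]]] by blast
  thus "m \<le> n" using e by (intro identity_approx_factor_imp_le[where D = "\<lambda>j i. D j i x" and C = "\<lambda>i l. C i l x" and e = e]) auto
qed

end

section \<open>Complete isometries\<close>

lemma (in complex_hilbert_space) op_matrix_norm_1:
  assumes T: "T 0 0 \<in> bounded_op_set H"
  shows "op_matrix_norm H 1 T = nrm BH (T 0 0)"
proof -
  let ?X = "{\<xi> \<in> {..<1::nat} \<rightarrow>\<^sub>E carrier H. (\<Sum>j<1. (hnorm H (\<xi> j))\<^sup>2) \<le> 1}"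
  have val: "sqrt (\<Sum>i<1::nat. (hnorm H (finsum H (\<lambda>j. T i j (\<xi> j)) {..<1}))\<^sup>2) = hnorm H (T 0 0 (\<xi> 0))"
    if "\<xi> 0 \<in> carrier H" for \<xi>
  proof -
    have "finsum H (\<lambda>j. T 0 j (\<xi> j)) {..<1} = T 0 0 (\<xi> 0)"
      using M.finsum_lessThan_Suc[of 0 "\<lambda>j. T 0 j (\<xi> j)"] T that by simp
    thus ?thesis using T that by simp
  qed
  have sq: "a\<^sup>2 \<le> 1 \<longleftrightarrow> a \<le> 1" if "a \<ge> 0" for a :: real using that by (simp add: abs_square_le_1)
  have "(\<lambda>\<xi>. sqrt (\<Sum>i<1::nat. (hnorm H (finsum H (\<lambda>j. T i j (\<xi> j)) {..<1}))\<^sup>2)) ` ?X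
      = (\<lambda>x. hnorm H (T 0 0 x)) ` {x \<in> carrier H. hnorm H x \<le> 1}" (is "?L = ?R")
  proof
    show "?L \<subseteq> ?R"
    proof
      fix v assume "v \<in> ?L"
      then obtain \<xi> where \<xi>: "\<xi> \<in> ?X" "v = sqrt (\<Sum>i<1::nat. (hnorm H (finsum H (\<lambda>j. T i j (\<xi> j)) {..<1}))\<^sup>2)" by blast
      hence "\<xi> 0 \<in> carrier H" by (auto simp: PiE_iff)
      moreover from this have "hnorm H (\<xi> 0) \<le> 1" using \<xi>(1) sq[of "hnorm H (\<xi> 0)"] by simp
      ultimately show "v \<in> ?R" using \<xi>(2) val[of \<xi>] by (intro image_eqI[of _ _ "\<xi> 0"]) simp_all
    qed
    show "?R \<subseteq> ?L"
    proof
      fix v assume "v \<in> ?R"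
      then obtain x where x: "x \<in> carrier H" "hnorm H x \<le> 1" "v = hnorm H (T 0 0 x)" by blast
      let ?\<xi> = "\<lambda>j\<in>{..<1::nat}. x"
      have a: "?\<xi> \<in> ?X" using x sq[of "hnorm H x"] by auto
      have b: "v = sqrt (\<Sum>i<1::nat. (hnorm H (finsum H (\<lambda>j. T i j (?\<xi> j)) {..<1}))\<^sup>2)"
        using val[of ?\<xi>] x by simp
      show "v \<in> ?L" unfolding image_iff by (rule bexI[of _ ?\<xi>]) (fact a b)+
    qed
  qed
  thus ?thesis unfolding op_matrix_norm_def nrm_bounded_ops by (rule arg_cong[of _ _ Sup])
qed

lemma (in stacey_universal) stacey_matrix_norm_1:
  assumes x: "x \<in> carrier U"
  shows "stacey_matrix_norm A \<alpha> n 1 (\<lambda>_ _. x) = nrm U x"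
  unfolding stacey_matrix_norm_def stacey_ambient_def nrm_cstar_prod
proof (rule SUP_cong[OF refl])
  fix r assume rR: "r \<in> stacey_reps A \<alpha> n"
  then obtain H \<pi> Q where r: "r = (H, \<pi>, Q)" "stacey_rep A \<alpha> H \<pi> Q n" by (rule rep_cases)
  interpret stacey_rep A \<alpha> H \<pi> Q n by (rule r)
  show "op_matrix_norm (fst r) 1 (\<lambda>i j. x r) = nrm (bounded_ops (fst r)) (x r)"
    using Hil.op_matrix_norm_1[of "\<lambda>i j. x r"] U_coord[OF x rep] r by simp
qed

lemma alg_hom_inv_into:
  assumes hom: "alg_hom A B \<Phi>" and bij: "bij_betw \<Phi> (carrier A) (carrier B)"
    and cl: "\<And>x y. x \<in> carrier A \<Longrightarrow> y \<in> carrier A \<Longrightarrow> x \<oplus>\<^bsub>A\<^esub> y \<in> carrier A"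
      "\<And>x y. x \<in> carrier A \<Longrightarrow> y \<in> carrier A \<Longrightarrow> x \<otimes>\<^bsub>A\<^esub> y \<in> carrier A"
      "\<And>c x. x \<in> carrier A \<Longrightarrow> c \<odot>\<^bsub>A\<^esub> x \<in> carrier A"
  shows "alg_hom B A (inv_into (carrier A) \<Phi>)"
proof -
  let ?\<Psi> = "inv_into (carrier A) \<Phi>"
  have \<Psi>: "?\<Psi> y \<in> carrier A" "\<Phi> (?\<Psi> y) = y" if "y \<in> carrier B" for y
    using that bij by (metis bij_betw_def inv_into_into, metis bij_betw_inv_into_right)
  have I: "?\<Psi> (\<Phi> x) = x" if "x \<in> carrier A" for x using that bij by (rule bij_betw_inv_into_left[rotated])
  have \<Phi>: "\<And>x y. x \<in> carrier A \<Longrightarrow> y \<in> carrier A \<Longrightarrow> \<Phi> (x \<oplus>\<^bsub>A\<^esub> y) = \<Phi> x \<oplus>\<^bsub>B\<^esub> \<Phi> y"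
    "\<And>x y. x \<in> carrier A \<Longrightarrow> y \<in> carrier A \<Longrightarrow> \<Phi> (x \<otimes>\<^bsub>A\<^esub> y) = \<Phi> x \<otimes>\<^bsub>B\<^esub> \<Phi> y"
    "\<And>c x. x \<in> carrier A \<Longrightarrow> \<Phi> (c \<odot>\<^bsub>A\<^esub> x) = c \<odot>\<^bsub>B\<^esub> \<Phi> x"
    using hom by (auto simp: alg_hom_def)
  show ?thesis
    unfolding alg_hom_def
  proof (intro conjI ballI allI)
    show "?\<Psi> \<in> carrier B \<rightarrow> carrier A" using \<Psi> by blast
    fix x y assume x: "x \<in> carrier B" and y: "y \<in> carrier B"
    show "?\<Psi> (x \<oplus>\<^bsub>B\<^esub> y) = ?\<Psi> x \<oplus>\<^bsub>A\<^esub> ?\<Psi> y"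
      using I[OF cl(1)[OF \<Psi>(1)[OF x] \<Psi>(1)[OF y]]] \<Phi>(1)[OF \<Psi>(1)[OF x] \<Psi>(1)[OF y]] \<Psi>(2)[OF x] \<Psi>(2)[OF y] by simp
    show "?\<Psi> (x \<otimes>\<^bsub>B\<^esub> y) = ?\<Psi> x \<otimes>\<^bsub>A\<^esub> ?\<Psi> y"
      using I[OF cl(2)[OF \<Psi>(1)[OF x] \<Psi>(1)[OF y]]] \<Phi>(2)[OF \<Psi>(1)[OF x] \<Psi>(1)[OF y]] \<Psi>(2)[OF x] \<Psi>(2)[OF y] by simp
  next
    fix c x assume x: "x \<in> carrier B"
    show "?\<Psi> (c \<odot>\<^bsub>B\<^esub> x) = c \<odot>\<^bsub>A\<^esub> ?\<Psi> x"
      using I[OF cl(3)[OF \<Psi>(1)[OF x]], of c] \<Phi>(3)[OF \<Psi>(1)[OF x], of c] \<Psi>(2)[OF x] by simp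
  qed
qed

context prob_space
begin

lemma reps_nonempty_if_inj:
  assumes S: "L2_stacey_rep M \<alpha> n S" and inj: "inj_on \<Phi> X"
    and X: "\<And>F. F \<in> carrier (Linf M) \<Longrightarrow> stacey_incl (Linf M) \<alpha> n F \<in> X"
    and fixes_A: "\<And>F. F \<in> carrier (Linf M) \<Longrightarrow> \<Phi> (stacey_incl (Linf M) \<alpha> n F) = stacey_incl (Linf M) \<alpha> m F"
  shows "stacey_reps (Linf M) \<alpha> m \<noteq> {}"
proof
  assume "stacey_reps (Linf M) \<alpha> m = {}"
  hence eq: "stacey_incl (Linf M) \<alpha> m F = stacey_incl (Linf M) \<alpha> m G" for F G by (simp add: stacey_incl_def restrict_def)
  have z: "\<zero>\<^bsub>Linf M\<^esub> \<in> carrier (Linf M)" "\<one>\<^bsub>Linf M\<^esub> \<in> carrier (Linf M)" by (auto simp: Linf_simps)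
  have "stacey_incl (Linf M) \<alpha> n \<zero>\<^bsub>Linf M\<^esub> = stacey_incl (Linf M) \<alpha> n \<one>\<^bsub>Linf M\<^esub>"
    using inj_onD[OF inj _ X[OF z(1)] X[OF z(2)]] fixes_A z eq by metis
  from fun_cong[OF this, of "(L2 M, mult_op M, S)"] have "mult_op M \<zero>\<^bsub>Linf M\<^esub> = mult_op M \<one>\<^bsub>Linf M\<^esub>"
    using L2_rep_mem[OF S] by (simp add: stacey_incl_def)
  hence "mult_op M \<zero>\<^bsub>Linf M\<^esub> unit_vector = unit_vector" using unit_vector(1) by (simp add: mult_op_one)
  moreover have "mult_op M \<zero>\<^bsub>Linf M\<^esub> unit_vector = \<zero>\<^bsub>L2 M\<^esub>"
    by (simp add: Linf_simps L2_simps mult_op_class square_integrable_def)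
  ultimately show False using unit_vector L2.hnorm_zero by simp
qed

lemma completely_isometric_imp_eq:
  assumes sys: "stacey_system (Linf M) \<alpha>" and S: "L2_stacey_rep M \<alpha> n S"
    and iso: "alg_iso (semicrossed_product (Linf M) \<alpha> n) (semicrossed_product (Linf M) \<alpha> m) \<Phi>"
    and ci: "completely_isometric_on_semicrossed (Linf M) \<alpha> n m \<Phi>"
    and fixes_A: "\<And>F. F \<in> carrier (Linf M) \<Longrightarrow> \<Phi> (stacey_incl (Linf M) \<alpha> n F) = stacey_incl (Linf M) \<alpha> m F"
  shows "n = m"
proof -
  interpret stacey_system "Linf M" \<alpha> by (rule sys)
  have r0: "(L2 M, mult_op M, S) \<in> stacey_reps (Linf M) \<alpha> n" using S by (rule L2_rep_mem)
  let ?C = "semicrossed_product (Linf M) \<alpha> n" and ?D = "semicrossed_product (Linf M) \<alpha> m"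
  have hom: "alg_hom ?C ?D \<Phi>" and bij: "bij_betw \<Phi> (carrier ?C) (carrier ?D)" using iso by (auto simp: alg_iso_def)
  have \<iota>C: "stacey_incl (Linf M) \<alpha> k F \<in> carrier (semicrossed_product (Linf M) \<alpha> k)" if "F \<in> carrier (Linf M)" for F k
    using that by (auto intro: hull_inc stacey_incl_gens)
  have onto: "\<Phi> ` carrier ?C = carrier ?D" and inj: "inj_on \<Phi> (carrier ?C)" using bij by (simp_all only: bij_betw_def)
  have ne: "stacey_reps (Linf M) \<alpha> n \<noteq> {}" "stacey_reps (Linf M) \<alpha> m \<noteq> {}"
    using r0 reps_nonempty_if_inj[OF S inj \<iota>C fixes_A] by auto
  interpret N: stacey_universal "Linf M" \<alpha> n by unfold_locales (rule ne)
  interpret K: stacey_universal "Linf M" \<alpha> m by unfold_locales (rule ne)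
  have \<Phi>_cl: "\<Phi> x \<in> carrier ?D" if "x \<in> carrier ?C" for x using hom that by (auto simp: alg_hom_def)
  have isom: "nrm K.U (\<Phi> x) = nrm N.U x" if x: "x \<in> carrier ?C" for x
  proof -
    have "stacey_matrix_norm (Linf M) \<alpha> m 1 (\<lambda>_ _. \<Phi> x) = stacey_matrix_norm (Linf M) \<alpha> n 1 (\<lambda>_ _. x)"
      by (rule ci[unfolded completely_isometric_on_semicrossed_def, rule_format, of 1 "\<lambda>_ _. x"]) (rule x)
    moreover have "x \<in> carrier N.U" "\<Phi> x \<in> carrier K.U"
      using x \<Phi>_cl[OF x] N.carrier_semicrossed_product K.carrier_semicrossed_product by blast+
    ultimately show ?thesis by (simp only: N.stacey_matrix_norm_1 K.stacey_matrix_norm_1)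
  qed
  let ?\<Psi> = "inv_into (carrier ?C) \<Phi>"
  have hom': "alg_hom ?D ?C ?\<Psi>"
    by (rule alg_hom_inv_into[OF hom bij]) (use closed_subalgebra_hull_closed in auto)
  have onto': "?\<Psi> ` carrier ?D = carrier ?C"
    using bij_betw_inv_into[OF bij] by (simp only: bij_betw_def)
  have \<Psi>\<Phi>: "?\<Psi> (\<Phi> x) = x" if "x \<in> carrier ?C" for x using bij_betw_inv_into_left[OF bij that] .
  have isom': "nrm N.U (?\<Psi> y) = nrm K.U y" if y: "y \<in> carrier ?D" for y
  proof -
    have "y \<in> \<Phi> ` carrier ?C" using y by (simp only: onto)
    then obtain x where "y = \<Phi> x" "x \<in> carrier ?C" by (rule imageE)
    thus ?thesis using isom[of x] \<Psi>\<Phi>[of x] by simp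
  qed
  have fixes': "?\<Psi> (K.\<iota> F) = N.\<iota> F" if "F \<in> carrier (Linf M)" for F
    using \<Psi>\<Phi>[OF \<iota>C[OF that]] fixes_A[OF that] by simp
  have coord: "nrm L2.BH (mult_op M F) \<le> nrm N.U (N.\<iota> F)" if "F \<in> carrier (Linf M)" for F
    using N.U_nrm_coord[OF N.\<iota>_closed[OF that] r0] by (simp add: N.U_apply[OF r0])
  define e where "e k = 1 / (real k + 1)" for k
  have e: "e k > 0" "e k \<ge> 0" "real k * e k < 1" for k by (auto simp: e_def)
  have "m \<le> n"
  proof -
    obtain d c where d: "\<forall>j<m. \<forall>i<n. d j i \<in> carrier (Linf M)" and c: "\<forall>i<n. \<forall>l<m. c i l \<in> carrier (Linf M)"
      and b: "\<forall>j<m. \<forall>l<m. nrm K.U (K.\<iota> (identity_defect (Linf M) n d c j l)) \<le> e m"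
      using identity_matrix_factors[OF ne hom onto isom fixes_A e(1)[of m]] by blast
    show "m \<le> n"
    proof (rule Linf_identity_factor_imp_le[where d = d and c = c and e = "e m"])
      fix j l assume jl: "j < m" "l < m"
      let ?X = "identity_defect (Linf M) n d c j l"
      have X: "?X \<in> carrier (Linf M)" using jl d c by (intro identity_defect_closed) auto
      have "nrm L2.BH (mult_op M ?X) \<le> nrm N.U (N.\<iota> ?X)" by (rule coord[OF X])
      also have "\<dots> = nrm K.U (K.\<iota> ?X)" using isom[OF \<iota>C[OF X]] fixes_A[OF X] by simp
      also have "\<dots> \<le> e m" using b jl by blast
      finally show "nrm L2.BH (mult_op M ?X) \<le> e m" .
    qed (use d c e in auto)
  qed
  moreover have "n \<le> m"
  proof -
    obtain d c where d: "\<forall>j<n. \<forall>i<m. d j i \<in> carrier (Linf M)" and c: "\<forall>i<m. \<forall>l<n. c i l \<in> carrier (Linf M)"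
      and b: "\<forall>j<n. \<forall>l<n. nrm N.U (N.\<iota> (identity_defect (Linf M) m d c j l)) \<le> e n"
      using identity_matrix_factors[OF ne(2,1) hom' onto' isom' fixes' e(1)[of n]] by blast
    show "n \<le> m"
    proof (rule Linf_identity_factor_imp_le[where d = d and c = c and e = "e n"])
      fix j l assume jl: "j < n" "l < n"
      let ?X = "identity_defect (Linf M) m d c j l"
      have X: "?X \<in> carrier (Linf M)" using jl d c by (intro identity_defect_closed) auto
      have "nrm L2.BH (mult_op M ?X) \<le> nrm N.U (N.\<iota> ?X)" by (rule coord[OF X])
      also have "\<dots> \<le> e n" using b jl by blast
      finally show "nrm L2.BH (mult_op M ?X) \<le> e n" .
    qed (use d c e in auto)
  qed
  ultimately show "n = m" by simp
qed

end

theorem corollary4p6: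
  fixes M :: "'a::t2_space measure"
    and \<alpha> :: "('a \<Rightarrow> complex) set \<Rightarrow> ('a \<Rightarrow> complex) set"
    and S :: "nat \<Rightarrow> ('a \<Rightarrow> complex) set \<Rightarrow> ('a \<Rightarrow> complex) set"
    and n m :: nat
  assumes "compact (UNIV :: 'a set)"
    and "prob_space M" and "regular_borel M"
    and "star_hom (Linf M) (Linf M) \<alpha>"
    and "\<alpha> \<one>\<^bsub>Linf M\<^esub> = \<one>\<^bsub>Linf M\<^esub>"
    and "\<forall>F\<in>carrier (Linf M). nrm (Linf M) (\<alpha> F) = nrm (Linf M) F"
    and "continuous_map (weak_star_topology M) (weak_star_topology M) \<alpha>"
    and "n \<ge> 1" and "m \<ge> 1"
    and "L2_stacey_rep M \<alpha> n S"
  shows "((\<exists>\<Phi>. star_iso (stacey_crossed_product (Linf M) \<alpha> n)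
                        (stacey_crossed_product (Linf M) \<alpha> m) \<Phi> \<and>
               (\<forall>F\<in>carrier (Linf M). \<Phi> (stacey_incl (Linf M) \<alpha> n F) = stacey_incl (Linf M) \<alpha> m F))
           \<longleftrightarrow> (\<exists>Q. L2_stacey_rep M \<alpha> m Q))
         \<and> ((\<exists>Q. L2_stacey_rep M \<alpha> m Q) \<longleftrightarrow> n = m)
         \<and> (n = m \<longleftrightarrow>
             (\<exists>\<Phi>. alg_iso (semicrossed_product (Linf M) \<alpha> n)
                           (semicrossed_product (Linf M) \<alpha> m) \<Phi> \<and>
               completely_isometric_on_semicrossed (Linf M) \<alpha> n m \<Phi> \<and>
               (\<forall>F\<in>carrier (Linf M). \<Phi> (stacey_incl (Linf M) \<alpha> n F) = stacey_incl (Linf M) \<alpha> m F)))"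
    (is "(?iso \<longleftrightarrow> ?rep) \<and> (?rep \<longleftrightarrow> n = m) \<and> (n = m \<longleftrightarrow> ?semi)")
proof -
  interpret prob_space M by fact
  have sys: "stacey_system (Linf M) \<alpha>" by (rule Linf_system) fact+
  have S: "L2_stacey_rep M \<alpha> n S" by fact
  have rep_eq: "n = m" if ?rep
    using that L2_rep_multiplicity_unique[OF sys S] by blast
  have iso_rep: ?rep if iso: ?iso
  proof -
    obtain \<Phi> where \<Phi>: "star_iso (stacey_crossed_product (Linf M) \<alpha> n) (stacey_crossed_product (Linf M) \<alpha> m) \<Phi>"
      and fixes_A: "\<And>F. F \<in> carrier (Linf M) \<Longrightarrow> \<Phi> (stacey_incl (Linf M) \<alpha> n F) = stacey_incl (Linf M) \<alpha> m F"
      using iso by blast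
    have "stacey_reps (Linf M) \<alpha> m \<noteq> {}"
    proof (rule reps_nonempty_if_inj[OF S _ _ fixes_A])
      show "inj_on \<Phi> (carrier (stacey_crossed_product (Linf M) \<alpha> n))"
        using \<Phi> by (simp only: star_iso_def bij_betw_def)
    qed (auto intro: hull_inc stacey_incl_gens)
    from star_iso_imp_L2_rep[OF sys S this \<Phi> fixes_A] show ?rep .
  qed
  have eq_iso: ?iso if "n = m"
    using that by (intro exI[of _ id]) (auto simp: star_iso_def star_hom_def alg_hom_def)
  have eq_semi: ?semi if "n = m"
    using that by (intro exI[of _ id]) (auto simp: alg_iso_def alg_hom_def completely_isometric_on_semicrossed_def)
  have semi_eq: "n = m" if semi: ?semi
    using semi completely_isometric_imp_eq[OF sys S] by blast
  show ?thesis using rep_eq iso_rep eq_iso eq_semi semi_eq by blast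
qed

end
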